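(* $\Lambda_m:L(\log L)^n(\mathbb{T})\to L(\log L)^{n-1}(\mathbb{T})$ for any Marcinkiewicz multiplier $m:\mathbb{R}\to\mathbb{C}$ and any $n\in\mathbb{N}=\{1,2,\dots\}$.
   Context: $\mathbb{T}=\mathbb{R}/\mathbb{Z}$ with Lebesgue (probability) measure; $\widehat f(k)=\int_{\mathbb{T}}f(x)e^{-2\pi ikx}\,dx$ for $k\in\mathbb{Z}$. A function $m:\mathbb{R}\to\mathbb{C}$ that is smooth away from $0$ and uniformly bounded (everywhere, including at $0$) is a Marcinkiewicz multiplier if $|m^{(l)}(t)|\lesssim|t|^{-l}$ for $0\le l\le4$, where $A\lesssim B$ means $A\le CB$ for some constant $C$. For $f\in L^1(\mathbb{T})$, the operator is defined by $\Lambda_mf(x)=\sum_{t\in\mathbb{Z}}m(t)\widehat f(t)e^{2\pi itx}$. On a probability space $(X,\rho)$, for $f:X\to\mathbb{C}$, let $f^*(t)=\inf\{\lambda\ge0:\rho\{|f|>\lambda\}\le t\}$, $f^{( *,1)}=f^*$, and $f^{( *,n)}(t)=\frac1t\int_0^tf^{( *,n-1)}(u)\,du$ for integers $n\ge2$. For integers $n\ge0$, $\|f\|_{L(\log L)^n}=\int_0^1f^{( *,n+1)}(t)\,dt$, and $L(\log L)^n(X)$ is the set of $f$ with finite norm (so $L(\log L)^0=L^1$). Writing $T:X\to Y$ means that $T$ maps boundedly: there is a constant $C$ with $\|Tf\|_Y\le C\|f\|_X$ for all $f$. *)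

theory Defs
  imports "HOL-Probability.Probability"
begin

definition rearrangement :: "'a measure \<Rightarrow> ('a \<Rightarrow> complex) \<Rightarrow> real \<Rightarrow> ennreal" where
  "rearrangement M f t =
     Inf {ennreal u | u. 0 \<le> u \<and> emeasure M {x \<in> space M. u < norm (f x)} \<le> ennreal t}"

text \<open>\<open>rearr_iter M f n\<close> is $f^{(*,n)}$ for $n \ge 1$; the value at \<open>n = 0\<close> is a dummy.\<close>

primrec rearr_iter :: "'a measure \<Rightarrow> ('a \<Rightarrow> complex) \<Rightarrow> nat \<Rightarrow> real \<Rightarrow> ennreal" where
  "rearr_iter M f 0 = (\<lambda>t. 0)"
| "rearr_iter M f (Suc n) =
     (if n = 0 then rearrangement M f
      else (\<lambda>t. (\<integral>\<^sup>+ u \<in> {0..t}. rearr_iter M f n u \<partial>lborel) / ennreal t))"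

definition LlogL_norm :: "'a measure \<Rightarrow> nat \<Rightarrow> ('a \<Rightarrow> complex) \<Rightarrow> ennreal" where
  "LlogL_norm M n f = (\<integral>\<^sup>+ t \<in> {0..1}. rearr_iter M f (n + 1) t \<partial>lborel)"

definition LlogL :: "'a measure \<Rightarrow> nat \<Rightarrow> ('a \<Rightarrow> complex) set" where
  "LlogL M n = {f \<in> borel_measurable M. LlogL_norm M n f < \<infinity>}"

text \<open>$\mathbb{R}/\mathbb{Z}$ is modelled by its fundamental domain \<open>{0..<1}\<close>; only the values
  of a function on that interval matter.\<close>

definition circle :: "real measure" where
  "circle = lebesgue_on {0..<1}"

lemma prob_space_circle: "prob_space circle"
  by (rule prob_spaceI) (simp add: circle_def space_restrict_space emeasure_restrict_space)

definition char_fun :: "int \<Rightarrow> real \<Rightarrow> complex" where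
  "char_fun k x = exp (2 * of_real pi * \<i> * of_int k * of_real x)"

definition fourier_coeff :: "(real \<Rightarrow> complex) \<Rightarrow> int \<Rightarrow> complex" where
  "fourier_coeff f k = (LINT x|circle. f x * char_fun (- k) x)"

definition iter_deriv :: "nat \<Rightarrow> (real \<Rightarrow> complex) \<Rightarrow> real \<Rightarrow> complex" where
  "iter_deriv l f = ((\<lambda>g t. vector_derivative g (at t)) ^^ l) f"

text \<open>Intended for open \<open>S\<close>, as the derivatives are two-sided.\<close>

definition smooth_on :: "real set \<Rightarrow> (real \<Rightarrow> complex) \<Rightarrow> bool" where
  "smooth_on S f \<longleftrightarrow> (\<forall>l. \<forall>t\<in>S. iter_deriv l f differentiable at t)"

definition marcinkiewicz_multiplier :: "(real \<Rightarrow> complex) \<Rightarrow> bool" where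
  "marcinkiewicz_multiplier m \<longleftrightarrow>
     smooth_on (- {0}) m \<and>
     (\<exists>B. \<forall>t. norm (m t) \<le> B) \<and>
     (\<exists>C. \<forall>l\<le>4. \<forall>t. t \<noteq> 0 \<longrightarrow> norm (iter_deriv l m t) \<le> C / \<bar>t\<bar> ^ l)"

definition test_function :: "(real \<Rightarrow> complex) \<Rightarrow> bool" where
  "test_function \<phi> \<longleftrightarrow> smooth_on UNIV \<phi> \<and> (\<forall>x. \<phi> (x + 1) = \<phi> x)"

text \<open>For $f \in L^1$ the series $\sum_t m(t) \widehat f(t) e^{2\pi i t x}$ need not converge
  pointwise; it is always a convergent series of periodic distributions.  \<open>multiplier_op m f g\<close>
  says that its distributional sum $\Lambda_m f$ is the integrable function \<open>g\<close>, which is thereby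
  determined almost everywhere.\<close>

definition multiplier_op ::
    "(real \<Rightarrow> complex) \<Rightarrow> (real \<Rightarrow> complex) \<Rightarrow> (real \<Rightarrow> complex) \<Rightarrow> bool" where
  "multiplier_op m f g \<longleftrightarrow>
     integrable circle f \<and> integrable circle g \<and>
     (\<forall>\<phi>. test_function \<phi> \<longrightarrow>
        ((\<lambda>t::int. LINT x|circle. m (of_int t) * fourier_coeff f t * char_fun t x * \<phi> x)
           has_sum (LINT x|circle. g x * \<phi> x)) UNIV)"

end

theory Submission
  imports Defs
begin

text \<open>
  The multiplier is approximated by its third Cesaro means, whose kernels are trigonometric
  polynomials \<open>K\<close> with \<open>|K'(u)| \<le> A / u\<^sup>2\<close> uniformly in the order of the mean: sum by parts three
  times beyond the frequency \<open>1/|u|\<close>.  Bessel's inequality gives the weak type (2,2), a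
  Calderon--Zygmund decomposition the weak type (1,1).  The dyadic stopping time is cut off at a
  finite depth, and the remaining short intervals contribute little because \<open>K\<close> is Lipschitz, so no
  differentiation theorem is needed.

  Splitting \<open>f\<close> at the height \<open>f\<^sup>*(t)\<close> turns the two weak types into the pointwise bound
  \<open>(\<Lambda>f)\<^sup>* \<le> C (P f\<^sup>* + Q f\<^sup>*)\<close> with the Hardy operators \<open>P h(t) = t\<^sup>-\<^sup>1 \<integral>\<^sub>0\<^sup>t h\<close> and
  \<open>Q h(t) = t\<^bsup>-1/2\<^esup> \<integral>\<^sub>t\<^sup>1 h(u) u\<^bsup>-1/2\<^esup> du\<close>.  As \<open>P Q = 2 (P + Q)\<close>, \<open>\<integral> Q h = 2 \<integral> h\<close> and \<open>h \<le> P h\<close> for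
  decreasing \<open>h\<close>, applying \<open>P\<close> another \<open>n - 1\<close> times and integrating yields the norm inequality.  The
  same inequality for \<open>n = 1\<close>, applied to truncations of \<open>f\<close>, makes the means converge in \<open>L\<^sup>1\<close>.
\<close>

section \<open>Hardy operators\<close>

text \<open>All estimates are made for finite sums, with constants that do not depend on the order
  of the mean; only then is a limit taken. A sharp cutoff at frequency N would destroy the symbol
  bounds: its first difference at the edge has size 1 instead of 1/N. The weights of a Cesaro mean
  of order k have differences of the right size up to order k, but a jump of size about N^-k in the
  next one. Three differences are required, because differentiating the kernel multiplies the symbol
  by the frequency t, and the third difference of the product is of size t^-2, hence summable.

  Exactly one logarithm is lost. The loss comes from P, which enters through the weak type (1,1).
  The exponent -1/2 in Q stems from the weak type (2,2), and Q costs nothing at this scale: it is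
  bounded on L^1, and averaging it reproduces it up to averages of \<open>h\<close>.

  The limit is not taken almost everywhere: convergence in L^1 is enough both to identify the
  distribution and to transfer bounds for distribution functions.\<close>

definition hardy :: "(real \<Rightarrow> ennreal) \<Rightarrow> real \<Rightarrow> ennreal" where
  "hardy h t = (\<integral>\<^sup>+ u \<in> {0..t}. h u \<partial>lborel) / ennreal t"

text \<open>For decreasing \<open>h\<close> this operator controls the L^2 size of \<open>h\<close>
  beyond \<open>t\<close>: the integral of h^2 over [t,1] is at most t (h(t) + Q h(t))^2. The upper
  limit is 1 because rearrangements on a probability space live on [0,1].\<close>

definition cohardy :: "(real \<Rightarrow> ennreal) \<Rightarrow> real \<Rightarrow> ennreal" where
  "cohardy h t = ennreal (t powr (- (1/2))) * (\<integral>\<^sup>+ u \<in> {t..1}. h u * ennreal (u powr (- (1/2))) \<partial>lborel)"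

lemma rearr_iter_eq_hardy: "rearr_iter M f (Suc n) = (hardy ^^ n) (rearrangement M f)"
proof (induction n)
  case (Suc n)
  have "rearr_iter M f (Suc (Suc n)) = hardy (rearr_iter M f (Suc n))"
    by (simp add: hardy_def fun_eq_iff)
  then show ?case using Suc by simp
qed simp

lemma LlogL_norm_eq: "LlogL_norm M n f = (\<integral>\<^sup>+ t \<in> {0..1}. (hardy ^^ n) (rearrangement M f) t \<partial>lborel)"
  using rearr_iter_eq_hardy[of M f n] by (simp add: LlogL_norm_def)

lemma hardy_measurable [measurable]:
  assumes [measurable]: "h \<in> borel_measurable borel"
  shows "hardy h \<in> borel_measurable borel"
proof -
  have eq: "hardy h = (\<lambda>t. (\<integral>\<^sup>+ u. h u * (if 0 \<le> u \<and> u \<le> t then 1 else 0) \<partial>lborel) / ennreal t)"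
    unfolding hardy_def by (intro ext arg_cong2[where f = "(/)"] nn_integral_cong) (auto simp: indicator_def)
  show ?thesis unfolding eq by measurable
qed

lemma hardy_funpow_measurable [measurable]:
  assumes [measurable]: "h \<in> borel_measurable borel"
  shows "(hardy ^^ n) h \<in> borel_measurable borel"
  by (induction n) auto

lemma cohardy_measurable [measurable]:
  assumes [measurable]: "h \<in> borel_measurable borel"
  shows "cohardy h \<in> borel_measurable borel"
proof -
  have eq: "cohardy h = (\<lambda>t. ennreal (t powr (- (1/2))) * (\<integral>\<^sup>+ u. h u * ennreal (u powr (- (1/2))) * (if t \<le> u \<and> u \<le> 1 then 1 else 0) \<partial>lborel))"
    unfolding cohardy_def by (intro ext arg_cong2[where f = "(*)"] nn_integral_cong) (auto simp: indicator_def)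
  show ?thesis unfolding eq by measurable
qed

text \<open>Nothing is asked at 0, a null point at which a rearrangement may be infinite; the
  pointwise bounds below are proved for positive arguments only.\<close>

lemma hardy_mono:
  assumes "\<And>u. 0 < u \<Longrightarrow> u \<le> t \<Longrightarrow> h u \<le> k u"
  shows "hardy h t \<le> hardy k t"
proof -
  have "(\<integral>\<^sup>+ u \<in> {0..t}. h u \<partial>lborel) \<le> (\<integral>\<^sup>+ u \<in> {0..t}. k u \<partial>lborel)"
    by (rule nn_integral_mono_AE, rule AE_mp[OF AE_lborel_singleton[of 0]])
      (use assms in \<open>auto simp: indicator_def\<close>)
  then show ?thesis unfolding hardy_def by (rule divide_right_mono_ennreal)
qed

lemma hardy_funpow_mono:
  assumes "\<And>u. 0 < u \<Longrightarrow> u \<le> b \<Longrightarrow> h u \<le> k u" "0 < t" "t \<le> b"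
  shows "(hardy ^^ n) h t \<le> (hardy ^^ n) k t"
  using assms(2,3)
proof (induction n arbitrary: t)
  case (Suc n)
  then show ?case by (auto intro!: hardy_mono)
qed (use assms in auto)

lemma hardy_add:
  assumes [measurable]: "h \<in> borel_measurable borel" "k \<in> borel_measurable borel"
  shows "hardy (\<lambda>u. h u + k u) t = hardy h t + hardy k t"
  unfolding hardy_def distrib_right
  by (subst nn_integral_add) (auto simp: add_divide_distrib_ennreal)

lemma hardy_cmult:
  assumes [measurable]: "h \<in> borel_measurable borel"
  shows "hardy (\<lambda>u. c * h u) t = c * hardy h t"
  unfolding hardy_def
  by (subst ennreal_times_divide, subst nn_integral_cmult[symmetric]) (auto simp: mult.assoc)

text \<open>The substitution u = t v moves the dependence on \<open>t\<close> from the interval into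
  the argument, so that monotonicity in \<open>t\<close> and dominated convergence can be read off
  on a fixed interval.\<close>

lemma hardy_scale:
  assumes [measurable]: "h \<in> borel_measurable borel" and t: "t > 0"
  shows "hardy h t = (\<integral>\<^sup>+ v \<in> {0..1}. h (t * v) \<partial>lborel)"
proof -
  have "(\<integral>\<^sup>+ u \<in> {0..t}. h u \<partial>lborel) = ennreal t * (\<integral>\<^sup>+ v. h (t * v) * indicator {0..t} (t * v) \<partial>lborel)"
    using nn_integral_real_affine[of "\<lambda>u. h u * indicator {0..t} u" t 0] t by simp
  also have "(\<integral>\<^sup>+ v. h (t * v) * indicator {0..t} (t * v) \<partial>lborel) = (\<integral>\<^sup>+ v \<in> {0..1}. h (t * v) \<partial>lborel)"
    using t by (intro nn_integral_cong) (auto simp: indicator_def zero_le_mult_iff)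
  finally show ?thesis
    unfolding hardy_def using t by (simp add: ennreal_mult_divide_eq mult.commute[of "ennreal t"])
qed

lemma antimono_le_hardy:
  assumes [measurable]: "h \<in> borel_measurable borel" and anti: "antimono_on {0<..} h" and t: "t > 0"
  shows "h t \<le> hardy h t"
proof -
  have "h t = (\<integral>\<^sup>+ v \<in> {0..1}. h t \<partial>(lborel::real measure))" by (simp add: nn_integral_cmult_indicator)
  also have "\<dots> \<le> (\<integral>\<^sup>+ v \<in> {0..1}. h (t * v) \<partial>lborel)"
  proof (rule nn_integral_mono_AE, rule AE_mp[OF AE_lborel_singleton[of 0]], intro AE_I2 impI)
    fix v :: real assume "v \<noteq> 0"
    then show "h t * indicator {0..1} v \<le> h (t * v) * indicator {0..1} v"
      using monotone_onD[OF anti, of "t * v" t] t by (auto simp: indicator_def)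
  qed
  finally show ?thesis using hardy_scale[OF assms(1) t] by simp
qed

lemma antimono_hardy:
  assumes [measurable]: "h \<in> borel_measurable borel" and anti: "antimono_on {0<..} h"
  shows "antimono_on {0<..} (hardy h)"
proof (rule monotone_onI)
  fix s t :: real assume st: "s \<in> {0<..}" "t \<in> {0<..}" "s \<le> t"
  have "(\<integral>\<^sup>+ v \<in> {0..1}. h (t * v) \<partial>lborel) \<le> (\<integral>\<^sup>+ v \<in> {0..1}. h (s * v) \<partial>lborel)"
  proof (rule nn_integral_mono_AE, rule AE_mp[OF AE_lborel_singleton[of 0]], intro AE_I2 impI)
    fix v :: real assume "v \<noteq> 0"
    then show "h (t * v) * indicator {0..1} v \<le> h (s * v) * indicator {0..1} v"
      using monotone_onD[OF anti, of "s * v" "t * v"] st by (auto simp: indicator_def mult_right_mono)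
  qed
  then show "hardy h t \<le> hardy h s" using st by (simp add: hardy_scale)
qed

lemma antimono_hardy_funpow:
  assumes [measurable]: "h \<in> borel_measurable borel" and "antimono_on {0<..} h"
  shows "antimono_on {0<..} ((hardy ^^ n) h)"
  by (induction n) (auto intro!: antimono_hardy assms)

lemma hardy_funpow_increasing:
  assumes [measurable]: "h \<in> borel_measurable borel" and anti: "antimono_on {0<..} h"
    and "j \<le> n" and t: "t > 0"
  shows "(hardy ^^ j) h t \<le> (hardy ^^ n) h t"
  using assms(3)
proof (induction n rule: dec_induct)
  case (step n)
  have "(hardy ^^ n) h t \<le> hardy ((hardy ^^ n) h) t"
    by (intro antimono_le_hardy antimono_hardy_funpow anti t) measurable
  then show ?case using step by auto
qed simp

lemma nn_integral_unit_mono: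
  assumes "\<And>t. 0 < t \<Longrightarrow> t < 1 \<Longrightarrow> h t \<le> k t"
  shows "(\<integral>\<^sup>+ t \<in> {0..1}. h t \<partial>lborel) \<le> (\<integral>\<^sup>+ t \<in> {0..(1::real)}. k t \<partial>lborel)"
  by (rule nn_integral_mono_AE, rule AE_mp[OF AE_lborel_singleton[of 0]], rule AE_mp[OF AE_lborel_singleton[of 1]])
    (use assms in \<open>auto simp: indicator_def less_le\<close>)

lemma nn_integral_powr_minus_half:
  assumes "c \<ge> 0"
  shows "(\<integral>\<^sup>+ t \<in> {0..c}. ennreal (t powr (- (1/2))) \<partial>lborel) = ennreal (2 * c powr (1/2))"
proof -
  have "((\<lambda>x. x powr (- (1/2))) has_integral (c powr (- (1/2)+1) / (- (1/2)+1))) {0..c}"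
    by (rule has_integral_powr_from_0) (use assms in auto)
  then have "((\<lambda>x. x powr (- (1/2))) has_integral (2 * c powr (1/2))) {0..c}" by (simp add: mult.commute)
  from nn_integral_has_integral_lebesgue[OF _ this] show ?thesis
    by (auto simp: ennreal_mult' ennreal_indicator mult.commute)
qed

text \<open>Tonelli: for fixed \<open>u\<close> the variable \<open>t\<close> runs over
  [0, min u s], where t^(-1/2) has integral 2 sqrt(min u s). The case s = 1 computes the integral of
  Q h, general \<open>s\<close> the composition P Q.\<close>

lemma nn_integral_cohardy:
  assumes [measurable]: "h \<in> borel_measurable borel" and s: "0 \<le> s" "s \<le> 1"
  shows "(\<integral>\<^sup>+ t \<in> {0..s}. cohardy h t \<partial>lborel)
    = (\<integral>\<^sup>+ u \<in> {0..1}. h u * ennreal (u powr (- (1/2)) * (2 * min u s powr (1/2))) \<partial>lborel)"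
proof -
  let ?k = "\<lambda>t u. ennreal (t powr (- (1/2))) * (h u * ennreal (u powr (- (1/2)))) * (if 0 \<le> t \<and> t \<le> s \<and> t \<le> u \<and> u \<le> 1 then 1 else 0)"
  have "(\<integral>\<^sup>+ t \<in> {0..s}. cohardy h t \<partial>lborel) =
    (\<integral>\<^sup>+ t. \<integral>\<^sup>+ u. ?k t u \<partial>lborel \<partial>lborel)"
  proof (rule nn_integral_cong)
    fix t :: real
    have "cohardy h t * indicator {0..s} t = (\<integral>\<^sup>+ u. (ennreal (t powr (- (1/2))) * indicator {0..s} t) * (h u * ennreal (u powr (- (1/2))) * indicator {t..1} u) \<partial>lborel)"
      by (subst nn_integral_cmult) (auto simp: cohardy_def mult_ac)
    also have "\<dots> = (\<integral>\<^sup>+ u. ?k t u \<partial>lborel)"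
      by (intro nn_integral_cong) (auto simp: indicator_def mult_ac)
    finally show "cohardy h t * indicator {0..s} t = \<dots>" .
  qed
  also have "\<dots> = (\<integral>\<^sup>+ u. \<integral>\<^sup>+ t. ?k t u \<partial>lborel \<partial>lborel)"
    by (rule lborel_pair.Fubini'[symmetric]) measurable
  also have "\<dots> = (\<integral>\<^sup>+ u \<in> {0..1}. h u * ennreal (u powr (- (1/2)) * (2 * min u s powr (1/2))) \<partial>lborel)"
  proof (rule nn_integral_cong)
    fix u :: real
    show "(\<integral>\<^sup>+ t. ?k t u \<partial>lborel)
      = h u * ennreal (u powr (- (1/2)) * (2 * min u s powr (1/2))) * indicator {0..1} u"
    proof (cases "0 \<le> u \<and> u \<le> 1")
      case True
      have "(\<integral>\<^sup>+ t. ?k t u \<partial>lborel)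
        = (\<integral>\<^sup>+ t. (h u * ennreal (u powr (- (1/2)))) * (ennreal (t powr (- (1/2))) * indicator {0..min u s} t) \<partial>lborel)"
        using True by (intro nn_integral_cong) (auto simp: indicator_def mult_ac)
      also have "\<dots> = (h u * ennreal (u powr (- (1/2)))) * ennreal (2 * min u s powr (1/2))"
        using True s by (subst nn_integral_cmult) (auto simp: nn_integral_powr_minus_half)
      also have "\<dots> = h u * ennreal (u powr (- (1/2)) * (2 * min u s powr (1/2)))"
        by (simp add: mult.assoc flip: ennreal_mult')
      finally show ?thesis using True by simp
    next
      case False
      then have "(\<lambda>t. ?k t u) = (\<lambda>_. 0)"
        by auto
      then show ?thesis using False by (simp add: indicator_def)
    qed
  qed
  finally show ?thesis .
qed

lemma nn_integral_unit_cohardy: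
  assumes [measurable]: "h \<in> borel_measurable borel"
  shows "(\<integral>\<^sup>+ t \<in> {0..1}. cohardy h t \<partial>lborel) \<le> 2 * (\<integral>\<^sup>+ t \<in> {0..1}. h t \<partial>lborel)"
proof -
  have "(\<integral>\<^sup>+ t \<in> {0..1}. cohardy h t \<partial>lborel) \<le> (\<integral>\<^sup>+ u \<in> {0..1}. 2 * h u \<partial>lborel)"
    unfolding nn_integral_cohardy[OF assms zero_le_one order_refl]
  proof (rule nn_integral_unit_mono)
    fix u :: real assume u: "0 < u" "u < 1"
    then have "u powr (- (1/2)) * (2 * min u 1 powr (1/2)) = 2 * (u powr (- (1/2)) * u powr (1/2))" by simp
    also have "\<dots> = 2" using u by (simp flip: powr_add)
    finally show "h u * ennreal (u powr (- (1/2)) * (2 * min u 1 powr (1/2))) \<le> 2 * h u"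
      by (simp only:) (simp add: mult.commute)
  qed
  also have "\<dots> = 2 * (\<integral>\<^sup>+ t \<in> {0..1}. h t \<partial>lborel)"
    by (simp add: nn_integral_cmult mult.assoc)
  finally show ?thesis .
qed

text \<open>The weight from Tonelli equals 2 for u \<le> s and 2 sqrt(s/u) for u > s. Divided by
  \<open>s\<close>, the first range yields 2 P h(s) and the second 2 Q h(s).\<close>

lemma hardy_cohardy_le:
  assumes [measurable]: "h \<in> borel_measurable borel" and s: "0 < s" "s \<le> 1"
  shows "hardy (cohardy h) s \<le> 2 * (hardy h s + cohardy h s)"
proof -
  have "(\<integral>\<^sup>+ u \<in> {0..1}. h u * ennreal (u powr (- (1/2)) * (2 * min u s powr (1/2))) \<partial>lborel)
    \<le> (\<integral>\<^sup>+ u. 2 * (h u * indicator {0..s} u) + ennreal (2 * s powr (1/2)) * (h u * ennreal (u powr (- (1/2))) * indicator {s..1} u) \<partial>lborel)"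
  proof (rule nn_integral_mono_AE, rule AE_mp[OF AE_lborel_singleton[of 0]], intro AE_I2 impI)
    fix u :: real assume "u \<noteq> 0"
    consider "u < 0" | "0 < u" "u \<le> s" | "u > s" "u \<le> 1" | "u > 1" using \<open>u \<noteq> 0\<close> by linarith
    then show "h u * ennreal (u powr (- (1/2)) * (2 * min u s powr (1/2))) * indicator {0..1} u
      \<le> 2 * (h u * indicator {0..s} u) + ennreal (2 * s powr (1/2)) * (h u * ennreal (u powr (- (1/2))) * indicator {s..1} u)"
    proof cases
      case 2
      then have "u powr (- (1/2)) * (2 * min u s powr (1/2)) = 2 * (u powr (- (1/2)) * u powr (1/2))" by simp
      also have "\<dots> = 2" using 2 by (simp flip: powr_add)
      finally show ?thesis using 2 s by (simp only:) (simp add: mult.commute[of _ "2::ennreal"] add_increasing2)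
    next
      case 3
      then have "u powr (- (1/2)) * (2 * min u s powr (1/2)) = (2 * s powr (1/2)) * u powr (- (1/2))" by (simp add: min_def)
      then show ?thesis using 3 s by (simp add: ennreal_mult mult_ac)
    qed auto
  qed
  also have "\<dots> = 2 * (\<integral>\<^sup>+ u \<in> {0..s}. h u \<partial>lborel) + ennreal (2 * s powr (1/2)) * (\<integral>\<^sup>+ u \<in> {s..1}. h u * ennreal (u powr (- (1/2))) \<partial>lborel)"
    by (subst nn_integral_add) (auto simp: nn_integral_cmult)
  finally have "hardy (cohardy h) s \<le> (2 * (\<integral>\<^sup>+ u \<in> {0..s}. h u \<partial>lborel) + ennreal (2 * s powr (1/2)) * (\<integral>\<^sup>+ u \<in> {s..1}. h u * ennreal (u powr (- (1/2))) \<partial>lborel)) / ennreal s"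
    unfolding hardy_def[of "cohardy h"] using s by (subst nn_integral_cohardy) (auto intro: divide_right_mono_ennreal)
  also have "\<dots> = 2 * hardy h s + (ennreal (2 * s powr (1/2)) / ennreal s) * (\<integral>\<^sup>+ u \<in> {s..1}. h u * ennreal (u powr (- (1/2))) \<partial>lborel)"
    unfolding add_divide_distrib_ennreal hardy_def ennreal_times_divide
    by (simp only: divide_ennreal_def mult.assoc mult.commute[of "inverse (ennreal s)"])
  also have "ennreal (2 * s powr (1/2)) / ennreal s = 2 * ennreal (s powr (- (1/2)))"
  proof -
    have "s powr (- (1/2)) = s powr (1/2 - 1)" by simp
    also have "\<dots> = s powr (1/2) / s" using s by (subst powr_diff) auto
    finally have "2 * s powr (1/2) / s = 2 * s powr (- (1/2))" by simp
    have "ennreal (2 * s powr (1/2)) / ennreal s = ennreal (2 * s powr (1/2) / s)"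
      using s by (simp only: divide_ennreal mult_nonneg_nonneg powr_ge_zero zero_le_numeral)
    then show ?thesis
      unfolding \<open>2 * s powr (1/2) / s = 2 * s powr (- (1/2))\<close> by (simp add: ennreal_mult')
  qed
  finally show ?thesis by (simp only: cohardy_def[of h s] distrib_left mult.assoc)
qed

text \<open>Averaging Q h never produces an iterate of Q, only a multiple of Q h together with P h,
  and P h lies below every later iterate since \<open>h\<close> decreases. One step costs the factor
  3 = 1 + 2.\<close>

lemma hardy_funpow_cohardy_le:
  assumes [measurable]: "h \<in> borel_measurable borel" and anti: "antimono_on {0<..} h"
    and "0 < t" "t \<le> 1"
  shows "(hardy ^^ k) (cohardy h) t \<le> 3 ^ k * ((hardy ^^ k) h t + cohardy h t)"
  using assms(3,4)
proof (induction k arbitrary: t)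
  case 0
  then show ?case by (simp add: add_increasing)
next
  case (Suc k)
  have "(hardy ^^ Suc k) (cohardy h) t = hardy ((hardy ^^ k) (cohardy h)) t" by simp
  also have "\<dots> \<le> hardy (\<lambda>t. 3 ^ k * ((hardy ^^ k) h t + cohardy h t)) t"
    using Suc by (intro hardy_mono) auto
  also have "\<dots> = 3 ^ k * (hardy ((hardy ^^ k) h) t + hardy (cohardy h) t)"
    by (subst hardy_cmult, measurable, subst hardy_add) auto
  also have "\<dots> \<le> 3 ^ k * ((hardy ^^ Suc k) h t + 2 * ((hardy ^^ Suc k) h t + cohardy h t))"
  proof (intro mult_left_mono add_mono order_refl)
    have "hardy (cohardy h) t \<le> 2 * (hardy h t + cohardy h t)"
      using Suc by (intro hardy_cohardy_le) auto
    also have "\<dots> \<le> 2 * ((hardy ^^ Suc k) h t + cohardy h t)"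
      using hardy_funpow_increasing[of h 1 "Suc k" t] anti Suc by (intro mult_left_mono add_mono) auto
    finally show "hardy (cohardy h) t \<le> 2 * ((hardy ^^ Suc k) h t + cohardy h t)" .
  qed auto
  also have "\<dots> \<le> 3 ^ k * (3 * ((hardy ^^ Suc k) h t + cohardy h t))"
  proof (intro mult_left_mono)
    have *: "x + 2 * (x + y) \<le> 3 * (x + y)" for x y :: ennreal
    proof -
      have "x + 2 * (x + y) \<le> (x + y) + 2 * (x + y)" by (intro add_right_mono) (simp add: add_increasing2)
      also have "\<dots> = (1 + 2) * (x + y)" by (simp only: distrib_right mult_1)
      finally show ?thesis by simp
    qed
    show "(hardy ^^ Suc k) h t + 2 * ((hardy ^^ Suc k) h t + cohardy h t) \<le> 3 * ((hardy ^^ Suc k) h t + cohardy h t)"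
      by (rule *)
  qed auto
  finally show ?case by (simp only: power_Suc2 mult.assoc)
qed

text \<open>The norm inequality in its real-variable form: P raises the number of averages by one,
  while Q only doubles the integral of \<open>h\<close>. In the constant, 1 belongs to P, and 3 *
  3^k = 3^k (1 + 2) to the k-th average and to Q. All lower averages are then replaced by the one of
  order k + 1.\<close>

lemma nn_integral_hardy_funpow_le:
  assumes [measurable]: "h \<in> borel_measurable borel" "g \<in> borel_measurable borel" and anti: "antimono_on {0<..} h"
    and g: "\<And>t. 0 < t \<Longrightarrow> t < 1 \<Longrightarrow> g t \<le> c * (hardy h t + cohardy h t)"
  shows "(\<integral>\<^sup>+ t \<in> {0..1}. (hardy ^^ k) g t \<partial>lborel)
    \<le> c * (1 + 3 * 3 ^ k) * (\<integral>\<^sup>+ t \<in> {0..1}. (hardy ^^ Suc k) h t \<partial>lborel)"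
proof -
  define I where "I = (\<lambda>j. \<integral>\<^sup>+ t \<in> {0..1}. (hardy ^^ j) h t \<partial>lborel)"
  have mono: "I j \<le> I (Suc k)" if "j \<le> Suc k" for j
    unfolding I_def by (rule nn_integral_unit_mono) (use that in \<open>intro hardy_funpow_increasing anti; simp\<close>)
  have fp: "(hardy ^^ k) (\<lambda>t. c * (a t + b t)) t = c * ((hardy ^^ k) a t + (hardy ^^ k) b t)"
    if [measurable]: "a \<in> borel_measurable borel" "b \<in> borel_measurable borel" for a b t
  proof (induction k arbitrary: t)
    case (Suc k)
    have "(hardy ^^ Suc k) (\<lambda>t. c * (a t + b t)) t = hardy (\<lambda>t. c * ((hardy ^^ k) a t + (hardy ^^ k) b t)) t"
      using ext[of "(hardy ^^ k) (\<lambda>t. c * (a t + b t))", OF Suc] by simp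
    also have "\<dots> = c * ((hardy ^^ Suc k) a t + (hardy ^^ Suc k) b t)"
      by (subst hardy_cmult, measurable, subst hardy_add) auto
    finally show ?case .
  qed simp
  have "(\<integral>\<^sup>+ t \<in> {0..1}. (hardy ^^ k) g t \<partial>lborel)
    \<le> (\<integral>\<^sup>+ t \<in> {0..1}. c * ((hardy ^^ Suc k) h t + 3 ^ k * ((hardy ^^ k) h t + cohardy h t)) \<partial>lborel)"
  proof (rule nn_integral_unit_mono)
    fix t :: real assume t: "0 < t" "t < 1"
    have "(hardy ^^ k) g t \<le> (hardy ^^ k) (\<lambda>t. c * (hardy h t + cohardy h t)) t"
      by (rule hardy_funpow_mono[of "t"]) (use g t in auto)
    also have "\<dots> = c * ((hardy ^^ k) (hardy h) t + (hardy ^^ k) (cohardy h) t)"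
      by (rule fp) auto
    also have "\<dots> \<le> c * ((hardy ^^ Suc k) h t + 3 ^ k * ((hardy ^^ k) h t + cohardy h t))"
      using hardy_funpow_cohardy_le[of h t k] anti t by (intro mult_left_mono add_mono) (auto simp: funpow_swap1)
    finally show "(hardy ^^ k) g t \<le> \<dots>" .
  qed
  also have "\<dots> = c * (I (Suc k) + 3 ^ k * (I k + (\<integral>\<^sup>+ t \<in> {0..1}. cohardy h t \<partial>lborel)))"
  proof -
    have "(\<integral>\<^sup>+ t \<in> {0..1}. c * ((hardy ^^ Suc k) h t + 3 ^ k * ((hardy ^^ k) h t + cohardy h t)) \<partial>lborel)
      = (\<integral>\<^sup>+ t. c * ((hardy ^^ Suc k) h t * indicator {0..1} t + 3 ^ k * ((hardy ^^ k) h t * indicator {0..1} t + cohardy h t * indicator {0..1} t)) \<partial>lborel)"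
      by (intro nn_integral_cong) (auto simp: indicator_def)
    also have "\<dots> = c * (I (Suc k) + 3 ^ k * (I k + (\<integral>\<^sup>+ t \<in> {0..1}. cohardy h t \<partial>lborel)))"
      unfolding I_def
      by (subst nn_integral_cmult, measurable, subst nn_integral_add, measurable,
          subst nn_integral_cmult, measurable, subst nn_integral_add) measurable
    finally show ?thesis .
  qed
  also have "\<dots> \<le> c * (I (Suc k) + 3 ^ k * (I (Suc k) + 2 * I (Suc k)))"
    using nn_integral_unit_cohardy[of h] mono[of 0] mono[of k]
      mult_left_mono[OF mono[of 0], of 2]
    by (intro mult_left_mono add_mono order_refl) (auto simp: I_def)
  also have "\<dots> = c * (1 + 3 * 3 ^ k) * I (Suc k)"
  proof -
    have "I (Suc k) + 2 * I (Suc k) = (1 + 2) * I (Suc k)" by (simp only: distrib_right mult_1)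
    then have "I (Suc k) + 2 * I (Suc k) = 3 * I (Suc k)" by simp
    then show ?thesis by (simp add: distrib_right distrib_left mult_ac)
  qed
  finally show ?thesis by (simp add: I_def)
qed

section \<open>Decreasing rearrangements\<close>

lemma rearrangement_le:
  assumes "0 \<le> u" "emeasure M {x \<in> space M. u < norm (f x)} \<le> ennreal t"
  shows "rearrangement M f t \<le> ennreal u"
  unfolding rearrangement_def using assms by (intro Inf_lower) auto

lemma rearrangement_antimono: "antimono (rearrangement M f)"
proof (rule antimonoI)
  fix s t :: real assume "s \<le> t"
  then have "a \<le> ennreal t" if "a \<le> ennreal s" for a
    using that ennreal_leI order_trans by blast
  then show "rearrangement M f t \<le> rearrangement M f s"
    unfolding rearrangement_def by (intro Inf_superset_mono) blast
qed

lemma rearrangement_measurable [measurable]: "rearrangement M f \<in> borel_measurable borel"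
proof (rule borel_measurableI_greater)
  fix y
  have "is_interval {x. y < rearrangement M f x}"
    unfolding is_interval_1 using rearrangement_antimono[of M f]
    by (auto dest: antimonoD intro: less_le_trans)
  then have "{x. y < rearrangement M f x} \<in> sets borel" by (rule real_interval_borel_measurable)
  then show "{x \<in> space borel. y < rearrangement M f x} \<in> sets borel" by simp
qed

lemma rearrangement_mono:
  assumes "f \<in> borel_measurable M" "\<And>x. x \<in> space M \<Longrightarrow> norm (g x) \<le> norm (f x)"
  shows "rearrangement M g t \<le> rearrangement M f t"
  unfolding rearrangement_def
proof (rule Inf_superset_mono, safe)
  fix u :: real assume u: "0 \<le> u" "emeasure M {x \<in> space M. u < norm (f x)} \<le> ennreal t"
  have "emeasure M {x \<in> space M. u < norm (g x)} \<le> emeasure M {x \<in> space M. u < norm (f x)}"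
    using assms by (intro emeasure_mono) (auto intro: less_le_trans)
  then show "\<exists>v. ennreal u = ennreal v \<and> 0 \<le> v \<and> emeasure M {x \<in> space M. v < norm (g x)} \<le> ennreal t"
    using u by (intro exI[of _ u]) auto
qed

context prob_space
begin

text \<open>The distribution function is continuous from the right: {|f| > l} is the increasing
  union of the sets {|f| > l + 1/(n+1)}. A strict inequality at \<open>l\<close> thus survives at a
  slightly higher level, and this gap makes the infimum strictly larger than
  \<open>l\<close>.\<close>

lemma less_rearrangement_iff:
  assumes [measurable]: "f \<in> borel_measurable M" and "0 \<le> l"
  shows "ennreal l < rearrangement M f t \<longleftrightarrow> ennreal t < emeasure M {x \<in> space M. l < norm (f x)}"
proof
  assume "ennreal l < rearrangement M f t"
  then show "ennreal t < emeasure M {x \<in> space M. l < norm (f x)}"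
    using rearrangement_le[OF \<open>0 \<le> l\<close>, of M f t] by (metis not_le)
next
  assume *: "ennreal t < emeasure M {x \<in> space M. l < norm (f x)}"
  define A where "A = (\<lambda>n. {x \<in> space M. l + 1 / real (Suc n) < norm (f x)})"
  have [measurable]: "A n \<in> sets M" for n unfolding A_def by measurable
  have "(\<lambda>n. emeasure M (A n)) \<longlonglongrightarrow> emeasure M (\<Union>n. A n)"
  proof (rule Lim_emeasure_incseq)
    show "incseq A"
    proof (rule incseq_SucI, unfold A_def, safe)
      fix n x assume "l + 1 / real (Suc n) < norm (f x)"
      moreover have "1 / real (Suc (Suc n)) \<le> 1 / real (Suc n)" by (intro divide_left_mono) auto
      ultimately show "l + 1 / real (Suc (Suc n)) < norm (f x)" by linarith
    qed
  qed auto
  also have "(\<Union>n. A n) = {x \<in> space M. l < norm (f x)}"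
  proof safe
    fix x assume x: "x \<in> space M" "l < norm (f x)"
    then obtain n where "inverse (real (Suc n)) < norm (f x) - l"
      using reals_Archimedean[of "norm (f x) - l"] by auto
    then show "x \<in> (\<Union>n. A n)" using x by (auto simp: A_def inverse_eq_divide intro!: exI[of _ n])
  next
    fix x n assume "x \<in> A n"
    then show "x \<in> space M" "l < norm (f x)" unfolding A_def
      by (auto intro: le_less_trans[rotated])
  qed
  finally have "\<forall>\<^sub>F n in sequentially. ennreal t < emeasure M (A n)"
    using * by (rule order_tendstoD)
  then obtain n where n: "ennreal t < emeasure M (A n)" by (auto dest: eventually_happens)
  have "ennreal (l + 1 / real (Suc n)) \<le> rearrangement M f t"
    unfolding rearrangement_def
  proof (rule Inf_greatest, safe)
    fix u :: real assume u: "0 \<le> u" "emeasure M {x \<in> space M. u < norm (f x)} \<le> ennreal t"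
    show "ennreal (l + 1 / real (Suc n)) \<le> ennreal u"
    proof (rule ccontr)
      assume "\<not> ?thesis"
      then have "u < l + 1 / real (Suc n)" by (meson ennreal_leI not_le)
      then have "emeasure M (A n) \<le> emeasure M {x \<in> space M. u < norm (f x)}"
        by (intro emeasure_mono) (auto simp: A_def)
      then show False using u n by auto
    qed
  qed
  moreover have "ennreal l < ennreal (l + 1 / real (Suc n))" using \<open>0 \<le> l\<close> by (simp add: ennreal_less_iff)
  ultimately show "ennreal l < rearrangement M f t" by order
qed

lemma rearrangement_finite:
  assumes [measurable]: "f \<in> borel_measurable M" and "t > 0"
  shows "rearrangement M f t < \<infinity>"
proof -
  define A where "A = (\<lambda>n. {x \<in> space M. real n < norm (f x)})"
  have "(\<lambda>n. emeasure M (A n)) \<longlonglongrightarrow> emeasure M (\<Inter>n. A n)"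
    by (rule Lim_emeasure_decseq) (auto simp: A_def decseq_def emeasure_eq_measure)
  also have "(\<Inter>n. A n) = {}"
  proof (rule equals0I)
    fix x assume x: "x \<in> (\<Inter>n. A n)"
    obtain n where "norm (f x) < real n" using reals_Archimedean2 by blast
    moreover have "x \<in> A n" using x by blast
    ultimately show False by (simp add: A_def)
  qed
  finally have "\<forall>\<^sub>F n in sequentially. emeasure M (A n) < ennreal t"
    using \<open>t > 0\<close> by (intro order_tendstoD(2)[where y = 0]) auto
  then obtain n where "emeasure M (A n) < ennreal t" by (auto dest: eventually_happens)
  then have "rearrangement M f t \<le> ennreal (real n)"
    by (intro rearrangement_le) (auto simp: A_def)
  then show ?thesis by (simp add: le_less_trans)
qed

text \<open>Equimeasurability: under the uniform law on (0,1) the set where the rearrangement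
  exceeds \<open>l\<close> is an interval (0,p) with p the measure of {|f| > l}, so both
  distribution functions agree and hence both laws. An arbitrary Borel \<open>P\<close> covers
  truncations and squares alike.\<close>

lemma nn_integral_rearrangement:
  assumes [measurable]: "f \<in> borel_measurable M" "P \<in> borel_measurable borel"
  shows "(\<integral>\<^sup>+ x. P (norm (f x)) \<partial>M) = (\<integral>\<^sup>+ t \<in> {0<..<1}. P (enn2real (rearrangement M f t)) \<partial>lborel)"
proof -
  define N where "N = restrict_space lborel {0<..<(1::real)}"
  define h where "h = (\<lambda>t. enn2real (rearrangement M f t))"
  have [measurable]: "h \<in> borel_measurable borel" unfolding h_def by measurable
  have [measurable]: "h \<in> borel_measurable N" unfolding N_def by (simp add: measurable_restrict_space1)
  have sN: "space N = {0<..<1}" by (simp add: N_def space_restrict_space)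
  interpret N: prob_space N
    by (rule prob_spaceI) (simp add: sN, simp add: N_def emeasure_restrict_space)
  interpret D1: real_distribution "distr M borel (\<lambda>x. norm (f x))"
    by (rule real_distribution_distr) simp
  interpret D2: real_distribution "distr N borel h"
    by (rule N.real_distribution_distr) simp
  have hgt: "l < h t \<longleftrightarrow> t < prob {x \<in> space M. l < norm (f x)}" if "0 \<le> l" "0 < t" for l t
  proof -
    have "ennreal l < rearrangement M f t \<longleftrightarrow> l < h t"
      using rearrangement_finite[of f t] that unfolding h_def
      by (cases "rearrangement M f t") (auto simp: ennreal_less_iff)
    moreover have "ennreal t < emeasure M {x \<in> space M. l < norm (f x)} \<longleftrightarrow> t < prob {x \<in> space M. l < norm (f x)}"
      using that by (simp add: emeasure_eq_measure ennreal_less_iff)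
    ultimately show ?thesis using less_rearrangement_iff[of f l t] that by simp
  qed
  have eq: "distr M borel (\<lambda>x. norm (f x)) = distr N borel h"
  proof (rule cdf_unique)
    show "real_distribution (distr M borel (\<lambda>x. norm (f x)))" "real_distribution (distr N borel h)"
      by unfold_locales
    show "cdf (distr M borel (\<lambda>x. norm (f x))) = cdf (distr N borel h)"
    proof
      fix l :: real
      have 1: "cdf (distr M borel (\<lambda>x. norm (f x))) l = prob {x \<in> space M. norm (f x) \<le> l}"
        unfolding cdf_def by (subst measure_distr) (auto intro!: arg_cong[where f = prob])
      have 2: "cdf (distr N borel h) l = N.prob {x \<in> space N. h x \<le> l}"
        unfolding cdf_def by (subst measure_distr) (auto intro!: arg_cong[where f = N.prob])
      show "cdf (distr M borel (\<lambda>x. norm (f x))) l = cdf (distr N borel h) l"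
      proof (cases "0 \<le> l")
        case True
        define p where "p = prob {x \<in> space M. l < norm (f x)}"
        have p: "0 \<le> p" "p \<le> 1" by (auto simp: p_def)
        have "N.prob {x \<in> space N. l < h x} = N.prob {0<..<p}"
          using p hgt[OF True, folded p_def] by (intro arg_cong[where f = N.prob]) (auto simp: sN)
        also have "\<dots> = p"
          unfolding N_def using p by (subst measure_restrict_space) auto
        finally have "N.prob {x \<in> space N. \<not> l < h x} = 1 - p"
          by (subst N.prob_neg) auto
        moreover have "prob {x \<in> space M. \<not> l < norm (f x)} = 1 - p"
          unfolding p_def by (subst prob_neg) auto
        ultimately show ?thesis unfolding 1 2 by (simp add: not_less)
      next
        case False
        then have "{x \<in> space M. norm (f x) \<le> l} = {}" "{x \<in> space N. h x \<le> l} = {}"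
          by (auto simp: h_def not_le intro: less_le_trans)
        then show ?thesis unfolding 1 2 by (simp only: measure_empty)
      qed
    qed
  qed
  have "(\<integral>\<^sup>+ x. P (norm (f x)) \<partial>M) = (\<integral>\<^sup>+ y. P y \<partial>distr M borel (\<lambda>x. norm (f x)))"
    by (simp add: nn_integral_distr)
  also have "\<dots> = (\<integral>\<^sup>+ t. P (h t) \<partial>N)"
    unfolding eq by (simp add: nn_integral_distr)
  also have "\<dots> = (\<integral>\<^sup>+ t \<in> {0<..<1}. P (h t) \<partial>lborel)"
    unfolding N_def by (subst nn_integral_restrict_space) auto
  finally show ?thesis by (simp add: h_def)
qed

lemma nn_integral_norm_eq_rearrangement:
  assumes [measurable]: "f \<in> borel_measurable M"
  shows "(\<integral>\<^sup>+ x. norm (f x) \<partial>M) = (\<integral>\<^sup>+ t \<in> {0..1}. rearrangement M f t \<partial>lborel)"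
proof -
  have "(\<integral>\<^sup>+ x. norm (f x) \<partial>M) = (\<integral>\<^sup>+ t \<in> {0<..<1}. ennreal (enn2real (rearrangement M f t)) \<partial>lborel)"
    by (rule nn_integral_rearrangement) auto
  also have "\<dots> = (\<integral>\<^sup>+ t \<in> {0..1}. rearrangement M f t \<partial>lborel)"
  proof (rule nn_integral_cong_AE, rule AE_mp[OF AE_lborel_singleton[of 0]], rule AE_mp[OF AE_lborel_singleton[of 1]], intro AE_I2 impI)
    fix t :: real assume "t \<noteq> 0" "t \<noteq> 1"
    then show "ennreal (enn2real (rearrangement M f t)) * indicator {0<..<1} t = rearrangement M f t * indicator {0..1} t"
      using rearrangement_finite[of f t] by (auto simp: indicator_def less_top[symmetric])
  qed
  finally show ?thesis .
qed

lemma LlogL_norm_0: "f \<in> borel_measurable M \<Longrightarrow> LlogL_norm M 0 f = (\<integral>\<^sup>+ x. norm (f x) \<partial>M)"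
  by (simp add: LlogL_norm_eq nn_integral_norm_eq_rearrangement)

section \<open>Splitting a function at the height of its rearrangement\<close>

lemma nn_integral_upper_part_le:
  assumes [measurable]: "f \<in> borel_measurable M" and t: "0 < t" "t < 1"
  defines "c \<equiv> enn2real (rearrangement M f t)"
  shows "(\<integral>\<^sup>+ x. norm (if c < norm (f x) then f x else 0) \<partial>M) \<le> ennreal t * hardy (rearrangement M f) t"
proof -
  let ?H = "rearrangement M f"
  have "(\<integral>\<^sup>+ x. norm (if c < norm (f x) then f x else 0) \<partial>M) = (\<integral>\<^sup>+ x. (\<lambda>v. if c < v then ennreal v else 0) (norm (f x)) \<partial>M)"
    by (intro nn_integral_cong) auto
  also have "\<dots> = (\<integral>\<^sup>+ s \<in> {0<..<1}. (\<lambda>v. if c < v then ennreal v else 0) (enn2real (?H s)) \<partial>lborel)"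
    by (rule nn_integral_rearrangement) auto
  also have "\<dots> \<le> (\<integral>\<^sup>+ s \<in> {0..t}. ?H s \<partial>lborel)"
  proof (rule nn_integral_mono)
    fix s :: real
    show "(if c < enn2real (?H s) then ennreal (enn2real (?H s)) else 0) * indicator {0<..<1} s \<le> ?H s * indicator {0..t} s"
    proof (cases "s \<in> {0<..<1} \<and> c < enn2real (?H s)")
      case True
      \<comment> \<open>A decreasing function exceeds its value at \<open>t\<close> only before
        \<open>t\<close>, so the upper part of \<open>f\<close> corresponds to a subset of
        (0,t).\<close>
      have "s < t"
      proof (rule ccontr)
        assume "\<not> s < t"
        then have "?H s \<le> ?H t" using rearrangement_antimono[of M f] by (simp add: antimonoD)
        then have "enn2real (?H s) \<le> c" unfolding c_def using rearrangement_finite[of f t] t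
          by (intro enn2real_mono) auto
        then show False using True by simp
      qed
      then show ?thesis using True rearrangement_finite[of f s] by (simp add: less_top[symmetric])
    qed auto
  qed
  also have "\<dots> = ennreal t * hardy ?H t"
    unfolding hardy_def using t by (simp add: ennreal_times_divide ennreal_mult_divide_eq mult.commute[of "ennreal t"])
  finally show ?thesis .
qed

text \<open>The square of the rearrangement H is made linear. Beyond \<open>t\<close>, one factor
  H(s) is weighted by sqrt s and bounded by the constant \<open>A\<close>, the other is weighted by
  s^(-1/2) and becomes the integrand of \<open>J\<close>. Before \<open>t\<close> the truncation at
  height \<open>c\<close> gives H(t)^2 t, which is at most A^2.\<close>

lemma nn_integral_lower_part_le:
  assumes [measurable]: "f \<in> borel_measurable M" and t: "0 < t" "t < 1"
  defines "c \<equiv> enn2real (rearrangement M f t)"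
  shows "(\<integral>\<^sup>+ x. ennreal (norm (if c < norm (f x) then 0 else f x) ^ 2) \<partial>M)
    \<le> 2 * ennreal t * (rearrangement M f t + cohardy (rearrangement M f) t) ^ 2"
proof -
  let ?H = "rearrangement M f"
  let ?r = "\<lambda>u. ennreal (u powr (- (1/2)))"
  define J where "J = (\<integral>\<^sup>+ u \<in> {t..1}. ?H u * ?r u \<partial>lborel)"
  define A where "A = ennreal (sqrt t) * ?H t + J"
  have fin: "ennreal (enn2real (?H s)) = ?H s" if "s > 0" for s
    using rearrangement_finite[of f s] that by (simp add: less_top[symmetric])
  have Hc: "?H t = ennreal c" unfolding c_def using fin t by simp
  \<comment> \<open>As H(s) s^(-1/2) decreases, \<open>J\<close> is at least (u - t) H(u) u^(-1/2),
    which dominates (sqrt u - sqrt t) H(u). The remaining sqrt t H(u) is at most sqrt t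
    H(t).\<close>
  have sqrtH: "ennreal (sqrt u) * ?H u \<le> A" if u: "t \<le> u" "u \<le> 1" for u
  proof -
    have "sqrt u - sqrt t \<le> (u - t) * u powr (- (1/2))"
    proof -
      have "(sqrt u - sqrt t) * sqrt u \<le> (sqrt u - sqrt t) * (sqrt u + sqrt t)"
        using u t by (intro mult_left_mono) auto
      also have "\<dots> = u - t" using u t by (simp add: algebra_simps)
      finally show ?thesis using u t by (simp add: powr_minus powr_half_sqrt field_simps)
    qed
    then have "ennreal (sqrt u - sqrt t) * ?H u \<le> ennreal ((u - t) * u powr (- (1/2))) * ?H u"
      by (intro mult_right_mono ennreal_leI) auto
    also have "\<dots> = (?H u * ?r u) * emeasure lborel {t..u}"
      using u by (simp add: ennreal_mult mult_ac)
    also have "\<dots> = (\<integral>\<^sup>+ s \<in> {t..u}. ?H u * ?r u \<partial>lborel)"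
      by (subst nn_integral_cmult_indicator) auto
    also have "\<dots> \<le> J"
      unfolding J_def
    proof (rule nn_integral_mono)
      fix s :: real
      show "?H u * ?r u * indicator {t..u} s \<le> ?H s * ?r s * indicator {t..1} s"
      proof (cases "s \<in> {t..u}")
        case True
        then have "?H u \<le> ?H s" using rearrangement_antimono[of M f] by (simp add: antimonoD)
        moreover have "u powr (- (1/2)) \<le> s powr (- (1/2))" using True t by (intro powr_mono2') auto
        ultimately show ?thesis using True u by (auto intro!: mult_mono ennreal_leI)
      qed auto
    qed
    finally have 1: "ennreal (sqrt u - sqrt t) * ?H u \<le> J" .
    have 2: "ennreal (sqrt t) * ?H u \<le> ennreal (sqrt t) * ?H t"
      using rearrangement_antimono[of M f] u by (intro mult_left_mono) (auto simp: antimonoD)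
    have "ennreal (sqrt u) = ennreal (sqrt t) + ennreal (sqrt u - sqrt t)"
      using u t by (simp flip: ennreal_plus)
    then show ?thesis unfolding A_def using 1 2 by (simp add: distrib_right add_mono)
  qed
  have "(\<integral>\<^sup>+ x. ennreal (norm (if c < norm (f x) then 0 else f x) ^ 2) \<partial>M)
     = (\<integral>\<^sup>+ x. (\<lambda>v. if c < v then 0 else ennreal (v ^ 2)) (norm (f x)) \<partial>M)"
    by (intro nn_integral_cong) auto
  also have "\<dots> = (\<integral>\<^sup>+ s \<in> {0<..<1}. (\<lambda>v. if c < v then 0 else ennreal (v ^ 2)) (enn2real (?H s)) \<partial>lborel)"
    by (rule nn_integral_rearrangement) auto
  also have "\<dots> \<le> (\<integral>\<^sup>+ s. ?H t ^ 2 * indicator {0..t} s + A * (?H s * ?r s * indicator {t..1} s) \<partial>lborel)"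
  proof (rule nn_integral_mono)
    fix s :: real
    show "(if c < enn2real (?H s) then 0 else ennreal (enn2real (?H s) ^ 2)) * indicator {0<..<1} s
      \<le> ?H t ^ 2 * indicator {0..t} s + A * (?H s * ?r s * indicator {t..1} s)"
    proof (cases "s \<in> {0<..<1} \<and> \<not> c < enn2real (?H s)")
      case True
      show ?thesis
      proof (cases "s \<le> t")
        case st: True
        have "ennreal (enn2real (?H s) ^ 2) \<le> ennreal (c ^ 2)"
          using True by (intro ennreal_leI power_mono) auto
        also have "\<dots> = ?H t ^ 2" unfolding Hc by (simp add: ennreal_power c_def)
        finally show ?thesis using True st by (simp add: add_increasing2)
      next
        case st: False
        have "ennreal (enn2real (?H s) ^ 2) = ?H s * ?H s"
          using fin[of s] st t by (simp add: power2_eq_square ennreal_mult)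
        also have "\<dots> = (ennreal (s powr (- (1/2)) * sqrt s) * ?H s) * ?H s"
          using st t by (simp add: powr_minus powr_half_sqrt)
        also have "\<dots> = (ennreal (sqrt s) * ?H s) * (?H s * ?r s)"
          unfolding ennreal_mult'[OF powr_ge_zero] by (simp only: mult_ac)
        also have "\<dots> \<le> A * (?H s * ?r s)"
          using sqrtH[of s] st True by (intro mult_right_mono) auto
        finally show ?thesis using True st by (simp add: indicator_def)
      qed
    qed auto
  qed
  also have "\<dots> = ?H t ^ 2 * ennreal t + A * J"
    unfolding J_def using t by (subst nn_integral_add) (auto simp: nn_integral_cmult nn_integral_cmult_indicator)
  also have "\<dots> \<le> A ^ 2 + A ^ 2"
  proof (rule add_mono)
    have "ennreal t = ennreal (sqrt t) ^ 2" using t by (simp add: ennreal_power)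
    then have "?H t ^ 2 * ennreal t = (ennreal (sqrt t) * ?H t) ^ 2" by (simp add: power_mult_distrib mult.commute)
    also have "\<dots> \<le> A ^ 2" unfolding A_def by (intro power_mono) auto
    finally show "?H t ^ 2 * ennreal t \<le> A ^ 2" .
    show "A * J \<le> A ^ 2" unfolding power2_eq_square by (intro mult_left_mono) (auto simp: A_def)
  qed
  also have "\<dots> = 2 * A ^ 2" by (simp add: mult_2)
  also have "A = ennreal (sqrt t) * (?H t + cohardy ?H t)"
  proof -
    have "ennreal (sqrt t) * ennreal (t powr (- (1/2))) = 1"
      using t by (simp add: powr_minus powr_half_sqrt flip: ennreal_mult')
    then have "J = ennreal (sqrt t) * cohardy ?H t"
      unfolding cohardy_def J_def[symmetric] by (simp flip: mult.assoc)
    then show ?thesis by (simp add: A_def distrib_left)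
  qed
  also have "2 * (ennreal (sqrt t) * (?H t + cohardy ?H t)) ^ 2 = 2 * ennreal t * (?H t + cohardy ?H t) ^ 2"
    using t by (simp add: power_mult_distrib ennreal_power mult.assoc)
  finally show ?thesis .
qed

text \<open>Marcinkiewicz interpolation with a splitting height that depends on \<open>t\<close>:
  \<open>F1\<close> and \<open>F2\<close> stand for the images of the upper and the lower part of
  \<open>f\<close>, each tested at level l/2. Only the pointwise bound of \<open>F\<close> by the
  two images enters, not linearity.\<close>

lemma distribution_bound_of_weak_type:
  assumes [measurable]: "f \<in> borel_measurable M" and t: "0 < t" "t < 1"
    and [measurable]: "F1 \<in> borel_measurable M" "F2 \<in> borel_measurable M"
    and F: "\<And>x. x \<in> space M \<Longrightarrow> norm (F x) \<le> norm (F1 x) + norm (F2 x)"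
    and C: "C1 \<ge> 0" "C2 \<ge> 0"
  defines "c \<equiv> enn2real (rearrangement M f t)"
  assumes w1: "\<And>l. l > 0 \<Longrightarrow> emeasure M {x \<in> space M. l < norm (F1 x)}
      \<le> ennreal (C1 / l) * (\<integral>\<^sup>+ x. norm (if c < norm (f x) then f x else 0) \<partial>M)"
    and w2: "\<And>l. l > 0 \<Longrightarrow> emeasure M {x \<in> space M. l < norm (F2 x)}
      \<le> ennreal ((C2 / l) ^ 2) * (\<integral>\<^sup>+ x. ennreal (norm (if c < norm (f x) then 0 else f x) ^ 2) \<partial>M)"
    and l: "ennreal (4 * C1 + 4 * C2) * (hardy (rearrangement M f) t + cohardy (rearrangement M f) t) < ennreal l"
  shows "emeasure M {x \<in> space M. l < norm (F x)} \<le> ennreal t"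
proof -
  let ?H = "rearrangement M f"
  have l0: "l > 0" using l by (metis ennreal_neg le_zero_eq not_le not_less_zero)
  have "emeasure M {x \<in> space M. l < norm (F x)} \<le> emeasure M ({x \<in> space M. l/2 < norm (F1 x)} \<union> {x \<in> space M. l/2 < norm (F2 x)})"
  proof (rule emeasure_mono, safe)
    fix x assume "x \<in> space M" "l < norm (F x)" "\<not> l / 2 < norm (F2 x)"
    then show "l / 2 < norm (F1 x)" using F[of x] by linarith
  qed measurable
  also have "\<dots> \<le> emeasure M {x \<in> space M. l/2 < norm (F1 x)} + emeasure M {x \<in> space M. l/2 < norm (F2 x)}"
    by (rule emeasure_subadditive) auto
  finally have split: "emeasure M {x \<in> space M. l < norm (F x)}
    \<le> emeasure M {x \<in> space M. l/2 < norm (F1 x)} + emeasure M {x \<in> space M. l/2 < norm (F2 x)}" .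
  show ?thesis
  \<comment> \<open>When both constants vanish, the product with an infinite Hardy average is still
    0, so the hypothesis on \<open>l\<close> no longer yields finiteness; the weak types then bound
    the set by 0 directly.\<close>
  proof (cases "C1 = 0 \<and> C2 = 0")
    case True
    then show ?thesis using split w1[of "l/2"] w2[of "l/2"] l0 by simp
  next
    case False
    have "hardy ?H t + cohardy ?H t \<noteq> \<top>"
      using l False C by (auto simp: ennreal_mult_eq_top_iff)
    then obtain x where x: "hardy ?H t + cohardy ?H t = ennreal x" "x \<ge> 0"
      by (cases "hardy ?H t + cohardy ?H t") auto
    have xl: "(4 * C1 + 4 * C2) * x < l" using l C x(2) unfolding x(1)
      by (simp add: ennreal_mult'[symmetric] ennreal_less_iff del: ennreal_plus)
    have e1: "(\<integral>\<^sup>+ x. norm (if c < norm (f x) then f x else 0) \<partial>M) \<le> ennreal (t * x)"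
    proof -
      have "(\<integral>\<^sup>+ x. norm (if c < norm (f x) then f x else 0) \<partial>M) \<le> ennreal t * hardy ?H t"
        unfolding c_def by (rule nn_integral_upper_part_le) (use t in auto)
      also have "\<dots> \<le> ennreal t * ennreal x" unfolding x(1)[symmetric] by (intro mult_left_mono) auto
      finally show ?thesis using t by (simp add: ennreal_mult')
    qed
    have e2: "(\<integral>\<^sup>+ x. ennreal (norm (if c < norm (f x) then 0 else f x) ^ 2) \<partial>M) \<le> ennreal (2 * t * x ^ 2)"
    proof -
      have "(\<integral>\<^sup>+ x. ennreal (norm (if c < norm (f x) then 0 else f x) ^ 2) \<partial>M) \<le> 2 * ennreal t * (?H t + cohardy ?H t) ^ 2"
        unfolding c_def by (rule nn_integral_lower_part_le) (use t in auto)
      also have "\<dots> \<le> 2 * ennreal t * (hardy ?H t + cohardy ?H t) ^ 2"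
        using t by (intro mult_left_mono power_mono add_right_mono antimono_le_hardy)
          (auto intro: monotone_on_subset[OF rearrangement_antimono])
      also have "\<dots> = ennreal (2 * t * x ^ 2)" unfolding x(1) using x t by (simp add: ennreal_mult' ennreal_power)
      finally show ?thesis .
    qed
    note split
    also have "emeasure M {x \<in> space M. l/2 < norm (F1 x)} + emeasure M {x \<in> space M. l/2 < norm (F2 x)}
        \<le> ennreal (C1 / (l/2)) * ennreal (t * x) + ennreal ((C2 / (l/2)) ^ 2) * ennreal (2 * t * x ^ 2)"
      using l0 by (intro add_mono order_trans[OF w1] order_trans[OF w2] mult_left_mono e1 e2) auto
    also have "\<dots> = ennreal (C1 / (l/2) * (t * x) + (C2 / (l/2)) ^ 2 * (2 * t * x ^ 2))"
      using C l0 x t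
      by (subst ennreal_plus, simp, simp, subst (1 2) ennreal_mult[symmetric]) simp_all
    also have "\<dots> \<le> ennreal t"
    proof (rule ennreal_leI)
      \<comment> \<open>The factor 4 in the threshold makes C1 x / l and C2 x / l at most 1/4. The
        two parts then contribute 2 (1/4) t and 8 (1/4)^2 t, that is t/2 each.\<close>
      have "0 \<le> C1 * x" "0 \<le> C2 * x" using C x by auto
      have "4 * (C1 * x) \<le> l" "4 * (C2 * x) \<le> l" using xl \<open>0 \<le> C1 * x\<close> \<open>0 \<le> C2 * x\<close> by (auto simp: algebra_simps)
      have 1: "C1 * x / l \<le> 1/4" "C2 * x / l \<le> 1/4" using \<open>4 * (C1 * x) \<le> l\<close> \<open>4 * (C2 * x) \<le> l\<close> l0 by (auto simp: field_simps)
      have 2: "(C2 * x / l) ^ 2 \<le> (1/4) ^ 2" using 1 C x l0 by (intro power_mono) auto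
      have "C1 / (l/2) * (t * x) + (C2 / (l/2)) ^ 2 * (2 * t * x ^ 2) = t * (2 * (C1 * x / l) + 8 * (C2 * x / l) ^ 2)"
        by (simp add: power2_eq_square algebra_simps)
      also have "\<dots> \<le> t * (2 * (1/4) + 8 * (1/4)^2)" using t 1 2 by (intro mult_left_mono add_mono) auto
      also have "\<dots> = t" by (simp add: power2_eq_square)
      finally show "C1 / (l/2) * (t * x) + (C2 / (l/2)) ^ 2 * (2 * t * x ^ 2) \<le> t" .
    qed
    finally show ?thesis .
  qed
qed

end

section \<open>Kernels of Marcinkiewicz multipliers\<close>

lemma norm_diff_le_vector_derivative:
  fixes f :: "real \<Rightarrow> 'a::real_normed_vector"
  assumes "\<And>x. x \<in> closed_segment a b \<Longrightarrow> (f has_vector_derivative f' x) (at x)"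
    and "\<And>x. x \<in> closed_segment a b \<Longrightarrow> norm (f' x) \<le> B"
  shows "norm (f b - f a) \<le> B * \<bar>b - a\<bar>"
proof -
  have "norm (f b - f a) \<le> B * norm (b - a)"
  proof (rule differentiable_bound[where S = "closed_segment a b" and f' = "\<lambda>x h. h *\<^sub>R f' x"])
    show "convex (closed_segment a b)" by simp
    fix x assume x: "x \<in> closed_segment a b"
    show "(f has_derivative (\<lambda>h. h *\<^sub>R f' x)) (at x within closed_segment a b)"
      using assms(1)[OF x] unfolding has_vector_derivative_def
      by (rule has_derivative_at_withinI)
    show "onorm (\<lambda>h. h *\<^sub>R f' x) \<le> B"
      by (rule onorm_bound)
         (use assms(2)[OF x] in \<open>auto simp: mult.commute[of B] intro: mult_left_mono order_trans[OF norm_ge_zero]\<close>)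
  qed auto
  then show ?thesis by simp
qed

text \<open>The argument type is left general so that one operator acts on functions of a real
  variable, where derivative bounds are available, and on sequences, where summation by parts takes
  place.\<close>

definition fdiff :: "('a::semiring_1 \<Rightarrow> 'b::ab_group_add) \<Rightarrow> 'a \<Rightarrow> 'b" where
  "fdiff a t = a (t + 1) - a t"

lemma fdiff_funpow_has_vector_derivative:
  fixes F G :: "real \<Rightarrow> complex"
  assumes "\<And>s. s > 0 \<Longrightarrow> (F has_vector_derivative G s) (at s)" "s > 0"
  shows "((fdiff ^^ l) F has_vector_derivative (fdiff ^^ l) G s) (at s)"
  using assms(2)
proof (induction l arbitrary: s)
  case 0
  then show ?case using assms by simp
next
  case (Suc l)
  have 1: "((fdiff ^^ l) F has_vector_derivative (fdiff ^^ l) G s) (at s)" if "s > 0" for s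
    using Suc that by auto
  have "((\<lambda>x. (fdiff ^^ l) F (x + 1)) has_vector_derivative (fdiff ^^ l) G (s+1)) (at s)"
  proof -
    have "((fdiff ^^ l) F \<circ> (\<lambda>x. x + 1) has_vector_derivative 1 *\<^sub>R (fdiff ^^ l) G (s+1)) (at s)"
      by (rule vector_diff_chain_at)
        (use Suc.prems 1[of "s+1"] in \<open>auto intro!: derivative_eq_intros\<close>)
    then show ?thesis by (simp add: o_def)
  qed
  then have "((\<lambda>x. (fdiff ^^ l) F (x + 1) - (fdiff ^^ l) F x) has_vector_derivative
     (fdiff ^^ l) G (s+1) - (fdiff ^^ l) G s) (at s)"
    using 1[OF Suc.prems] by (rule has_vector_derivative_diff)
  moreover have "(fdiff ^^ Suc l) H = (\<lambda>x. (fdiff ^^ l) H (x + 1) - (fdiff ^^ l) H x)"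
    for H :: "real \<Rightarrow> complex" by (auto simp: fdiff_def)
  ultimately show ?case by simp
qed

text \<open>By the mean value inequality each difference costs one derivative, and differences
  commute with derivatives. The order \<open>j\<close> of the starting derivative is kept free so
  that the induction can trade a difference for a derivative. The bound is taken at the left end of
  the interval, where it is largest.\<close>

lemma norm_fdiff_funpow_le:
  fixes F :: "nat \<Rightarrow> real \<Rightarrow> complex"
  assumes "\<And>l s. l < n \<Longrightarrow> s > 0 \<Longrightarrow> (F l has_vector_derivative F (Suc l) s) (at s)"
    and "\<And>l s. l \<le> n \<Longrightarrow> s > 0 \<Longrightarrow> norm (F l s) \<le> A / s ^ l"
    and "l + j \<le> n" "s > 0" and "A \<ge> 0"
  shows "norm ((fdiff ^^ l) (F j) s) \<le> A / s ^ (l + j)"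
  using assms(3,4)
proof (induction l arbitrary: j s)
  case 0
  then show ?case using assms by auto
next
  case (Suc l)
  have "norm ((fdiff ^^ l) (F j) (s + 1) - (fdiff ^^ l) (F j) s)
     \<le> A / s ^ (Suc l + j) * \<bar>(s + 1) - s\<bar>"
  proof (rule norm_diff_le_vector_derivative)
    fix x assume "x \<in> closed_segment s (s+1)"
    then have x: "s \<le> x" "x > 0" using Suc by (auto simp: closed_segment_eq_real_ivl)
    show "((fdiff ^^ l) (F j) has_vector_derivative (fdiff ^^ l) (F (Suc j)) x) (at x)"
      using fdiff_funpow_has_vector_derivative assms(1) Suc.prems x by simp
    have "norm ((fdiff ^^ l) (F (Suc j)) x) \<le> A / x ^ (l + Suc j)"
      using Suc.IH[of "Suc j" x] Suc.prems x by simp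
    also have "\<dots> \<le> A / s ^ (l + Suc j)"
      using x Suc.prems assms(5) by (intro divide_left_mono power_mono mult_pos_pos) auto
    finally show "norm ((fdiff ^^ l) (F (Suc j)) x) \<le> A / s ^ (Suc l + j)" by simp
  qed
  then show ?case by (simp add: fdiff_def[of "(fdiff ^^ l) (F j)"])
qed

lemma fdiff_funpow_of_nat:
  "(fdiff ^^ l) (\<lambda>t::nat. f (real t)) t = (fdiff ^^ l) f (real t)"
  by (induction l arbitrary: t) (auto simp: fdiff_def add.commute)

text \<open>The index \<open>0\<close> is left out because the value of a multiplier at \<open>0\<close> is unrelated to the others; it
  drops out of the derivative of the kernel.\<close>

definition symbol_seq :: "real \<Rightarrow> (nat \<Rightarrow> complex) \<Rightarrow> bool" where
  "symbol_seq A a \<longleftrightarrow> (\<forall>l\<le>3. \<forall>t\<ge>1. norm ((fdiff ^^ l) a t) \<le> A / real t ^ l)"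

lemma all_le_3: "(\<forall>l\<le>3. P l) \<longleftrightarrow> P 0 \<and> P 1 \<and> P 2 \<and> P (3::nat)"
  by (auto simp: le_Suc_eq numeral_3_eq_3 numeral_2_eq_2)

lemma fdiff_mult_funpow:
  fixes a b :: "nat \<Rightarrow> complex"
  shows "(fdiff ^^ 0) (\<lambda>t. a t * b t) t = a t * b t"
    "(fdiff ^^ 1) (\<lambda>t. a t * b t) t = a (t+1) * (fdiff ^^ 1) b t + (fdiff ^^ 1) a t * b t"
    "(fdiff ^^ 2) (\<lambda>t. a t * b t) t = a (t+2) * (fdiff ^^ 2) b t
       + 2 * ((fdiff ^^ 1) a (t+1) * (fdiff ^^ 1) b t) + (fdiff ^^ 2) a t * b t"
    "(fdiff ^^ 3) (\<lambda>t. a t * b t) t = a (t+3) * (fdiff ^^ 3) b t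
       + 3 * ((fdiff ^^ 1) a (t+2) * (fdiff ^^ 2) b t)
       + 3 * ((fdiff ^^ 2) a (t+1) * (fdiff ^^ 1) b t) + (fdiff ^^ 3) a t * b t"
  by (simp_all add: fdiff_def numeral_2_eq_2 numeral_3_eq_3 algebra_simps)

text \<open>By the Leibniz rule a third difference is a sum of 8 = 2^3 products counted with
  multiplicity. The shifts in the first factor are harmless because A / t^l decreases in
  \<open>t\<close>.\<close>

lemma symbol_seq_mult:
  assumes a: "symbol_seq A a" and b: "symbol_seq B b" and "A \<ge> 0" "B \<ge> 0"
  shows "symbol_seq (8 * A * B) (\<lambda>t. a t * b t)"
proof -
  have P: "norm ((fdiff ^^ l) a (t+k) * (fdiff ^^ j) b t) \<le> A * B / real t ^ (l + j)"
    if "t \<ge> 1" "l \<le> 3" "j \<le> 3" for l j k t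
  proof -
    have "norm ((fdiff ^^ l) a (t+k)) \<le> A / real (t+k) ^ l"
      using a that unfolding symbol_seq_def by (metis trans_le_add1)
    also have "\<dots> \<le> A / real t ^ l"
      using that \<open>A \<ge> 0\<close> by (intro divide_left_mono power_mono mult_pos_pos) auto
    finally have "norm ((fdiff ^^ l) a (t+k)) * norm ((fdiff ^^ j) b t) \<le> A / real t ^ l * (B / real t ^ j)"
      using b that \<open>A \<ge> 0\<close> by (intro mult_mono) (auto simp: symbol_seq_def)
    then show ?thesis by (simp add: norm_mult power_add)
  qed
  have "norm ((fdiff ^^ 0) (\<lambda>t. a t * b t) t) \<le> 8 * A * B / real t ^ 0" 
    "norm ((fdiff ^^ 1) (\<lambda>t. a t * b t) t) \<le> 8 * A * B / real t ^ 1"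
    "norm ((fdiff ^^ 2) (\<lambda>t. a t * b t) t) \<le> 8 * A * B / real t ^ 2"
    "norm ((fdiff ^^ 3) (\<lambda>t. a t * b t) t) \<le> 8 * A * B / real t ^ 3" if t: "t \<ge> 1" for t
  proof -
    have AB: "A * B / real t ^ l \<ge> 0" for l using assms by simp
    show "norm ((fdiff ^^ 0) (\<lambda>t. a t * b t) t) \<le> 8 * A * B / real t ^ 0" 
      using P[OF t, of 0 0 0] AB[of 0] unfolding fdiff_mult_funpow by simp
    show "norm ((fdiff ^^ 1) (\<lambda>t. a t * b t) t) \<le> 8 * A * B / real t ^ 1"
      using P[OF t, of 0 1 1] P[OF t, of 1 0 0] AB[of 1] unfolding fdiff_mult_funpow
      by (intro order_trans[OF norm_triangle_ineq]) simp
    show "norm ((fdiff ^^ 2) (\<lambda>t. a t * b t) t) \<le> 8 * A * B / real t ^ 2"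
      using P[OF t, of 0 2 2] P[OF t, of 1 1 1] P[OF t, of 2 0 0] AB[of 2] unfolding fdiff_mult_funpow
      by (intro order_trans[OF norm_triangle_ineq] order_trans[OF add_right_mono[OF norm_triangle_ineq]])
        (simp add: norm_mult numeral_2_eq_2)
    show "norm ((fdiff ^^ 3) (\<lambda>t. a t * b t) t) \<le> 8 * A * B / real t ^ 3"
      using P[OF t, of 0 3 3] P[OF t, of 1 2 2] P[OF t, of 2 1 1] P[OF t, of 3 0 0] AB[of 3]
      unfolding fdiff_mult_funpow
      by (intro order_trans[OF norm_triangle_ineq] order_trans[OF add_right_mono[OF norm_triangle_ineq]]
          order_trans[OF add_right_mono[OF add_right_mono[OF norm_triangle_ineq]]])
        (simp add: norm_mult power3_eq_cube)
  qed
  then show ?thesis unfolding symbol_seq_def by (auto simp: all_le_3)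
qed

section \<open>Weights of the third Cesaro means\<close>

text \<open>The weights of the third Cesaro means are finitely supported, so that all kernels below are
  trigonometric polynomials, and their differences are again binomial coefficients.  The truncated
  subtraction makes them vanish for \<open>t > N\<close>.\<close>

definition cesaro :: "nat \<Rightarrow> nat \<Rightarrow> real" where
  "cesaro N t = real ((N + 3 - t) choose 3) / real ((N + 3) choose 3)"

lemma cesaro_nonneg: "0 \<le> cesaro N t" by (simp add: cesaro_def)

lemma cesaro_le_1: "cesaro N t \<le> 1"
proof -
  have "(N + 3 - t) choose 3 \<le> (N + 3) choose 3" by (rule binomial_right_mono) auto
  moreover have "(N + 3) choose 3 > 0" by simp
  ultimately show ?thesis unfolding cesaro_def by (simp add: divide_le_eq_1)
qed

lemma cesaro_eq_0: "t > N \<Longrightarrow> cesaro N t = 0"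
  by (simp add: cesaro_def)

lemma choose_3: "real (n choose 3) = real n * (real n - 1) * (real n - 2) / 6"
proof -
  have "real (n choose 3) = (real n gchoose 3)" by (simp add: binomial_gbinomial)
  also have "\<dots> = real n * (real n - 1) * (real n - 2) / 6"
    by (simp add: gbinomial_prod_rev numeral_3_eq_3 fact_reduce lessThan_Suc atLeast0_lessThan_Suc)
  finally show ?thesis .
qed

text \<open>Pascal's rule under truncated subtraction. For k = 0 and t \<ge> n the left side would
  be 0 but the right side -1, whence the condition.\<close>

lemma fdiff_choose:
  "real ((n - Suc t) choose Suc k) - real ((n - t) choose Suc k) = - real ((n - Suc t) choose k)"
  if "k > 0 \<or> t < n"
proof (cases "n - t")
  case 0
  then show ?thesis using that by auto
next
  case (Suc s)
  then have "n - Suc t = s" by auto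
  then show ?thesis using Suc by simp
qed

text \<open>Every difference lowers the binomial coefficient by one, while the denominator
  \<open>q\<close> stays of order N^3 / 6; the differences of order 1, 2, 3 are therefore at most
  3/(N+3), 6/((N+3)(N+2)) and 1/q. They vanish for t > N + 1, and for t \<le> N + 1 powers of 1/N
  can be replaced by powers of 1/t. The point is that the constant 6 does not depend on
  \<open>N\<close>.\<close>

lemma symbol_seq_cesaro: "symbol_seq 6 (\<lambda>t. complex_of_real (cesaro N t))"
proof -
  define q where "q = real ((N + 3) choose 3)"
  have q: "q = (real N + 3) * (real N + 2) * (real N + 1) / 6" by (simp add: q_def choose_3 add.commute)
  define c where "c = (\<lambda>t. complex_of_real (cesaro N t))"
  have 1: "(fdiff ^^ 1) c t = - of_real (real ((N + 2 - t) choose 2) / q)" for t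
  proof -
    have "cesaro N (t+1) - cesaro N t = (real ((N + 3 - Suc t) choose 3) - real ((N + 3 - t) choose 3)) / q"
      by (simp add: cesaro_def q_def diff_divide_distrib)
    also have "\<dots> = - real ((N + 2 - t) choose 2) / q" 
      using fdiff_choose[of 2 t "N+3"] by (simp add: numeral_3_eq_3 numeral_2_eq_2)
    finally show ?thesis unfolding c_def
      by (simp add: fdiff_def flip: of_real_diff)
  qed
  have 2: "(fdiff ^^ 2) c t = of_real (real (N + 1 - t) / q)" for t
  proof -
    have "(fdiff ^^ 2) c t = - (of_real ((real ((N + 2 - Suc t) choose 2) - real ((N + 2 - t) choose 2)) / q))"
      using 1 by (simp add: fdiff_def numeral_2_eq_2 diff_divide_distrib)
    also have "(real ((N + 2 - Suc t) choose 2) - real ((N + 2 - t) choose 2)) = - real (N + 1 - t)" 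
      using fdiff_choose[of 1 t "N+2"] by (simp add: numeral_2_eq_2)
    finally show ?thesis by simp
  qed
  have 3: "(fdiff ^^ 3) c t = - of_real ((if t \<le> N then 1 else 0) / q)" for t
  proof -
    have "(fdiff ^^ 3) c t = (fdiff ^^ 2) c (t+1) - (fdiff ^^ 2) c t"
      by (simp add: fdiff_def numeral_3_eq_3 numeral_2_eq_2)
    also have "\<dots> = of_real ((real (N + 1 - (t+1)) - real (N + 1 - t)) / q)"
      unfolding 2 by (simp add: diff_divide_distrib)
    also have "real (N + 1 - (t+1)) - real (N + 1 - t) = - (if t \<le> N then 1 else 0)" by auto
    finally show ?thesis by simp
  qed
  have "norm ((fdiff ^^ l) c t) \<le> 6 / real t ^ l" if t: "t \<ge> 1" and l: "l \<le> 3" for t l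
  proof (cases "t \<le> N + 1")
    case True
    have qp: "q > 0" by (simp add: q)
    have tt: "real t \<le> real N + 1" "real t > 0" using True t by auto
    have c2: "real ((N + 2 - t) choose 2) \<le> (real N + 2) * (real N + 1) / 2"
    proof -
      have "(N + 2 - t) choose 2 \<le> (N + 2) choose 2" by (rule binomial_right_mono) auto
      then have "real ((N + 2 - t) choose 2) \<le> real ((N + 2) choose 2)" by simp
      also have "real ((N + 2) choose 2) = (real N + 2) * (real N + 1) / 2"
        by (simp add: choose_two real_of_nat_div algebra_simps)
      finally show ?thesis .
    qed
    consider "l = 0" | "l = 1" | "l = 2" | "l = 3" using l by linarith
    then show ?thesis
    proof cases
      assume "l = 0"
      then show ?thesis using cesaro_nonneg[of N t] cesaro_le_1[of N t] by (simp add: c_def)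
    next
      assume l: "l = 1"
      have "real ((N + 2 - t) choose 2) / q \<le> ((real N + 2) * (real N + 1) / 2) / q"
        using c2 qp by (intro divide_right_mono) auto
      also have "\<dots> = 3 / (real N + 3)" unfolding q by (simp add: divide_simps)
      also have "\<dots> \<le> 6 / real t" using tt by (intro frac_le) auto
      finally show ?thesis using l qp by (simp add: 1 norm_divide del: One_nat_def)
    next
      assume l: "l = 2"
      have "real (N + 1 - t) / q \<le> (real N + 1) / q"
        using qp by (intro divide_right_mono) auto
      also have "\<dots> = 6 / ((real N + 3) * (real N + 2))" unfolding q by (simp add: divide_simps)
      also have "\<dots> \<le> 6 / (real t * real t)" using tt by (intro frac_le mult_mono) auto
      finally show ?thesis using l qp by (simp add: 2 power2_eq_square norm_divide)
    next
      assume l: "l = 3"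
      have "(if t \<le> N then 1 else 0) / q \<le> 1 / q"
        using qp by (intro divide_right_mono) auto
      also have "\<dots> = 6 / ((real N + 3) * (real N + 2) * (real N + 1))" unfolding q by (simp add: divide_simps)
      also have "\<dots> \<le> 6 / (real t * real t * real t)" using tt by (intro frac_le mult_mono) auto
      finally show ?thesis using l qp by (auto simp add: 3 power3_eq_cube norm_divide)
    qed
  next
    case False
    consider "l = 0" | "l = 1" | "l = 2" | "l = 3" using l by linarith
    then show ?thesis
      by cases (use False 1 2 3 in \<open>auto simp: c_def cesaro_eq_0 binomial_eq_0 simp del: One_nat_def\<close>)
  qed
  then show ?thesis by (simp add: symbol_seq_def c_def)
qed

lemma cesaro_tendsto_1: "(\<lambda>N. cesaro N t) \<longlonglongrightarrow> 1"
proof -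
  have "(\<lambda>N. ((real N + 3 - real t) * (real N + 2 - real t) * (real N + 1 - real t)) /
      ((real N + 3) * (real N + 2) * (real N + 1))) \<longlonglongrightarrow> 1"
  proof -
    have *: "(\<lambda>N. (real N + a - real t) / (real N + a)) \<longlonglongrightarrow> 1" if "a > 0" for a
    proof -
      have "(\<lambda>N. 1 - real t / (real N + a)) \<longlonglongrightarrow> 1 - 0"
        by (intro tendsto_intros tendsto_divide_0[OF tendsto_const])
          (auto intro!: filterlim_at_top_imp_at_infinity
            filterlim_tendsto_add_at_top[OF tendsto_const[of a], simplified add.commute[of a]]
            filterlim_real_sequentially)
      moreover have "1 - real t / (real N + a) = (real N + a - real t) / (real N + a)" for N
      proof -
        have "real N + a > 0" using that by (simp add: add_nonneg_pos)
        then show ?thesis by (simp add: field_simps)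
      qed
      ultimately show ?thesis by simp
    qed
    have "(\<lambda>N. (real N + 3 - real t) / (real N + 3) * ((real N + 2 - real t) / (real N + 2)) *
        ((real N + 1 - real t) / (real N + 1))) \<longlonglongrightarrow> 1 * 1 * 1"
      by (intro tendsto_mult *) auto
    then show ?thesis by (simp add: times_divide_times_eq)
  qed
  moreover have "\<forall>\<^sub>F N in sequentially. ((real N + 3 - real t) * (real N + 2 - real t) * (real N + 1 - real t)) /
      ((real N + 3) * (real N + 2) * (real N + 1)) = cesaro N t"
    using eventually_ge_at_top[of t]
  proof eventually_elim
    case (elim N)
    then have *: "real (N + 3 - t) = real N + 3 - real t" by simp
    have "real N + 3 - real t - 1 = real N + 2 - real t" "real N + 3 - real t - 2 = real N + 1 - real t"
      "real (N + 3) - 1 = real N + 2" "real (N + 3) - 2 = real N + 1" "real (N + 3) = real N + 3"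
      by simp_all
    then show ?case unfolding cesaro_def choose_3 * by (simp only:) simp
  qed
  ultimately show ?thesis by (rule Lim_transform_eventually)
qed

text \<open>Multiplication by 1 - z makes the sum telescope up to the sum with differenced
  coefficients; the upper boundary term is removed by \<open>c R = 0\<close>. One application trades
  a factor 1/|1 - z| for one difference.\<close>

lemma summation_by_parts_bound:
  fixes c :: "nat \<Rightarrow> complex"
  assumes "norm z = 1" "c R = 0"
  shows "norm (1 - z) * norm (\<Sum>t=M..<R. c t * z ^ t)
    \<le> norm (c M) + norm (\<Sum>t=M..<R. fdiff c t * z ^ t)"
proof (cases "M \<le> R")
  case True
  have "(1 - z) * (\<Sum>t=M..<R. c t * z ^ t) - z * (\<Sum>t=M..<R. fdiff c t * z ^ t)
    = (\<Sum>t=M..<R. c t * z ^ t - c (Suc t) * z ^ Suc t)"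
    by (simp add: sum_distrib_left algebra_simps fdiff_def flip: sum_subtractf sum.distrib)
  also have "\<dots> = - (\<Sum>t=M..<R. c (Suc t) * z ^ Suc t - c t * z ^ t)"
    by (simp flip: sum_negf)
  also have "\<dots> = c M * z ^ M"
    using sum_Suc_diff'[OF True, of "\<lambda>t. c t * z ^ t"] assms(2) by simp
  finally have "(1 - z) * (\<Sum>t=M..<R. c t * z ^ t) = c M * z ^ M + z * (\<Sum>t=M..<R. fdiff c t * z ^ t)"
    by (simp add: algebra_simps)
  then have "norm ((1 - z) * (\<Sum>t=M..<R. c t * z ^ t)) \<le> norm (c M * z ^ M) + norm (z * (\<Sum>t=M..<R. fdiff c t * z ^ t))"
    by (metis norm_triangle_ineq)
  then show ?thesis using assms(1) by (simp add: norm_mult norm_power)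
qed simp

text \<open>For t \<ge> 1 one has 1/t^2 \<le> 2/(t(t+1)), and the right side telescopes.\<close>

lemma sum_inverse_squares_le:
  assumes "M \<ge> 1"
  shows "(\<Sum>t=M..<R. 1 / real t ^ 2) \<le> 2 / real M"
proof (cases "M \<le> R")
  case True
  have "(\<Sum>t=M..<R. 1 / real t ^ 2) \<le> (\<Sum>t=M..<R. (- 2 / real (Suc t)) - (- 2 / real t))"
  proof (rule sum_mono)
    fix t assume "t \<in> {M..<R}"
    then have "real t \<ge> 1" using assms by simp
    then have "1 / real t ^ 2 \<le> 2 / (real t * (real t + 1))"
      by (simp add: divide_simps power2_eq_square)
    also have "\<dots> = (- 2 / real (Suc t)) - (- 2 / real t)"
      using \<open>real t \<ge> 1\<close> by (simp add: divide_simps)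
    finally show "1 / real t ^ 2 \<le> (- 2 / real (Suc t)) - (- 2 / real t)" .
  qed
  also have "\<dots> = - 2 / real R - (- 2 / real M)" by (rule sum_Suc_diff'[OF True])
  also have "\<dots> \<le> 2 / real M" by simp
  finally show ?thesis .
qed simp

text \<open>Here \<open>c\<close> grows like A t. Up to M, about 1/|1 - z|, oscillation is of no
  help and the trivial bound A M^2 gives the share 9. Beyond \<open>M\<close>, three summations by
  parts reduce to third differences of size A/t^2 and give the share 7. The value at 0 is prescribed
  separately since the difference bounds start at 1.\<close>

lemma one_sided_kernel_bound:
  fixes c :: "nat \<Rightarrow> complex"
  assumes c: "\<And>l t. l \<le> 3 \<Longrightarrow> t \<ge> 1 \<Longrightarrow> norm ((fdiff ^^ l) c t) \<le> A * real t / real t ^ l"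
    and c0: "c 0 = 0" and R: "\<And>t. t \<ge> R \<Longrightarrow> c t = 0"
    and z: "norm z = 1" "z \<noteq> 1" and A: "A \<ge> 0"
  shows "norm (\<Sum>t<R. c t * z ^ t) \<le> 16 * A / norm (1 - z) ^ 2"
proof -
  define d where "d = norm (1 - z)"
  define M where "M = nat \<lceil>1 / d\<rceil>"
  have d: "d > 0" "d \<le> 2"
    using z norm_triangle_ineq4[of 1 z] by (auto simp: d_def)
  have M: "1 / d \<le> real M" "real M \<le> 1 / d + 1" unfolding M_def using d by (auto simp: of_nat_nat of_int_ceiling_le_add_one)
  have "real M > 0" by (rule less_le_trans[OF _ M(1)]) (use d in simp)
  then have M1: "M \<ge> 1" by simp
  \<comment> \<open>Rounding up costs at most 1, and this is at most 2/d because a chord of the unit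
    circle has length at most 2.\<close>
  have M3: "real M \<le> 3 / d"
  proof -
    have "1 \<le> 2 / d" using d by simp
    then show ?thesis using M by (simp add: add_divide_distrib)
  qed
  have Md: "1 / real M \<le> d"
    using M(1) d \<open>real M > 0\<close> by (simp add: field_simps)
  have RR: "(fdiff ^^ l) c t = 0" if "t \<ge> R" for l t
    using that by (induction l arbitrary: t) (auto simp: R fdiff_def)
  define S where "S = (\<lambda>l. norm (\<Sum>t=M..<R. (fdiff ^^ l) c t * z ^ t))"
  have step: "d * S l \<le> norm ((fdiff ^^ l) c M) + S (Suc l)" for l
    unfolding d_def S_def using summation_by_parts_bound[OF z(1), of "(fdiff ^^ l) c" R M] RR[of R l] by simp
  \<comment> \<open>The sum of third differences is at most 2 A / M, hence at most 2 A d. Each step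
    back adds the boundary term at \<open>M\<close> (A d, then A, then 3 A / d) and divides by
    \<open>d\<close>, which leads to 3 A, 4 A / d and 7 A / d^2.\<close>
  have S3: "S 3 \<le> 2 * A * d"
  proof -
    have "S 3 \<le> (\<Sum>t=M..<R. A * (1 / real t ^ 2))"
      unfolding S_def
    proof (rule order_trans[OF norm_sum sum_mono])
      fix t assume "t \<in> {M..<R}"
      then have t: "t \<ge> 1" using M1 by auto
      have "norm ((fdiff ^^ 3) c t) \<le> A * real t / real t ^ 3" using c t by simp
      also have "\<dots> = A * (1 / real t ^ 2)" using t by (simp add: power2_eq_square power3_eq_cube)
      finally show "norm ((fdiff ^^ 3) c t * z ^ t) \<le> A * (1 / real t ^ 2)"
        by (simp add: norm_mult norm_power z)
    qed
    also have "\<dots> \<le> A * (2 / real M)"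
      unfolding sum_distrib_left[symmetric] by (intro mult_left_mono sum_inverse_squares_le M1 A)
    also have "\<dots> \<le> 2 * A * d" using mult_left_mono[OF Md, of "2 * A"] A by (simp add: mult.commute)
    finally show ?thesis .
  qed
  have S2: "S 2 \<le> 3 * A"
  proof -
    have "norm ((fdiff ^^ 2) c M) \<le> A * real M / real M ^ 2" using c M1 by simp
    also have "\<dots> = A * (1 / real M)" using M1 by (simp add: power2_eq_square)
    also have "\<dots> \<le> A * d" using Md A by (intro mult_left_mono) auto
    finally have "d * S 2 \<le> d * (3 * A)" using step[of 2] S3 by (simp add: numeral_3_eq_3 numeral_2_eq_2 mult_ac)
    then show ?thesis using d by simp
  qed
  have S1: "S 1 \<le> 4 * A / d"
  proof -
    have "norm ((fdiff ^^ 1) c M) \<le> A" using c[of 1 M] M1 by simp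
    then have "d * S 1 \<le> 4 * A" using step[of 1] S2 by (simp add: numeral_2_eq_2)
    then show ?thesis using d by (simp add: field_simps)
  qed
  have S0: "S 0 \<le> 7 * A / d ^ 2"
  proof -
    have "norm ((fdiff ^^ 0) c M) \<le> A * real M" using c[of 0 M] M1 by simp
    also have "\<dots> \<le> A * (3 / d)" using M3 A by (rule mult_left_mono)
    finally have "d * S 0 \<le> 7 * A / d" using step[of 0] S1 by simp
    then show ?thesis using d by (simp add: field_simps power2_eq_square)
  qed
  have I: "norm (\<Sum>t<min M R. c t * z ^ t) \<le> 9 * A / d ^ 2"
  proof -
    have "norm (\<Sum>t<min M R. c t * z ^ t) \<le> (\<Sum>t<min M R. A * real M)"
    proof (rule order_trans[OF norm_sum sum_mono])
      fix t assume t: "t \<in> {..<min M R}"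
      show "norm (c t * z ^ t) \<le> A * real M"
      proof (cases "t = 0")
        case False
        then have "norm (c t) \<le> A * real t" using c[of 0 t] by simp
        also have "\<dots> \<le> A * real M" using t A by (intro mult_left_mono) auto
        finally show ?thesis by (simp add: norm_mult norm_power z)
      qed (use c0 A in auto)
    qed
    also have "\<dots> \<le> real M * (A * real M)" using A by (simp add: mult_right_mono)
    also have "\<dots> = A * (real M * real M)" by simp
    also have "\<dots> \<le> A * (3 / d * (3 / d))"
      using M3 A d by (intro mult_left_mono mult_mono) auto
    finally show ?thesis by (simp add: power2_eq_square mult.commute)
  qed
  have "(\<Sum>t<R. c t * z ^ t) = (\<Sum>t<min M R. c t * z ^ t) + (\<Sum>t=M..<R. c t * z ^ t)"
  proof (cases "M \<le> R")
    case True
    have "{..<R} = {..<M} \<union> {M..<R}" using True by auto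
    then show ?thesis using True by (simp add: sum.union_disjoint ivl_disj_int min_def)
  qed (simp add: min_def)
  also have "norm \<dots> \<le> 9 * A / d ^ 2 + 7 * A / d ^ 2"
    using I S0 unfolding S_def by (intro order_trans[OF norm_triangle_ineq]) auto
  finally show ?thesis by (simp add: d_def add_divide_distrib[symmetric] distrib_right[symmetric])
qed

text \<open>Second differences of the index vanish, so the Leibniz rule has just two terms: (t + l)
  times the l-th difference of \<open>a\<close>, and \<open>l\<close> times the previous one. With l
  \<le> 3 and t \<ge> 1 they contribute 4 and 3. For l = 0 the truncated \<open>l - 1\<close> is
  multiplied by 0.\<close>

lemma symbol_seq_times_index:
  assumes "symbol_seq A a" "A \<ge> 0" "l \<le> 3" "t \<ge> 1"
  shows "norm ((fdiff ^^ l) (\<lambda>t. of_nat t * a t) t) \<le> 7 * A * real t / real t ^ l"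
proof -
  have a: "norm ((fdiff ^^ l) a t) \<le> A / real t ^ l" if "l \<le> 3" for l
    using assms that by (auto simp: symbol_seq_def)
  have rec: "(fdiff ^^ l) (\<lambda>t. of_nat t * a t) s = of_nat (s + l) * (fdiff ^^ l) a s + of_nat l * (fdiff ^^ (l - 1)) a s" for l s
  proof (induction l arbitrary: s)
    case (Suc l)
    have "(fdiff ^^ Suc l) (\<lambda>t. of_nat t * a t) s = (fdiff ^^ l) (\<lambda>t. of_nat t * a t) (s + 1) - (fdiff ^^ l) (\<lambda>t. of_nat t * a t) s"
      by (simp add: fdiff_def[of "(fdiff ^^ l) _"])
    also have "\<dots> = of_nat (s + Suc l) * (fdiff ^^ Suc l) a s + of_nat (Suc l) * (fdiff ^^ l) a s"
    proof (cases l)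
      case 0
      then show ?thesis unfolding Suc.IH by (simp add: fdiff_def algebra_simps)
    next
      case (Suc k)
      have 1: "(fdiff ^^ l) a r = (fdiff ^^ k) a (r + 1) - (fdiff ^^ k) a r" for r
        by (simp add: Suc fdiff_def[of "(fdiff ^^ k) _"])
      have 2: "(fdiff ^^ Suc l) a s = (fdiff ^^ l) a (s + 1) - (fdiff ^^ l) a s"
        by (simp add: fdiff_def[of "(fdiff ^^ l) _"])
      have 3: "(fdiff ^^ (l - 1)) a (s + 1) = (fdiff ^^ l) a s + (fdiff ^^ (l - 1)) a s"
        using 1[of s] Suc by simp
      show ?thesis unfolding Suc.IH 2 3 by (simp add: algebra_simps)
    qed
    finally show ?case by simp
  qed simp
  have t: "real t \<ge> 1" using assms by simp
  have "norm ((fdiff ^^ l) (\<lambda>t. of_nat t * a t) t) \<le> (real t + real l) * norm ((fdiff ^^ l) a t) + real l * norm ((fdiff ^^ (l - 1)) a t)"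
    unfolding rec by (rule order_trans[OF norm_triangle_ineq]) (simp add: norm_mult flip: of_nat_add)
  also have "\<dots> \<le> (4 * real t) * (A / real t ^ l) + 3 * (A * real t / real t ^ l)"
  proof (rule add_mono)
    show "(real t + real l) * norm ((fdiff ^^ l) a t) \<le> (4 * real t) * (A / real t ^ l)"
      using a assms t by (intro mult_mono) auto
    show "real l * norm ((fdiff ^^ (l - 1)) a t) \<le> 3 * (A * real t / real t ^ l)"
    proof (cases l)
      case (Suc k)
      have "norm ((fdiff ^^ k) a t) \<le> A * real t / real t ^ l"
        using a[of k] assms Suc t by simp
      then show ?thesis using assms Suc by (intro mult_mono) auto
    qed (use assms in simp)
  qed
  finally show ?thesis by (simp add: field_simps)
qed

lemma has_vector_derivative_iter_deriv:
  assumes "smooth_on S f" "t \<in> S"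
  shows "(iter_deriv l f has_vector_derivative iter_deriv (Suc l) f t) (at t)"
  using assms by (auto simp: smooth_on_def iter_deriv_def vector_derivative_works)

text \<open>The half lines are treated separately, since the mean value inequality must not cross
  the singularity at 0. The negative one is reflected, which puts the sign (-1)^l on the
  derivatives.\<close>

lemma marcinkiewicz_symbol_seq:
  assumes "marcinkiewicz_multiplier m"
  shows "\<exists>A\<ge>0. symbol_seq A (\<lambda>t. m (real t)) \<and> symbol_seq A (\<lambda>t. m (- real t))"
proof -
  from assms obtain A where sm: "smooth_on (- {0}) m"
    and A: "\<And>l t. l \<le> 4 \<Longrightarrow> t \<noteq> 0 \<Longrightarrow> norm (iter_deriv l m t) \<le> A / \<bar>t\<bar> ^ l"
    unfolding marcinkiewicz_multiplier_def by blast
  have A0: "A \<ge> 0" using A[of 0 1] by (simp add: order_trans[OF norm_ge_zero])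
  have *: "symbol_seq A (\<lambda>t. F (0::nat) (real t))"
    if F: "\<And>l s. s > 0 \<Longrightarrow> (F l has_vector_derivative F (Suc l) s) (at s)"
      "\<And>l s. l \<le> 3 \<Longrightarrow> s > 0 \<Longrightarrow> norm (F l s) \<le> A / s ^ l" for F
    unfolding symbol_seq_def fdiff_funpow_of_nat
    using norm_fdiff_funpow_le[of 3 F A _ 0] F A0 by auto
  have 1: "symbol_seq A (\<lambda>t. m (real t))"
  proof -
    have "norm (iter_deriv l m s) \<le> A / s ^ l" if "l \<le> 3" "s > 0" for l s
      using A[of l s] that by simp
    then show ?thesis
      using *[of "\<lambda>l. iter_deriv l m"] has_vector_derivative_iter_deriv[OF sm]
      by (simp add: iter_deriv_def)
  qed
  have 2: "symbol_seq A (\<lambda>t. m (- real t))"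
  proof -
    define F where "F = (\<lambda>l s. (-1) ^ l * iter_deriv l m (- s))"
    have "(F l has_vector_derivative F (Suc l) s) (at s)" if "s > 0" for l s
    proof -
      have "(iter_deriv l m \<circ> uminus has_vector_derivative (-1) *\<^sub>R iter_deriv (Suc l) m (- s)) (at s)"
        by (rule vector_diff_chain_at)
          (use that in \<open>auto intro!: derivative_eq_intros has_vector_derivative_iter_deriv[OF sm]\<close>)
      then have "((\<lambda>s. (-1) ^ l * (iter_deriv l m \<circ> uminus) s) has_vector_derivative
          (-1) ^ l * ((-1) *\<^sub>R iter_deriv (Suc l) m (- s))) (at s)"
        by (rule has_vector_derivative_mult_right)
      then show ?thesis by (simp add: F_def o_def)
    qed
    moreover have "norm (F l s) \<le> A / s ^ l" if "l \<le> 3" "s > 0" for l s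
      using A[of l "- s"] that by (simp add: F_def norm_mult norm_power)
    ultimately show ?thesis using *[of F] by (simp add: F_def iter_deriv_def)
  qed
  show ?thesis using 1 2 A0 by blast
qed

lemma char_fun_cis: "char_fun k x = cis (2 * pi * of_int k * x)"
  by (simp add: char_fun_def cis_conv_exp mult_ac)

lemma sum_int_symmetric:
  fixes g :: "int \<Rightarrow> 'a::comm_monoid_add"
  shows "(\<Sum>t\<in>{- int N..int N}. g t) = g 0 + ((\<Sum>t=1..N. g (int t)) + (\<Sum>t=1..N. g (- int t)))"
proof -
  have "{- int N..int N} = {0} \<union> (int ` {1..N} \<union> (\<lambda>t. - int t) ` {1..N})"
  proof (intro equalityI subsetI)
    fix x assume "x \<in> {- int N..int N}"
    then show "x \<in> {0} \<union> (int ` {1..N} \<union> (\<lambda>t. - int t) ` {1..N})"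
      by (cases x rule: int_cases2) (auto simp: image_iff Bex_def)
  qed auto
  also have "(\<Sum>t\<in>\<dots>. g t) = g 0 + ((\<Sum>t\<in>int ` {1..N}. g t) + (\<Sum>t\<in>(\<lambda>t. - int t) ` {1..N}. g t))"
    by (subst sum.union_disjoint; (subst sum.union_disjoint)?) auto
  also have "(\<Sum>t\<in>int ` {1..N}. g t) = (\<Sum>t=1..N. g (int t))"
    by (subst sum.reindex) auto
  also have "(\<Sum>t\<in>(\<lambda>t. - int t) ` {1..N}. g t) = (\<Sum>t=1..N. g (- int t))"
    by (subst sum.reindex) (auto simp: inj_on_def)
  finally show ?thesis .
qed

text \<open>The chord has length 2 |sin (pi u)|, and concavity of the sine keeps it above its secant
  from 0 to pi/2.\<close>

lemma norm_one_minus_cis_ge: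
  assumes "\<bar>u\<bar> \<le> 1/2"
  shows "4 * \<bar>u\<bar> \<le> norm (1 - cis (2 * pi * u))"
proof -
  have 1: "2 * v \<le> sin (pi * v)" if v: "0 \<le> v" "v \<le> 1/2" for v
  proof -
    have cc: "concave_on {0..pi} sin"
      unfolding concave_on_def
      by (rule f''_ge0_imp_convex[where f' = "\<lambda>x. - cos x" and f'' = sin])
        (auto intro!: derivative_eq_intros sin_ge_zero)
    have "(1 - 2 * v) * sin 0 + (2 * v) * sin (pi / 2) \<le> sin ((1 - 2 * v) *\<^sub>R 0 + (2 * v) *\<^sub>R (pi / 2))"
      using v by (intro concave_onD[OF cc]) auto
    then show ?thesis by (simp add: mult_ac)
  qed
  have "4 * \<bar>u\<bar> \<le> 2 * sin (pi * \<bar>u\<bar>)" using 1[of "\<bar>u\<bar>"] assms by simp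
  also have "\<dots> \<le> 2 * \<bar>sin (pi * u)\<bar>" by (cases "u \<ge> 0") auto
  also have "\<dots> = norm (1 - cis (2 * pi * u))"
  proof -
    have "1 - cis (2 * pi * u) = 1 - cis (pi * u) * cis (pi * u)"
      by (simp add: cis_mult mult.assoc)
    also have "\<dots> = cis (pi * u) * (cis (- (pi * u)) - cis (pi * u))"
      by (simp add: algebra_simps cis_mult)
    also have "cis (- (pi * u)) - cis (pi * u) = - 2 * \<i> * of_real (sin (pi * u))"
      by (simp add: complex_eq_iff)
    finally show ?thesis by (simp add: norm_mult)
  qed
  finally show ?thesis .
qed

definition cesaro_weight :: "(real \<Rightarrow> complex) \<Rightarrow> nat \<Rightarrow> int \<Rightarrow> complex" where
  "cesaro_weight m N t = m (of_int t) * of_real (cesaro N (nat \<bar>t\<bar>))"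

text \<open>Differentiation annihilates frequency 0. The positive frequencies form a power sum in z
  = exp(2 pi i u), the negative ones in its conjugate, at the same distance from 1. The bound |1 -
  z| \<ge> 4 |u| cancels the factor 16 of the one-sided estimate.\<close>

lemma kernel_deriv_bound:
  assumes "marcinkiewicz_multiplier m"
  shows "\<exists>A\<ge>0. \<forall>N u. 0 < \<bar>u\<bar> \<longrightarrow> \<bar>u\<bar> \<le> 1/2 \<longrightarrow>
    norm (\<Sum>t\<in>{- int N..int N}. cesaro_weight m N t * (2 * pi * \<i> * of_int t) * char_fun t u) \<le> A / u ^ 2"
proof -
  obtain A where A: "A \<ge> 0" "symbol_seq A (\<lambda>t. m (real t))" "symbol_seq A (\<lambda>t. m (- real t))"
    using marcinkiewicz_symbol_seq[OF assms] by blast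
  \<comment> \<open>6 comes from the Cesaro weights, 8 from the product with the multiplier, 7 from
    the factor \<open>t\<close>.\<close>
  define B where "B = 7 * (8 * A * 6)"
  have B0: "B \<ge> 0" using A by (simp add: B_def)
  have one: "norm (\<Sum>t=1..N. (of_nat t * (a t * of_real (cesaro N t))) * z ^ t) \<le> 16 * B / norm (1 - z) ^ 2"
    if a: "symbol_seq A a" and z: "norm z = 1" "z \<noteq> 1" for a N z
  proof -
    define c where "c = (\<lambda>t. of_nat t * (a t * complex_of_real (cesaro N t)))"
    have "norm (\<Sum>t<N+1. c t * z ^ t) \<le> 16 * B / norm (1 - z) ^ 2"
    proof (rule one_sided_kernel_bound)
      fix l t :: nat assume lt: "l \<le> 3" "t \<ge> 1"
      show "norm ((fdiff ^^ l) c t) \<le> B * real t / real t ^ l"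
        unfolding c_def B_def
        by (rule symbol_seq_times_index[OF symbol_seq_mult[OF a symbol_seq_cesaro]]) (use A lt in auto)
    qed (use z B0 in \<open>auto simp: c_def cesaro_eq_0\<close>)
    also have "(\<Sum>t<N+1. c t * z ^ t) = (\<Sum>t=1..N. c t * z ^ t)"
      by (rule sum.mono_neutral_right) (auto simp: c_def Suc_le_eq)
    finally show ?thesis by (simp add: c_def)
  qed
  have "norm (\<Sum>t\<in>{- int N..int N}. cesaro_weight m N t * (2 * pi * \<i> * of_int t) * char_fun t u) \<le> (4 * pi * B) / u ^ 2"
    if u: "0 < \<bar>u\<bar>" "\<bar>u\<bar> \<le> 1/2" for N u
  proof -
    define z where "z = cis (2 * pi * u)"
    have zn: "4 * \<bar>u\<bar> \<le> norm (1 - z)" unfolding z_def by (rule norm_one_minus_cis_ge) fact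
    have zc: "norm (1 - cnj z) = norm (1 - z)"
      by (metis complex_cnj_diff complex_cnj_one complex_mod_cnj)
    have z1: "norm z = 1" "z \<noteq> 1" "norm (cnj z) = 1" "cnj z \<noteq> 1"
      using zn u zc by (auto simp: z_def)
    have bd: "16 * B / norm (1 - z) ^ 2 \<le> B / u ^ 2"
    proof -
      have "(4 * \<bar>u\<bar>) ^ 2 \<le> norm (1 - z) ^ 2" using zn by (intro power_mono) auto
      then have "16 * B / norm (1 - z) ^ 2 \<le> 16 * B / (4 * \<bar>u\<bar>) ^ 2"
        using u B0 by (intro divide_left_mono mult_pos_pos) (auto intro: order_less_le_trans[rotated])
      then show ?thesis by (simp add: power_mult_distrib)
    qed
    have nn: "norm (2 * pi * \<i>) = 2 * pi" by (simp add: norm_mult)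
    have zp: "char_fun (int t) u = z ^ t" "char_fun (- int t) u = cnj z ^ t" for t
      unfolding char_fun_cis z_def cis_cnj Complex.DeMoivre
      by (rule arg_cong[where f = cis], simp)+
    have "(\<Sum>t\<in>{- int N..int N}. cesaro_weight m N t * (2 * pi * \<i> * of_int t) * char_fun t u)
      = (2 * pi * \<i>) * ((\<Sum>t=1..N. (of_nat t * (m (real t) * of_real (cesaro N t))) * z ^ t)
        - (\<Sum>t=1..N. (of_nat t * (m (- real t) * of_real (cesaro N t))) * cnj z ^ t))"
      unfolding sum_int_symmetric zp
      by (simp add: cesaro_weight_def sum_distrib_left right_diff_distrib sum_negf mult_ac)
    also have "norm \<dots> \<le> 2 * pi * (B / u ^ 2 + B / u ^ 2)"
      unfolding norm_mult[of "2 * pi * \<i>"] nn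
      by (intro mult_left_mono order_trans[OF norm_triangle_ineq4] add_mono
          order_trans[OF one[OF A(2) z1(1,2)] bd] order_trans[OF one[OF A(3) z1(3,4)] bd[folded zc]])
        auto
    finally show ?thesis by (simp add: algebra_simps add_divide_distrib[symmetric])
  qed
  moreover have "4 * pi * B \<ge> 0" using B0 by simp
  ultimately show ?thesis by blast
qed

section \<open>Fourier coefficients on the circle\<close>

interpretation circle: prob_space circle by (rule prob_space_circle)

lemma space_circle: "space circle = {0..<1}"
  by (simp add: circle_def space_restrict_space)

lemma borel_measurable_circleI [measurable (raw)]:
  "h \<in> borel_measurable borel \<Longrightarrow> h \<in> borel_measurable circle"
  unfolding circle_def by (intro measurable_restrict_space1 measurable_completion) simp

lemma sets_circleI: "A \<in> sets borel \<Longrightarrow> A \<subseteq> {0..<1} \<Longrightarrow> A \<in> sets circle"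
  unfolding circle_def by (subst sets_restrict_space_iff) auto

lemma char_fun_measurable [measurable]: "char_fun k \<in> borel_measurable borel"
  unfolding char_fun_def by measurable

lemma char_fun_measurable_circle [measurable]: "char_fun k \<in> borel_measurable circle"
  by (rule borel_measurable_circleI) simp

lemma norm_char_fun [simp]: "norm (char_fun k x) = 1"
proof -
  have "2 * of_real pi * \<i> * of_int k * of_real x = \<i> * of_real (2 * pi * of_int k * x)" by simp
  then show ?thesis unfolding char_fun_def by (simp only: norm_exp_i_times)
qed

lemma char_fun_0 [simp]: "char_fun 0 x = 1" by (simp add: char_fun_def)

lemma char_fun_add: "char_fun (j + k) x = char_fun j x * char_fun k x"
  by (simp add: char_fun_def algebra_simps flip: exp_add)

lemma char_fun_diff_arg: "char_fun k (x - y) = char_fun k x * char_fun (- k) y"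
  by (simp add: char_fun_def algebra_simps flip: exp_add)

lemma char_fun_add_int: "char_fun k (x + of_int j) = char_fun k x"
proof -
  have "char_fun k (x + of_int j) = char_fun k x * exp ((2 * of_int (k * j) * pi) * \<i>)"
    by (simp add: char_fun_def algebra_simps flip: exp_add)
  also have "exp ((2 * of_int (k * j) * pi) * \<i>) = 1"
    using exp_integer_2pi[of "of_int (k * j)"] by (simp add: Ints_of_int)
  finally show ?thesis by simp
qed

lemma cnj_char_fun: "cnj (char_fun k x) = char_fun (- k) x"
  by (simp add: char_fun_def exp_cnj)

lemma char_fun_has_vector_derivative:
  "(char_fun k has_vector_derivative (2 * of_real pi * \<i> * of_int k) * char_fun k x) (at x within S)"
proof -
  have "((\<lambda>z. exp (2 * of_real pi * \<i> * of_int k * z)) has_field_derivative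
      (2 * of_real pi * \<i> * of_int k) * char_fun k x) (at (of_real x))"
    unfolding char_fun_def by (auto intro!: derivative_eq_intros)
  then have "((\<lambda>x. exp (2 * of_real pi * \<i> * of_int k * of_real x)) has_vector_derivative
      (2 * of_real pi * \<i> * of_int k) * char_fun k x) (at x within S)"
    by (rule has_vector_derivative_real_field)
  then show ?thesis by (simp add: char_fun_def[abs_def])
qed

lemma integral_circle_eq:
  fixes f :: "real \<Rightarrow> complex"
  assumes "continuous_on {0..1} f"
  shows "(LINT x|circle. f x) = integral {0..1} f"
proof -
  have "(f absolutely_integrable_on {0..1})" using assms by (rule absolutely_integrable_continuous_real)
  then have "f absolutely_integrable_on {0..<1}"
    by (rule set_integrable_subset) auto
  then have "integrable circle f"
    unfolding circle_def by (simp add: integrable_restrict_space set_integrable_def)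
  then have "(LINT x|circle. f x) = integral {0..<1} f"
    unfolding circle_def by (intro lebesgue_integral_eq_integral) auto
  also have "\<dots> = integral {0..1} f"
    by (rule integral_subset_negligible) (auto intro: negligible_subset[of "{1}"])
  finally show ?thesis .
qed

lemma integral_circle_vector_derivative:
  fixes F :: "real \<Rightarrow> complex"
  assumes "\<And>x. (F has_vector_derivative F' x) (at x)" "continuous_on {0..1} F'"
  shows "(LINT x|circle. F' x) = F 1 - F 0"
proof -
  have "(F' has_integral F 1 - F 0) {0..1}"
    by (rule fundamental_theorem_of_calculus) (auto intro: has_vector_derivative_at_within assms)
  then show ?thesis using integral_circle_eq[OF assms(2)] by (simp add: integral_unique)
qed

lemma char_fun_continuous_on: "continuous_on S (char_fun k)"
  unfolding char_fun_def by (intro continuous_intros)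

lemma integral_char_fun: "(LINT x|circle. char_fun k x) = (if k = 0 then 1 else 0)"
proof (cases "k = 0")
  case False
  have "(LINT x|circle. (2 * of_real pi * \<i> * of_int k) * char_fun k x) = char_fun k 1 - char_fun k 0"
    by (rule integral_circle_vector_derivative)
      (auto intro!: char_fun_has_vector_derivative continuous_intros char_fun_continuous_on)
  also have "\<dots> = 0" using char_fun_add_int[of k 0 1] by simp
  finally show ?thesis using False by simp
qed (simp add: circle.prob_space)

lemma integrable_mult_char_fun [intro]:
  "integrable circle f \<Longrightarrow> integrable circle (\<lambda>x. f x * char_fun k x)"
  by (rule Bochner_Integration.integrable_bound[of circle f]) (auto simp: norm_mult)

lemma integrable_circle_bounded:
  fixes f :: "real \<Rightarrow> 'b::{banach,second_countable_topology}"
  assumes "f \<in> borel_measurable circle" "\<And>x. x \<in> {0..<1} \<Longrightarrow> norm (f x) \<le> B"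
  shows "integrable circle f"
  using assms by (intro circle.integrable_const_bound[where B = B]) (auto simp: space_circle intro!: AE_I2)

lemma fourier_coeff_add:
  "integrable circle f \<Longrightarrow> integrable circle g \<Longrightarrow>
    fourier_coeff (\<lambda>x. f x + g x) k = fourier_coeff f k + fourier_coeff g k"
  unfolding fourier_coeff_def distrib_right
  by (intro Bochner_Integration.integral_add integrable_mult_char_fun)

lemma norm_fourier_coeff_le:
  "integrable circle f \<Longrightarrow> norm (fourier_coeff f k) \<le> (LINT x|circle. norm (f x))"
  unfolding fourier_coeff_def
  by (rule order_trans[OF integral_norm_bound]) (simp add: norm_mult)

lemma fourier_coeff_cnj: "fourier_coeff (\<lambda>x. cnj (f x)) (- k) = cnj (fourier_coeff f k)"
  unfolding fourier_coeff_def
  by (subst Bochner_Integration.integral_cnj[symmetric]) (simp only: complex_cnj_mult cnj_char_fun)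

section \<open>Trigonometric polynomials, Parseval and Bessel\<close>

definition trig_poly :: "int set \<Rightarrow> (int \<Rightarrow> complex) \<Rightarrow> real \<Rightarrow> complex" where
  "trig_poly S c x = (\<Sum>t\<in>S. c t * char_fun t x)"

lemma trig_poly_measurable [measurable]: "trig_poly S c \<in> borel_measurable borel"
  unfolding trig_poly_def by measurable

lemma trig_poly_measurable_circle [measurable]: "trig_poly S c \<in> borel_measurable circle"
  by (rule borel_measurable_circleI) simp

lemma norm_trig_poly_le: "norm (trig_poly S c x) \<le> (\<Sum>t\<in>S. norm (c t))"
  unfolding trig_poly_def by (rule order_trans[OF norm_sum]) (simp add: norm_mult)

lemma integrable_trig_poly [intro]: "integrable circle (trig_poly S c)"
  by (rule integrable_circle_bounded[OF _ norm_trig_poly_le]) measurable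

lemma integral_mult_trig_poly:
  assumes "integrable circle f"
  shows "(LINT x|circle. f x * trig_poly S c x) = (\<Sum>t\<in>S. c t * fourier_coeff f (- t))"
proof -
  have "(LINT x|circle. f x * trig_poly S c x) = (LINT x|circle. (\<Sum>t\<in>S. c t * (f x * char_fun t x)))"
    unfolding trig_poly_def sum_distrib_left by (simp add: mult_ac)
  also have "\<dots> = (\<Sum>t\<in>S. c t * (LINT x|circle. f x * char_fun t x))"
    using assms by (subst Bochner_Integration.integral_sum) auto
  finally show ?thesis by (simp add: fourier_coeff_def)
qed

lemma fourier_coeff_trig_poly:
  assumes "finite S"
  shows "fourier_coeff (trig_poly S c) k = (if k \<in> S then c k else 0)"
proof -
  have "fourier_coeff (trig_poly S c) k = (LINT x|circle. char_fun (- k) x * trig_poly S c x)"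
    by (simp add: fourier_coeff_def mult.commute)
  also have "\<dots> = (\<Sum>t\<in>S. c t * fourier_coeff (char_fun (- k)) (- t))"
    by (rule integral_mult_trig_poly, rule integrable_circle_bounded[where B = 1]) auto
  also have "\<dots> = (\<Sum>t\<in>S. if t = k then c t else 0)"
    by (intro sum.cong) (auto simp: fourier_coeff_def integral_char_fun simp flip: char_fun_add)
  also have "\<dots> = (if k \<in> S then c k else 0)" using assms by (simp add: sum.delta)
  finally show ?thesis .
qed

lemma parseval_trig_poly:
  assumes "finite S"
  shows "(LINT x|circle. norm (trig_poly S c x) ^ 2) = (\<Sum>t\<in>S. norm (c t) ^ 2)"
proof -
  have cnj: "cnj (trig_poly S c x) = (\<Sum>t\<in>S. cnj (c t) * char_fun (- t) x)" for x
    by (simp add: trig_poly_def cnj_char_fun)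
  have "complex_of_real (LINT x|circle. norm (trig_poly S c x) ^ 2) = (LINT x|circle. cnj (trig_poly S c x) * trig_poly S c x)"
    unfolding integral_complex_of_real[symmetric]
    by (intro Bochner_Integration.integral_cong) (simp_all add: complex_norm_square mult.commute del: of_real_power)
  also have "\<dots> = (\<Sum>t\<in>S. c t * fourier_coeff (\<lambda>x. cnj (trig_poly S c x)) (- t))"
    by (rule integral_mult_trig_poly) auto
  also have "\<dots> = (\<Sum>t\<in>S. c t * cnj (c t))"
  proof (intro sum.cong refl)
    fix t assume t: "t \<in> S"
    have "fourier_coeff (\<lambda>x. cnj (trig_poly S c x)) (- t) = cnj (fourier_coeff (trig_poly S c) t)"
      by (rule fourier_coeff_cnj)
    then show "c t * fourier_coeff (\<lambda>x. cnj (trig_poly S c x)) (- t) = c t * cnj (c t)"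
      using t assms by (simp add: fourier_coeff_trig_poly)
  qed
  also have "\<dots> = complex_of_real (\<Sum>t\<in>S. norm (c t) ^ 2)"
    by (simp add: complex_norm_square del: of_real_power)
  finally show ?thesis by (simp only: of_real_eq_iff)
qed

text \<open>Expansion of the nonnegative integral of |f - p|^2, where \<open>p\<close> is the
  partial Fourier sum over \<open>S\<close>: the cross term and the norm of \<open>p\<close> both
  equal \<open>E\<close>. Boundedness makes all products integrable and holds for the truncations to
  which this is applied.\<close>

lemma bessel:
  assumes [measurable]: "f \<in> borel_measurable circle" and bd: "\<And>x. x \<in> {0..<1} \<Longrightarrow> norm (f x) \<le> B" and "finite S"
  shows "(\<Sum>t\<in>S. norm (fourier_coeff f t) ^ 2) \<le> (LINT x|circle. norm (f x) ^ 2)"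
proof -
  define p where "p = trig_poly S (fourier_coeff f)"
  define E where "E = (\<Sum>t\<in>S. norm (fourier_coeff f t) ^ 2)"
  have [measurable]: "p \<in> borel_measurable circle" unfolding p_def by measurable
  have fi: "integrable circle f" by (rule integrable_circle_bounded[OF _ bd]) auto
  have pb: "norm (p x) \<le> (\<Sum>t\<in>S. norm (fourier_coeff f t))" for x
    unfolding p_def by (rule norm_trig_poly_le)
  have i1: "integrable circle (\<lambda>x. norm (f x) ^ 2)"
    by (rule integrable_circle_bounded[where B = "B ^ 2"]) (use bd in \<open>auto intro: power_mono\<close>)
  have i2: "integrable circle (\<lambda>x. norm (p x) ^ 2)"
    by (rule integrable_circle_bounded[where B = "(\<Sum>t\<in>S. norm (fourier_coeff f t)) ^ 2"])
      (use pb in \<open>auto intro: power_mono\<close>)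
  have [measurable]: "(\<lambda>x. cnj (p x)) \<in> borel_measurable circle"
    unfolding p_def by (rule borel_measurable_integrable) auto
  have i3: "integrable circle (\<lambda>x. cnj (p x) * f x)"
    by (rule integrable_circle_bounded[where B = "(\<Sum>t\<in>S. norm (fourier_coeff f t)) * B"])
      (use pb bd in \<open>auto simp: norm_mult intro!: mult_mono order_trans[OF norm_ge_zero pb]\<close>)
  have cross: "(LINT x|circle. Re (cnj (p x) * f x)) = E"
  proof -
    have "(LINT x|circle. cnj (p x) * f x) = cnj (LINT x|circle. cnj (f x) * p x)"
      by (subst Bochner_Integration.integral_cnj[symmetric]) (simp only: complex_cnj_mult complex_cnj_cnj mult.commute)
    also have "(LINT x|circle. cnj (f x) * p x) = (\<Sum>t\<in>S. fourier_coeff f t * fourier_coeff (\<lambda>x. cnj (f x)) (- t))"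
      unfolding p_def by (rule integral_mult_trig_poly) (use fi in simp)
    also have "\<dots> = (\<Sum>t\<in>S. fourier_coeff f t * cnj (fourier_coeff f t))"
      by (simp only: fourier_coeff_cnj)
    also have "\<dots> = of_real E" by (simp add: E_def complex_norm_square del: of_real_power)
    finally show ?thesis using integral_Re[OF i3] by simp
  qed
  have "0 \<le> (LINT x|circle. norm (f x - p x) ^ 2)" by simp
  also have "\<dots> = (LINT x|circle. norm (f x) ^ 2 - 2 * Re (cnj (p x) * f x) + norm (p x) ^ 2)"
  proof (intro Bochner_Integration.integral_cong refl)
    fix x
    show "norm (f x - p x) ^ 2 = norm (f x) ^ 2 - 2 * Re (cnj (p x) * f x) + norm (p x) ^ 2"
      unfolding cmod_power2 by (simp add: power2_eq_square algebra_simps)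
  qed
  also have "\<dots> = (LINT x|circle. norm (f x) ^ 2) - 2 * E + E"
  proof -
    have "integrable circle (\<lambda>x. Re (cnj (p x) * f x))" using i3 by (rule integrable_Re)
    then show ?thesis
      using i1 i2 cross parseval_trig_poly[OF \<open>finite S\<close>, of "fourier_coeff f"]
      by (simp add: E_def p_def del: times_complex.simps)
  qed
  finally show ?thesis by (simp add: E_def)
qed

lemma trig_poly_l2_bound:
  assumes [measurable]: "f \<in> borel_measurable circle" and bd: "\<And>x. x \<in> {0..<1} \<Longrightarrow> norm (f x) \<le> L" and "finite S"
    and a: "\<And>t. t \<in> S \<Longrightarrow> norm (a t) \<le> B" and "B \<ge> 0"
  shows "(LINT x|circle. norm (trig_poly S (\<lambda>t. a t * fourier_coeff f t) x) ^ 2) \<le> B ^ 2 * (LINT x|circle. norm (f x) ^ 2)"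
proof -
  have "(LINT x|circle. norm (trig_poly S (\<lambda>t. a t * fourier_coeff f t) x) ^ 2) = (\<Sum>t\<in>S. norm (a t) ^ 2 * norm (fourier_coeff f t) ^ 2)"
    using assms by (simp add: parseval_trig_poly norm_mult power_mult_distrib)
  also have "\<dots> \<le> (\<Sum>t\<in>S. B ^ 2 * norm (fourier_coeff f t) ^ 2)"
    using a by (intro sum_mono mult_right_mono power_mono) auto
  also have "\<dots> \<le> B ^ 2 * (LINT x|circle. norm (f x) ^ 2)"
    unfolding sum_distrib_left[symmetric] using bessel[OF assms(1) bd] assms by (intro mult_left_mono) auto
  finally show ?thesis .
qed

lemma trig_poly_convolution:
  assumes "integrable circle f"
  shows "trig_poly S (\<lambda>t. a t * fourier_coeff f t) x = (LINT y|circle. f y * trig_poly S a (x - y))"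
proof -
  have "(LINT y|circle. f y * trig_poly S a (x - y)) = (LINT y|circle. (\<Sum>t\<in>S. (a t * char_fun t x) * (f y * char_fun (- t) y)))"
    unfolding trig_poly_def sum_distrib_left by (simp add: mult_ac char_fun_diff_arg)
  also have "\<dots> = (\<Sum>t\<in>S. (a t * char_fun t x) * (LINT y|circle. f y * char_fun (- t) y))"
    using assms by (subst Bochner_Integration.integral_sum) auto
  finally show ?thesis by (simp add: trig_poly_def fourier_coeff_def mult_ac)
qed

section \<open>Weak type estimates\<close>

lemma nn_integral_circle_le:
  assumes [measurable]: "h \<in> borel_measurable borel"
  shows "(\<integral>\<^sup>+ x. h x \<partial>circle) \<le> (\<integral>\<^sup>+ x. h x \<partial>lborel)"
proof -
  have "(\<integral>\<^sup>+ x. h x \<partial>circle) = (\<integral>\<^sup>+ x. h x * indicator {0..<1} x \<partial>lebesgue)"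
    unfolding circle_def by (subst nn_integral_restrict_space) auto
  also have "\<dots> = (\<integral>\<^sup>+ x. h x * indicator {0..<1} x \<partial>lborel)"
    by (rule nn_integral_completion)
  also have "\<dots> \<le> (\<integral>\<^sup>+ x. h x \<partial>lborel)"
    by (intro nn_integral_mono) (auto simp: indicator_def)
  finally show ?thesis .
qed

lemma emeasure_circle_eq:
  assumes "X \<in> sets borel" "X \<subseteq> {0..<1}"
  shows "emeasure circle X = emeasure lborel X"
  unfolding circle_def using assms by (subst emeasure_restrict_space) auto

lemma trig_poly_has_vector_derivative:
  "(trig_poly S a has_vector_derivative trig_poly S (\<lambda>t. a t * (2 * of_real pi * \<i> * of_int t)) x) (at x)"
proof -
  have "((\<lambda>x. \<Sum>t\<in>S. a t * char_fun t x) has_vector_derivative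
    (\<Sum>t\<in>S. a t * ((2 * of_real pi * \<i> * of_int t) * char_fun t x))) (at x)"
    by (intro has_vector_derivative_sum has_vector_derivative_mult_right char_fun_has_vector_derivative)
  then show ?thesis by (simp add: trig_poly_def[abs_def] mult_ac)
qed

lemma trig_poly_add_int: "trig_poly S a (x + of_int j) = trig_poly S a x"
  by (simp add: trig_poly_def char_fun_add_int)

text \<open>The dyadic stopping time at height \<open>l\<close>, run for \<open>J\<close> steps: an interval of the partition is either
  one on which it stopped, or has the minimal length.\<close>

lemma cz_partition:
  fixes \<mu> :: "real \<Rightarrow> real \<Rightarrow> real"
  assumes add: "\<And>a b c. a \<le> b \<Longrightarrow> b \<le> c \<Longrightarrow> \<mu> a c = \<mu> a b + \<mu> b c"
    and nonneg: "\<And>a b. 0 \<le> \<mu> a b" and l: "l \<ge> 0"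
    and "a < b" "\<mu> a b \<le> l * (b - a)"
  shows "\<exists>P. finite P \<and> disjoint_family_on (\<lambda>p. {fst p..<snd p}) P \<and> (\<Union>p\<in>P. {fst p..<snd p}) = {a..<b} \<and>
    (\<forall>p\<in>P. fst p < snd p \<and> \<mu> (fst p) (snd p) \<le> 2 * l * (snd p - fst p) \<and>
      (snd p - fst p = (b - a) / 2 ^ J \<or> l * (snd p - fst p) < \<mu> (fst p) (snd p)))"
    (is "\<exists>P. ?Q J a b P")
  using assms(4,5)
proof (induction J arbitrary: a b)
  case 0
  have "l * (b - a) \<le> 2 * l * (b - a)" using l 0 by (intro mult_right_mono) auto
  then have "?Q 0 a b {(a, b)}" using 0 by (auto simp: disjoint_family_on_def)
  then show ?case by blast
next
  case (Suc J)
  define c where "c = (a + b) / 2"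
  have c: "a < c" "c < b" "c - a = (b - a) / 2" "b - c = (b - a) / 2" using Suc.prems by (auto simp: c_def field_simps)
  have half: "\<exists>P. ?Q J u v P" if uv: "u < v" "v - u = (b - a) / 2" "\<mu> u v \<le> \<mu> a b" for u v
  proof (cases "\<mu> u v \<le> l * (v - u)")
    case True
    then show ?thesis using Suc.IH uv by blast
  next
    case False
    \<comment> \<open>This half stops. Its mass is at most that of the parent, which passed the test
      at height \<open>l\<close> on twice the length; hence the average is at most 2 l.\<close>
    have "\<mu> u v \<le> l * (b - a)" using uv Suc.prems by simp
    also have "l * (b - a) = 2 * l * (v - u)" using uv by simp
    finally have "?Q J u v {(u, v)}" using False uv(1) by (simp add: disjoint_family_on_def not_le)
    then show ?thesis by blast
  qed
  have "\<mu> a b = \<mu> a c + \<mu> c b" using add c by simp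
  then have "\<mu> a c \<le> \<mu> a b" "\<mu> c b \<le> \<mu> a b" using nonneg[of a c] nonneg[of c b] by auto
  then obtain P1 P2 where P: "?Q J a c P1" "?Q J c b P2"
    using half[OF c(1,3)] half[OF c(2,4)] by blast
  have sub: "{fst p..<snd p} \<subseteq> {a..<c}" if "p \<in> P1" for p
  proof -
    have "{fst p..<snd p} \<subseteq> (\<Union>p\<in>P1. {fst p..<snd p})" using that by blast
    then show ?thesis using P(1) by simp
  qed
  have sub2: "{fst p..<snd p} \<subseteq> {c..<b}" if "p \<in> P2" for p
  proof -
    have "{fst p..<snd p} \<subseteq> (\<Union>p\<in>P2. {fst p..<snd p})" using that by blast
    then show ?thesis using P(2) by simp
  qed
  have "disjoint_family_on (\<lambda>p. {fst p..<snd p}) (P1 \<union> P2)"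
    unfolding disjoint_family_on_def
  proof (intro ballI impI)
    fix p q assume pq: "p \<in> P1 \<union> P2" "q \<in> P1 \<union> P2" "p \<noteq> q"
    have cd: "{a..<c} \<inter> {c..<b} = {}" by auto
    consider "p \<in> P1" "q \<in> P1" | "p \<in> P2" "q \<in> P2" | "p \<in> P1" "q \<in> P2" | "p \<in> P2" "q \<in> P1" using pq by blast
    then show "{fst p..<snd p} \<inter> {fst q..<snd q} = {}"
    proof cases
      case 1 then show ?thesis using P(1) pq(3) by (auto simp: disjoint_family_on_def)
    next
      case 2 then show ?thesis using P(2) pq(3) by (auto simp: disjoint_family_on_def)
    next
      case 3 then show ?thesis using sub[of p] sub2[of q] cd by blast
    next
      case 4 then show ?thesis using sub[of q] sub2[of p] cd by blast
    qed
  qed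
  moreover have "(\<Union>p\<in>P1 \<union> P2. {fst p..<snd p}) = {a..<b}"
    using P c by (simp add: UN_Un ivl_disj_un)
  moreover have "(c - a) / 2 ^ J = (b - a) / 2 ^ Suc J" "(b - c) / 2 ^ J = (b - a) / 2 ^ Suc J" unfolding c(3,4) by auto
  ultimately have "?Q (Suc J) a b (P1 \<union> P2)" using P by auto
  then show ?case by blast
qed

text \<open>The decay of the kernel difference away from an interval of length \<open>r\<close>. It
  is normalised to be invariant under scaling, so its integral has a bound free of
  \<open>r\<close>.\<close>

definition tail_weight :: "real \<Rightarrow> real \<Rightarrow> real" where
  "tail_weight r v = (if r \<le> \<bar>v\<bar> then r / v ^ 2 else 0)"

lemma tail_weight_measurable [measurable]: "tail_weight r \<in> borel_measurable borel"
  unfolding tail_weight_def by measurable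

lemma tail_weight_nonneg: "r > 0 \<Longrightarrow> 0 \<le> tail_weight r v" by (simp add: tail_weight_def)

lemma nn_integral_tail_weight:
  assumes r: "r > 0"
  shows "(\<integral>\<^sup>+ v. ennreal (tail_weight r v) \<partial>lborel) \<le> 2"
proof -
  have half: "(\<integral>\<^sup>+ v. ennreal (r / v ^ 2) * indicator {r..} v \<partial>lborel) = 1"
  proof -
    have "(\<integral>\<^sup>+ v. ennreal (r / v ^ 2) * indicator {r..} v \<partial>lborel) = ennreal (0 - (- r / r))"
    proof (rule nn_integral_FTC_atLeast[where F = "\<lambda>x. - r / x"])
      fix x assume "r \<le> x"
      then show "DERIV (\<lambda>x. - r / x) x :> r / x ^ 2" "0 \<le> r / x ^ 2"
        using r by (auto intro!: derivative_eq_intros simp: power2_eq_square)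
    next
      show "((\<lambda>x. - r / x) \<longlongrightarrow> 0) at_top"
        by (intro tendsto_divide_0[OF tendsto_const] filterlim_at_top_imp_at_infinity filterlim_ident)
    qed auto
    then show ?thesis using r by simp
  qed
  have half': "(\<integral>\<^sup>+ v. ennreal (r / v ^ 2) * indicator {r..} (- v) \<partial>lborel) = 1"
    using nn_integral_real_affine[of "\<lambda>v. ennreal (r / v ^ 2) * indicator {r..} v" "-1" 0] half by simp
  have "(\<integral>\<^sup>+ v. ennreal (tail_weight r v) \<partial>lborel)
    \<le> (\<integral>\<^sup>+ v. ennreal (r / v ^ 2) * indicator {r..} v + ennreal (r / v ^ 2) * indicator {r..} (- v) \<partial>lborel)"
    by (intro nn_integral_mono) (auto simp: tail_weight_def indicator_def abs_if split: if_splits)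
  also have "\<dots> = 1 + 1" by (subst nn_integral_add) (simp_all add: half half')
  finally show ?thesis by simp
qed

lemma nn_integral_circle_tail_weight:
  assumes r: "r > 0"
  shows "(\<integral>\<^sup>+ x. ennreal (tail_weight r (x - c)) \<partial>circle) \<le> 2"
proof -
  have "(\<integral>\<^sup>+ x. ennreal (tail_weight r (x - c)) \<partial>circle) \<le> (\<integral>\<^sup>+ x. ennreal (tail_weight r (x - c)) \<partial>lborel)"
    by (rule nn_integral_circle_le) measurable
  also have "\<dots> = (\<integral>\<^sup>+ v. ennreal (tail_weight r v) \<partial>lborel)"
    using nn_integral_real_affine[of "\<lambda>v. ennreal (tail_weight r v)" 1 "- c"] by simp
  finally show ?thesis using nn_integral_tail_weight[OF r] by order
qed

text \<open>One mean, seen as a convolution with a trigonometric polynomial. The weak type bounds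
  will involve \<open>S\<close> and \<open>a\<close> only through \<open>A\<close> and
  \<open>B\<close>, which makes them uniform over all means.\<close>

locale cz_kernel =
  fixes S :: "int set" and a :: "int \<Rightarrow> complex" and A B :: real
  assumes finite_S: "finite S" and B: "\<And>t. t \<in> S \<Longrightarrow> norm (a t) \<le> B" and B0: "B \<ge> 0" and A0: "A \<ge> 0"
    and kernel_deriv: "\<And>u. 0 < \<bar>u\<bar> \<Longrightarrow> \<bar>u\<bar> \<le> 1/2 \<Longrightarrow>
      norm (trig_poly S (\<lambda>t. a t * (2 * of_real pi * \<i> * of_int t)) u) \<le> A / u ^ 2"
begin

abbreviation "K \<equiv> trig_poly S a"
abbreviation "K' \<equiv> trig_poly S (\<lambda>t. a t * (2 * of_real pi * \<i> * of_int t))"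

definition T :: "(real \<Rightarrow> complex) \<Rightarrow> real \<Rightarrow> complex" where
  "T f = trig_poly S (\<lambda>t. a t * fourier_coeff f t)"

lemma T_measurable [measurable]: "T f \<in> borel_measurable circle"
  unfolding T_def by measurable

text \<open>The difference of two points of [0,1) ranges over (-1,1), while the kernel bound is
  given on half of this range. By periodicity the kernel is also singular near -1 and 1, hence three
  terms here and three weights in \<open>W\<close>.\<close>

lemma norm_K'_le:
  assumes "-1 < u" "u < 1" "u \<noteq> 0"
  shows "norm (K' u) \<le> A * (1 / u ^ 2 + 1 / (u - 1) ^ 2 + 1 / (u + 1) ^ 2)"
proof -
  have pos: "0 \<le> A / v ^ 2" for v :: real using A0 by simp
  consider "\<bar>u\<bar> \<le> 1/2" | "u > 1/2" | "u < -1/2" by linarith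
  then show ?thesis
  proof cases
    case 1
    then show ?thesis using kernel_deriv[of u] assms pos[of "u-1"] pos[of "u+1"] by (simp add: distrib_left)
  next
    case 2
    then have "norm (K' (u - 1)) \<le> A / (u - 1) ^ 2" using assms by (intro kernel_deriv) auto
    then show ?thesis using trig_poly_add_int[of S _ u "-1"] pos[of u] pos[of "u+1"] by (simp add: distrib_left)
  next
    case 3
    then have "norm (K' (u + 1)) \<le> A / (u + 1) ^ 2" using assms by (intro kernel_deriv) auto
    then show ?thesis using trig_poly_add_int[of S _ u "1"] pos[of u] pos[of "u-1"] by (simp add: distrib_left)
  qed
qed

definition W :: "real \<Rightarrow> real \<Rightarrow> real" where
  "W r v = tail_weight r v + tail_weight r (v - 1) + tail_weight r (v + 1)"

text \<open>Mean value inequality on the segment from x - c to x - y. Moving by at most r/2 at most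
  halves the distance to each of the singularities -1, 0, 1, which are at least \<open>r\<close>
  away; this costs a factor 4 in the derivative, and the length r/2 leaves 2. The bounds on the
  points keep the segment inside (-1,1).\<close>

lemma norm_K_diff_far:
  assumes x: "0 \<le> x" "x < 1" and c: "0 < c" "c < 1" and y: "0 \<le> y" "y < 1" and yc: "\<bar>y - c\<bar> \<le> r / 2"
    and r: "r > 0" "r \<le> \<bar>x - c\<bar>" "r \<le> \<bar>x - c - 1\<bar>" "r \<le> \<bar>x - c + 1\<bar>"
  shows "norm (K (x - y) - K (x - c)) \<le> 2 * A * W r (x - c)"
proof -
  define V where "V = 1 / (x - c) ^ 2 + 1 / (x - c - 1) ^ 2 + 1 / (x - c + 1) ^ 2"
  have V: "r * V = W r (x - c)" using r by (simp add: V_def W_def tail_weight_def distrib_left)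
  have "norm (K (x - y) - K (x - c)) \<le> (4 * A * V) * \<bar>(x - y) - (x - c)\<bar>"
  proof (rule norm_diff_le_vector_derivative)
    fix s assume s: "s \<in> closed_segment (x - c) (x - y)"
    show "(K has_vector_derivative K' s) (at s)" by (rule trig_poly_has_vector_derivative)
    have s1: "-1 < s" "s < 1" using s x y c by (auto simp: closed_segment_eq_real_ivl split: if_splits)
    have s2: "\<bar>s - (x - c)\<bar> \<le> r / 2" using s yc by (auto simp: closed_segment_eq_real_ivl split: if_splits)
    have key: "1 / (s - k) ^ 2 \<le> 4 * (1 / (x - c - k) ^ 2) \<and> s \<noteq> k" if "r \<le> \<bar>x - c - k\<bar>" for k
    proof -
      have "\<bar>x - c - k\<bar> \<le> \<bar>s - k\<bar> + \<bar>s - (x - c)\<bar>" by linarith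
      then have *: "\<bar>x - c - k\<bar> / 2 \<le> \<bar>s - k\<bar>" "\<bar>x - c - k\<bar> > 0"
        using that s2 r(1) by auto
      then have "(\<bar>x - c - k\<bar> / 2) ^ 2 \<le> \<bar>s - k\<bar> ^ 2" by (intro power_mono) auto
      then have "1 / \<bar>s - k\<bar> ^ 2 \<le> 1 / (\<bar>x - c - k\<bar> / 2) ^ 2"
        using * by (intro divide_left_mono mult_pos_pos) auto
      then show ?thesis using * by (auto simp: power_divide)
    qed
    have k0: "1 / s ^ 2 \<le> 4 * (1 / (x - c) ^ 2)" "s \<noteq> 0" using key[of 0] r by auto
    have k1: "1 / (s - 1) ^ 2 \<le> 4 * (1 / (x - c - 1) ^ 2)" using key[of 1] r by auto
    have k2: "1 / (s + 1) ^ 2 \<le> 4 * (1 / (x - c + 1) ^ 2)" using key[of "-1"] r by auto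
    have "norm (K' s) \<le> A * (1 / s ^ 2 + 1 / (s - 1) ^ 2 + 1 / (s + 1) ^ 2)"
      using s1 k0 by (intro norm_K'_le) auto
    also have "\<dots> \<le> A * (4 * V)"
      unfolding V_def distrib_left[of 4] by (intro mult_left_mono add_mono k0 k1 k2 A0)
    finally show "norm (K' s) \<le> 4 * A * V" by simp
  qed
  also have "\<dots> \<le> (4 * A * V) * (r / 2)"
    using yc A0 by (intro mult_left_mono) (auto simp: V_def abs_minus_commute)
  also have "\<dots> = 2 * A * (r * V)" by simp
  finally show ?thesis unfolding V .
qed

text \<open>Since the mean of \<open>b\<close> is 0, the constant K(x - c) may be subtracted under
  the integral. The bound on the kernel difference is required only where \<open>b\<close> does not
  vanish.\<close>

lemma norm_T_mean_zero_le:
  assumes b: "integrable circle b" "(LINT y|circle. b y) = 0"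
    and D: "\<And>y. y \<in> {0..<1} \<Longrightarrow> b y \<noteq> 0 \<Longrightarrow> norm (K (x - y) - K (x - c)) \<le> D"
  shows "norm (T b x) \<le> D * (LINT y|circle. norm (b y))"
proof -
  have Kb: "norm (K z) \<le> (\<Sum>t\<in>S. norm (a t))" for z by (rule norm_trig_poly_le)
  have i1: "integrable circle (\<lambda>y. b y * K (x - y))"
  proof (rule Bochner_Integration.integrable_bound[of circle "\<lambda>y. (\<Sum>t\<in>S. norm (a t)) * norm (b y)"])
    show "AE y in circle. norm (b y * K (x - y)) \<le> norm ((\<Sum>t\<in>S. norm (a t)) * norm (b y))"
      using Kb by (intro AE_I2) (auto simp: norm_mult abs_mult sum_nonneg mult.commute[of "norm (b _)"] intro!: mult_right_mono)
    have "(\<lambda>y. K (x - y)) \<in> borel_measurable circle" by (rule borel_measurable_circleI) measurable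
    then show "(\<lambda>y. b y * K (x - y)) \<in> borel_measurable circle" using b by measurable
  qed (use b in auto)
  have "T b x = (LINT y|circle. b y * K (x - y)) - (LINT y|circle. b y * K (x - c))"
    unfolding T_def using b by (simp add: trig_poly_convolution)
  also have "\<dots> = (LINT y|circle. b y * (K (x - y) - K (x - c)))"
    using i1 b by (subst Bochner_Integration.integral_diff[symmetric]) (auto simp: right_diff_distrib)
  also have "norm \<dots> \<le> (LINT y|circle. norm (b y * (K (x - y) - K (x - c))))"
    by (rule integral_norm_bound)
  also have "\<dots> \<le> (LINT y|circle. D * norm (b y))"
  proof (rule integral_mono)
    show "integrable circle (\<lambda>y. norm (b y * (K (x - y) - K (x - c))))"
      unfolding right_diff_distrib using i1 b by auto
    fix y assume "y \<in> space circle"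
    then show "norm (b y * (K (x - y) - K (x - c))) \<le> D * norm (b y)"
      using D[of y] by (cases "b y = 0") (auto simp: norm_mult space_circle mult.commute[of "norm (b y)"] intro!: mult_right_mono)
  qed (use b in auto)
  finally show ?thesis by simp
qed

lemma weak_type_2:
  assumes [measurable]: "f \<in> borel_measurable circle" and bd: "\<And>x. x \<in> {0..<1} \<Longrightarrow> norm (f x) \<le> L" and l: "l > 0"
  shows "measure circle {x \<in> space circle. l < norm (T f x)} \<le> (B / l) ^ 2 * (LINT x|circle. norm (f x) ^ 2)"
proof -
  have i: "integrable circle (\<lambda>x. norm (T f x) ^ 2)"
    by (rule integrable_circle_bounded[where B = "(\<Sum>t\<in>S. norm (a t * fourier_coeff f t)) ^ 2"])
      (auto simp: T_def intro: power_mono norm_trig_poly_le)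
  have "measure circle {x \<in> space circle. l < norm (T f x)} \<le> measure circle {x \<in> space circle. l ^ 2 \<le> norm (T f x) ^ 2}"
    using l by (intro circle.finite_measure_mono) (auto intro: power_mono)
  also have "\<dots> \<le> (LINT x|circle. norm (T f x) ^ 2) / l ^ 2"
    using i l by (intro integral_Markov_inequality_measure[where A = "{}"]) auto
  also have "\<dots> \<le> (B ^ 2 * (LINT x|circle. norm (f x) ^ 2)) / l ^ 2"
    unfolding T_def using l by (intro divide_right_mono trig_poly_l2_bound[where L = L] bd finite_S B B0) auto
  finally show ?thesis by (simp add: power_divide)
qed

end

lemma sum_indicator_disjoint_family:
  fixes h :: "'i \<Rightarrow> 'b::real_vector"
  assumes "finite P" "disjoint_family_on I P" "q \<in> P" "x \<in> I q"
  shows "(\<Sum>p\<in>P. indicator (I p) x *\<^sub>R h p) = h q"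
proof -
  have "indicator (I p) x *\<^sub>R h p = (if p = q then h q else 0)" if "p \<in> P" for p
  proof (cases "p = q")
    case False
    then have "I p \<inter> I q = {}" using assms that by (auto simp: disjoint_family_on_def)
    then show ?thesis using False assms(4) by (auto simp: indicator_def)
  qed (use assms in simp)
  then have "(\<Sum>p\<in>P. indicator (I p) x *\<^sub>R h p) = (\<Sum>p\<in>P. if p = q then h q else 0)"
    by (intro sum.cong) auto
  then show ?thesis using assms by simp
qed

lemma integrable_circle_indicator:
  fixes w :: "'b::{banach,second_countable_topology}"
  assumes "X \<in> sets borel"
  shows "integrable circle (\<lambda>x. indicator X x *\<^sub>R w)"
proof (rule integrable_circle_bounded[where B = "norm w"])
  show "(\<lambda>x. indicator X x *\<^sub>R w) \<in> borel_measurable circle"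
    by (rule borel_measurable_circleI) (use assms in measurable)
qed (auto simp: indicator_def)

context cz_kernel
begin

lemma T_add_sum:
  assumes "integrable circle g" "\<And>p. p \<in> P \<Longrightarrow> integrable circle (b p)" "finite P"
    and "\<And>x. x \<in> {0..<1} \<Longrightarrow> f x = g x + (\<Sum>p\<in>P. b p x)"
  shows "T f x = T g x + (\<Sum>p\<in>P. T (b p) x)"
proof -
  have "fourier_coeff f t = fourier_coeff g t + (\<Sum>p\<in>P. fourier_coeff (b p) t)" for t
  proof -
    have "fourier_coeff f t = (LINT x|circle. g x * char_fun (- t) x + (\<Sum>p\<in>P. b p x * char_fun (- t) x))"
      unfolding fourier_coeff_def
      by (intro Bochner_Integration.integral_cong) (auto simp: assms(4) space_circle distrib_right sum_distrib_right)
    also have "\<dots> = fourier_coeff g t + (\<Sum>p\<in>P. fourier_coeff (b p) t)"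
      unfolding fourier_coeff_def using assms
      by (subst Bochner_Integration.integral_add) (auto simp: Bochner_Integration.integral_sum integrable_mult_char_fun)
    finally show ?thesis .
  qed
  then show ?thesis
    unfolding T_def trig_poly_def
    by (simp add: distrib_left distrib_right sum.distrib sum_distrib_left sum_distrib_right sum.swap[of _ P])
qed

text \<open>The level is divided into thirds: for the good part, for the bad parts on stopped
  intervals and for those on short intervals. The good part gives 18 B^2 from 9 B^2 / l^2 times 2 l
  F, the exceptional set gives 6, the far field 72 A from 24 A F over l/3. The third share is never
  exceeded and contributes no set.\<close>

lemma weak_type_1:
  assumes f: "integrable circle f" and l: "l > 0"
  shows "measure circle {x \<in> space circle. l < norm (T f x)}
    \<le> (7 + 18 * B ^ 2 + 72 * A) / l * (LINT x|circle. norm (f x))"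
proof (cases "(LINT x|circle. norm (f x)) \<le> l")
  \<comment> \<open>If the average over the whole circle exceeds \<open>l\<close>, no partition can
    be started, but then the claimed bound is at least 1.\<close>
  case False
  have "measure circle {x \<in> space circle. l < norm (T f x)} \<le> 1" by simp
  also have "1 \<le> 1 / l * (LINT x|circle. norm (f x))" using False l by (simp add: field_simps)
  also have "\<dots> \<le> (7 + 18 * B ^ 2 + 72 * A) / l * (LINT x|circle. norm (f x))"
    using l A0 by (intro mult_right_mono divide_right_mono) auto
  finally show ?thesis .
next
  case True
  define F where "F = (LINT x|circle. norm (f x))"
  have F0: "F \<ge> 0" by (simp add: F_def)
  define \<mu> where "\<mu> = (\<lambda>u v. LINT x|circle. indicator {u..<v} x * norm (f x))"
  have [measurable]: "f \<in> borel_measurable circle" using f by auto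
  have ind [measurable]: "(\<lambda>x. indicator {u..<v} x :: real) \<in> borel_measurable circle" for u v :: real
    by (rule borel_measurable_circleI) measurable
  have i\<mu>: "integrable circle (\<lambda>x. indicator {u..<v} x * norm (f x))" for u v :: real
    by (rule Bochner_Integration.integrable_bound[OF f]) (auto simp: indicator_def)
  have \<mu>_add: "\<mu> u w = \<mu> u v + \<mu> v w" if "u \<le> v" "v \<le> w" for u v w
  proof -
    have "\<mu> u w = (LINT x|circle. indicator {u..<v} x * norm (f x) + indicator {v..<w} x * norm (f x))"
      unfolding \<mu>_def using that by (intro Bochner_Integration.integral_cong refl) (auto simp: indicator_def)
    also have "\<dots> = \<mu> u v + \<mu> v w"
      unfolding \<mu>_def by (intro Bochner_Integration.integral_add i\<mu>)
    finally show ?thesis .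
  qed
  have \<mu>0: "0 \<le> \<mu> u v" for u v unfolding \<mu>_def by (intro Bochner_Integration.integral_nonneg) auto
  have \<mu>1: "\<mu> 0 1 = F" unfolding \<mu>_def F_def
    by (intro Bochner_Integration.integral_cong) (auto simp: space_circle)
  \<comment> \<open>A Lipschitz constant of \<open>K\<close>, which may be huge. It enters only
    through the depth \<open>J\<close>, chosen so that the short intervals stay below l/3, and is
    absent from the final bound.\<close>
  define Lip where "Lip = (\<Sum>t\<in>S. norm (a t * (2 * of_real pi * \<i> * of_int t)))"
  have Lip0: "Lip \<ge> 0" unfolding Lip_def by (intro sum_nonneg) auto
  obtain J where J: "2 * Lip * F / 2 ^ J \<le> l / 3"
  proof -
    obtain J where "2 * Lip * F / (l / 3) < 2 ^ J"
      using real_arch_pow[of 2 "2 * Lip * F / (l / 3)"] by auto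
    then show ?thesis using l that[of J] by (simp add: field_simps)
  qed
  obtain P where P: "finite P" "disjoint_family_on (\<lambda>p. {fst p..<snd p}) P" "(\<Union>p\<in>P. {fst p..<snd p}) = {0..<1::real}"
    "\<And>p. p \<in> P \<Longrightarrow> fst p < snd p" "\<And>p. p \<in> P \<Longrightarrow> \<mu> (fst p) (snd p) \<le> 2 * l * (snd p - fst p)"
    "\<And>p. p \<in> P \<Longrightarrow> snd p - fst p = 1 / 2 ^ J \<or> l * (snd p - fst p) < \<mu> (fst p) (snd p)"
    using cz_partition[of \<mu> l 0 1 J, OF \<mu>_add \<mu>0] l True \<mu>1 unfolding F_def by auto
  define I where "I = (\<lambda>p::real \<times> real. {fst p..<snd p})"
  define r where "r = (\<lambda>p::real \<times> real. snd p - fst p)"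
  define c where "c = (\<lambda>p::real \<times> real. (fst p + snd p) / 2)"
  define m where "m = (\<lambda>p. \<mu> (fst p) (snd p))"
  have r0: "r p > 0" if "p \<in> P" for p using P(4)[OF that] by (simp add: r_def)
  have Isub: "I p \<subseteq> {0..<1}" if "p \<in> P" for p using P(3) that unfolding I_def by blast
  have pb: "0 \<le> fst p" "snd p \<le> 1" if "p \<in> P" for p
    using Isub[OF that] P(4)[OF that] by (auto simp: I_def)
  note uniq = sum_indicator_disjoint_family[OF P(1) P(2)[folded I_def]]
  have Ib: "I p \<in> sets borel" for p by (simp add: I_def)
  have cover: "\<exists>q\<in>P. x \<in> I q" if "x \<in> {0..<1}" for x using P(3) that unfolding I_def by blast
  have I_len: "(LINT x|circle. indicator (I p) x) = r p" if "p \<in> P" for p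
  proof -
    have "(LINT x|circle. indicator (I p) x :: real) = measure circle (I p \<inter> space circle)" by simp
    also have "I p \<inter> space circle = I p" using Isub[OF that] by (auto simp: space_circle)
    also have "measure circle (I p) = r p"
      using emeasure_circle_eq[of "I p"] Isub[OF that] r0[OF that] unfolding measure_def by (simp add: I_def r_def)
    finally show ?thesis .
  qed
  have sum_m: "(\<Sum>p\<in>P. m p) = F"
  proof -
    have "(\<Sum>p\<in>P. m p) = (LINT x|circle. (\<Sum>p\<in>P. indicator (I p) x * norm (f x)))"
      unfolding m_def \<mu>_def I_def using i\<mu> by (subst Bochner_Integration.integral_sum) auto
    also have "\<dots> = F" unfolding F_def
    proof (rule Bochner_Integration.integral_cong[OF refl])
      fix x assume "x \<in> space circle"
      then obtain q where q: "q \<in> P" "x \<in> I q" using cover[of x] by (auto simp: space_circle)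
      show "(\<Sum>p\<in>P. indicator (I p) x * norm (f x)) = norm (f x)"
        using uniq[OF q, of "\<lambda>p. norm (f x)"] by simp
    qed
    finally show ?thesis .
  qed
  define av where "av = (\<lambda>p. (LINT x|circle. indicator (I p) x *\<^sub>R f x) / of_real (r p))"
  have if': "integrable circle (\<lambda>x. indicator (I p) x *\<^sub>R f x)" for p
    by (rule Bochner_Integration.integrable_bound[OF f]) (auto simp: indicator_def I_def)
  have av_le: "r p * norm (av p) \<le> m p" if "p \<in> P" for p
  proof -
    have "r p * norm (av p) = norm (LINT x|circle. indicator (I p) x *\<^sub>R f x)"
      using r0[OF that] by (simp add: av_def norm_divide)
    also have "\<dots> \<le> (LINT x|circle. norm (indicator (I p) x *\<^sub>R f x))" by (rule integral_norm_bound)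
    also have "\<dots> = m p" by (simp add: m_def \<mu>_def I_def)
    finally show ?thesis .
  qed
  have av_2l: "norm (av p) \<le> 2 * l" if "p \<in> P" for p
  proof -
    have "r p * norm (av p) \<le> r p * (2 * l)"
      using av_le[OF that] P(5)[OF that] by (simp add: m_def r_def mult_ac)
    then show ?thesis using r0[OF that] by simp
  qed
  define g where "g = (\<lambda>x. \<Sum>p\<in>P. indicator (I p) x *\<^sub>R av p)"
  define b where "b = (\<lambda>p x. indicator (I p) x *\<^sub>R (f x - av p))"
  have indI [measurable]: "(\<lambda>x. indicator (I p) x :: real) \<in> borel_measurable circle" for p
    unfolding I_def by measurable
  have [measurable]: "g \<in> borel_measurable circle" unfolding g_def by measurable
  have g2l: "norm (g x) \<le> 2 * l" if x01: "x \<in> {0..<1}" for x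
  proof -
    obtain q where q: "q \<in> P" "x \<in> I q" using cover[OF x01] by blast
    show ?thesis unfolding g_def uniq[OF q] by (rule av_2l[OF q(1)])
  qed
  have gi: "integrable circle g" by (rule integrable_circle_bounded[OF _ g2l]) measurable
  note iI = integrable_circle_indicator[OF Ib]
  have bi: "integrable circle (b p)" for p
    unfolding b_def scaleR_diff_right using if' iI by (intro Bochner_Integration.integrable_diff)
  have b0: "(LINT y|circle. b p y) = 0" if "p \<in> P" for p
  proof -
    have "(LINT y|circle. b p y) = (LINT x|circle. indicator (I p) x *\<^sub>R f x) - (LINT x|circle. indicator (I p) x *\<^sub>R av p)"
      unfolding b_def scaleR_diff_right using if' iI by (intro Bochner_Integration.integral_diff)
    also have "(LINT x|circle. indicator (I p) x *\<^sub>R av p) = r p *\<^sub>R av p"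
      using I_len[OF that] iI[of p "1::real"] by (subst integral_scaleR_left) auto
    finally show ?thesis using r0[OF that] by (simp add: av_def scaleR_conv_of_real)
  qed
  define \<beta> where "\<beta> = (\<lambda>p. LINT y|circle. norm (b p y))"
  have \<beta>0: "0 \<le> \<beta> p" for p by (simp add: \<beta>_def)
  have \<beta>2: "\<beta> p \<le> 2 * m p" if "p \<in> P" for p
  proof -
    have "\<beta> p \<le> (LINT x|circle. indicator (I p) x * norm (f x) + indicator (I p) x *\<^sub>R norm (av p))"
      unfolding \<beta>_def
    proof (rule integral_mono)
      show "integrable circle (\<lambda>x. indicator (I p) x * norm (f x) + indicator (I p) x *\<^sub>R norm (av p))"
        using i\<mu> iI[of p "norm (av p)"] by (auto simp: I_def)
      fix x show "norm (b p x) \<le> indicator (I p) x * norm (f x) + indicator (I p) x *\<^sub>R norm (av p)"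
        unfolding b_def using norm_triangle_ineq4[of "f x" "av p"] by (auto simp: indicator_def)
    qed (use bi in auto)
    also have "\<dots> = m p + r p * norm (av p)"
      using i\<mu>[of "fst p" "snd p"] iI[of p "norm (av p)"] I_len[OF that]
      by (subst Bochner_Integration.integral_add) (auto simp: I_def m_def \<mu>_def)
    finally show ?thesis using av_le[OF that] by simp
  qed
  have sum\<beta>: "(\<Sum>p\<in>P. \<beta> p) \<le> 2 * F"
    using sum_mono[of P \<beta> "\<lambda>p. 2 * m p"] \<beta>2 sum_m by (simp flip: sum_distrib_left)
  have decomp: "f x = g x + (\<Sum>p\<in>P. b p x)" if x01: "x \<in> {0..<1}" for x
  proof -
    obtain q where q: "q \<in> P" "x \<in> I q" using cover[OF x01] by blast
    show ?thesis unfolding g_def b_def uniq[OF q] by simp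
  qed
  \<comment> \<open>The square is bounded by the supremum 2 l times the first power, whose integral
    is at most F because averaging does not increase mass.\<close>
  have g1: "(LINT x|circle. norm (g x) ^ 2) \<le> 2 * l * F"
  proof -
    have "(LINT x|circle. norm (g x) ^ 2) \<le> (LINT x|circle. 2 * l * (\<Sum>p\<in>P. indicator (I p) x *\<^sub>R norm (av p)))"
    proof (rule integral_mono)
      show "integrable circle (\<lambda>x. norm (g x) ^ 2)"
      proof (rule integrable_circle_bounded[where B = "(2 * l) ^ 2"])
        fix x :: real assume "x \<in> {0..<1}"
        then show "norm (norm (g x) ^ 2) \<le> (2 * l) ^ 2" using power_mono[OF g2l[of x], of 2] by simp
      qed measurable
      show "integrable circle (\<lambda>x. 2 * l * (\<Sum>p\<in>P. indicator (I p) x *\<^sub>R norm (av p)))"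
        by (intro integrable_mult_right Bochner_Integration.integrable_sum iI)
      fix x assume "x \<in> space circle"
      then have x: "x \<in> {0..<1}" by (simp add: space_circle)
      obtain q where q: "q \<in> P" "x \<in> I q" using cover[OF x] by blast
      show "norm (g x) ^ 2 \<le> 2 * l * (\<Sum>p\<in>P. indicator (I p) x *\<^sub>R norm (av p))"
        unfolding uniq[OF q] using g2l[OF x] l unfolding g_def uniq[OF q] power2_eq_square
        by (intro mult_right_mono) auto
    qed
    also have "\<dots> = 2 * l * (\<Sum>p\<in>P. r p * norm (av p))"
    proof -
      have *: "(LINT x|circle. indicator (I p) x *\<^sub>R norm (av p)) = r p * norm (av p)" if "p \<in> P" for p
        using I_len[OF that] iI[of p "1::real"] by (subst integral_scaleR_left) auto
      have "(LINT x|circle. (\<Sum>p\<in>P. indicator (I p) x *\<^sub>R norm (av p))) = (\<Sum>p\<in>P. LINT x|circle. indicator (I p) x *\<^sub>R norm (av p))"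
        by (intro Bochner_Integration.integral_sum iI)
      also have "\<dots> = (\<Sum>p\<in>P. r p * norm (av p))" by (intro sum.cong refl *)
      finally show ?thesis by (simp only: integral_mult_right_zero)
    qed
    also have "\<dots> \<le> 2 * l * F"
      using l av_le sum_m by (intro mult_left_mono) (auto intro: sum_mono order_trans)
    finally show ?thesis .
  qed
  have Tf: "T f x = T g x + (\<Sum>p\<in>P. T (b p) x)" for x
    by (rule T_add_sum[OF gi bi P(1) decomp])
  \<comment> \<open>The intervals with average above \<open>l\<close>. By the partition property all
    others have length exactly 2^-J.\<close>
  define Q where "Q = {p \<in> P. l * r p < m p}"
  have Q: "Q \<subseteq> P" "finite Q" using P(1) by (auto simp: Q_def)
  have short: "norm (T (b p) x) \<le> (Lip / 2 ^ J) * \<beta> p" if p: "p \<in> P - Q" for p x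
    unfolding \<beta>_def
  proof (rule norm_T_mean_zero_le[OF bi b0, of _ _ "c p"])
    show "p \<in> P" using p by simp
    fix y assume "y \<in> {0..<1}" "b p y \<noteq> 0"
    then have y: "y \<in> I p" by (auto simp: b_def indicator_def split: if_splits)
    have rJ: "r p = 1 / 2 ^ J" using P(6)[of p] p by (auto simp: Q_def r_def m_def)
    have "norm (K (x - y) - K (x - c p)) \<le> Lip * \<bar>(x - y) - (x - c p)\<bar>"
      by (rule norm_diff_le_vector_derivative[OF trig_poly_has_vector_derivative])
        (auto simp: Lip_def norm_trig_poly_le)
    also have "\<dots> \<le> Lip * (1 / 2 ^ J)"
    proof (rule mult_left_mono[OF _ Lip0])
      have "\<bar>(x - y) - (x - c p)\<bar> \<le> r p"
        using y by (auto simp: I_def c_def r_def abs_le_iff field_simps)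
      then show "\<bar>(x - y) - (x - c p)\<bar> \<le> 1 / 2 ^ J" using rJ by simp
    qed
    finally show "norm (K (x - y) - K (x - c p)) \<le> Lip / 2 ^ J" by simp
  qed
  have short_sum: "(\<Sum>p\<in>P - Q. norm (T (b p) x)) \<le> l / 3" for x
  proof -
    have "(\<Sum>p\<in>P - Q. norm (T (b p) x)) \<le> (\<Sum>p\<in>P - Q. (Lip / 2 ^ J) * \<beta> p)"
      by (rule sum_mono) (rule short)
    also have "\<dots> \<le> (\<Sum>p\<in>P. (Lip / 2 ^ J) * \<beta> p)"
      using P(1) Lip0 \<beta>0 by (intro sum_mono2) auto
    also have "\<dots> \<le> (Lip / 2 ^ J) * (2 * F)"
      unfolding sum_distrib_left[symmetric] using sum\<beta> Lip0 by (intro mult_left_mono) auto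
    also have "\<dots> \<le> l / 3" using J by (simp add: mult_ac)
    finally show ?thesis .
  qed
  \<comment> \<open>The radius is the full length of the interval, twice the distance from the
    centre to its ends, as the far estimate demands. The translates by 1 and -1 account for the
    periodicity of the kernel.\<close>
  define N where "N = (\<lambda>p. {0..<1} \<inter> (ball (c p) (r p) \<union> ball (c p + 1) (r p) \<union> ball (c p - 1) (r p)))"
  define E where "E = (\<Union>p\<in>Q. N p)"
  have Nb: "N p \<in> sets borel" for p unfolding N_def by measurable
  have Em [measurable]: "E \<in> sets circle"
    unfolding E_def using Q Nb by (intro sets.finite_UN sets_circleI) (auto simp: N_def)
  have mN: "measure circle (N p) \<le> 6 * r p" if "p \<in> P" for p
  proof -
    have "emeasure circle (N p) = emeasure lborel (N p)"
      by (rule emeasure_circle_eq[OF Nb]) (auto simp: N_def)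
    also have "\<dots> \<le> emeasure lborel (ball (c p) (r p) \<union> ball (c p + 1) (r p) \<union> ball (c p - 1) (r p))"
      by (intro emeasure_mono) (auto simp: N_def)
    also have "\<dots> \<le> emeasure lborel (ball (c p) (r p)) + emeasure lborel (ball (c p + 1) (r p)) + emeasure lborel (ball (c p - 1) (r p))"
      by (intro order_trans[OF emeasure_subadditive] add_mono order_refl) auto
    also have "\<dots> = ennreal (6 * r p)"
      unfolding ball_eq_greaterThanLessThan using r0[OF that] by (simp add: flip: ennreal_plus)
    finally show ?thesis
      using r0[OF that] by (simp add: circle.emeasure_eq_measure)
  qed
  have mE: "measure circle E \<le> 6 * F / l"
  proof -
    have "measure circle E \<le> (\<Sum>p\<in>Q. measure circle (N p))"
      unfolding E_def using Q Nb by (intro measure_UNION_le) (auto simp: N_def intro!: sets_circleI)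
    also have "\<dots> \<le> (\<Sum>p\<in>Q. 6 * m p / l)"
    proof (rule sum_mono)
      fix p assume p: "p \<in> Q"
      \<comment> \<open>The stopping condition turns lengths into masses, so the total length of the
        stopped intervals is at most F / l.\<close>
      then have "r p \<le> m p / l" using l by (simp add: Q_def field_simps)
      then show "measure circle (N p) \<le> 6 * m p / l" using mN[of p] p Q by force
    qed
    also have "\<dots> \<le> (\<Sum>p\<in>P. 6 * m p / l)"
      using P(1) Q l \<mu>0 by (intro sum_mono2) (auto simp: m_def)
    also have "\<dots> = 6 * F / l" by (simp add: sum_m[symmetric] sum_distrib_left sum_divide_distrib)
    finally show ?thesis .
  qed
  \<comment> \<open>A majorant of the far contributions. Each \<open>W\<close> has integral at most
    6 = 3 * 2 on the circle whatever the length of the interval, and the norms of the bad parts add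
    up to at most 2 F.\<close>
  define V where "V = (\<lambda>x. \<Sum>p\<in>Q. 2 * A * \<beta> p * W (r p) (x - c p))"
  have far: "(\<Sum>p\<in>Q. norm (T (b p) x)) \<le> V x" if x: "x \<in> {0..<1}" "x \<notin> E" for x
    unfolding V_def
  proof (rule sum_mono)
    fix p assume p: "p \<in> Q"
    then have pP: "p \<in> P" using Q by auto
    have xN: "x \<notin> N p" using x p by (auto simp: E_def)
    have "norm (T (b p) x) \<le> (2 * A * W (r p) (x - c p)) * \<beta> p"
      unfolding \<beta>_def
    proof (rule norm_T_mean_zero_le[OF bi b0[OF pP], of _ "c p"])
      fix y assume y1: "y \<in> {0..<1}" "b p y \<noteq> 0"
      then have y: "y \<in> I p" by (auto simp: b_def indicator_def split: if_splits)
      show "norm (K (x - y) - K (x - c p)) \<le> 2 * A * W (r p) (x - c p)"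
      proof (rule norm_K_diff_far)
        show "0 < c p" "c p < 1" using pb[OF pP] P(4)[OF pP] by (auto simp: c_def)
        show "\<bar>y - c p\<bar> \<le> r p / 2" using y by (auto simp: I_def c_def r_def abs_le_iff field_simps)
        show "r p \<le> \<bar>x - c p\<bar>" "r p \<le> \<bar>x - c p - 1\<bar>" "r p \<le> \<bar>x - c p + 1\<bar>"
          using xN x(1) by (auto simp: N_def dist_real_def abs_minus_commute algebra_simps)
      qed (use x y1 r0[OF pP] in auto)
    qed
    then show "norm (T (b p) x) \<le> 2 * A * \<beta> p * W (r p) (x - c p)" by (simp add: mult_ac)
  qed
  have W0: "0 \<le> W (r p) v" if "p \<in> P" for p v using tail_weight_nonneg[OF r0[OF that]] by (simp add: W_def)
  have Wm [measurable]: "W r \<in> borel_measurable borel" for r unfolding W_def by measurable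
  have Vb: "V \<in> borel_measurable borel" unfolding V_def by measurable
  then have Vm [measurable]: "V \<in> borel_measurable circle" by (rule borel_measurable_circleI)
  have V0: "0 \<le> V x" for x unfolding V_def using A0 \<beta>0 W0 Q by (intro sum_nonneg mult_nonneg_nonneg) auto
  have W6: "(\<integral>\<^sup>+ x. ennreal (W (r p) (x - c p)) \<partial>circle) \<le> 6" if "p \<in> P" for p
  proof -
    let ?w = "\<lambda>s x. ennreal (tail_weight (r p) (x - s))"
    have [measurable]: "(\<lambda>x. tail_weight (r p) (x - s)) \<in> borel_measurable circle" for s
      by (rule borel_measurable_circleI) measurable
    have "(\<integral>\<^sup>+ x. ennreal (W (r p) (x - c p)) \<partial>circle) =
      (\<integral>\<^sup>+ x. ?w (c p) x + ?w (c p + 1) x + ?w (c p - 1) x \<partial>circle)"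
      unfolding W_def using tail_weight_nonneg[OF r0[OF that]]
      by (intro nn_integral_cong) (simp add: ennreal_plus[symmetric] add_nonneg_nonneg diff_diff_eq2 diff_diff_eq algebra_simps del: ennreal_plus)
    also have "\<dots> = (\<integral>\<^sup>+ x. ?w (c p) x \<partial>circle) + (\<integral>\<^sup>+ x. ?w (c p + 1) x \<partial>circle) + (\<integral>\<^sup>+ x. ?w (c p - 1) x \<partial>circle)"
      by (subst nn_integral_add, measurable, subst nn_integral_add) measurable
    also have "\<dots> \<le> 2 + 2 + 2"
      by (intro add_mono nn_integral_circle_tail_weight r0[OF that])
    finally show ?thesis by simp
  qed
  have intV: "(\<integral>\<^sup>+ x. ennreal (V x) \<partial>circle) \<le> ennreal (24 * A * F)"
  proof -
    have [measurable]: "(\<lambda>x. W (r p) (x - c p)) \<in> borel_measurable circle" for p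
      by (rule borel_measurable_circleI) measurable
    have "(\<integral>\<^sup>+ x. ennreal (V x) \<partial>circle) = (\<integral>\<^sup>+ x. (\<Sum>p\<in>Q. ennreal (2 * A * \<beta> p) * ennreal (W (r p) (x - c p))) \<partial>circle)"
      unfolding V_def using A0 \<beta>0 W0 Q
      by (intro nn_integral_cong) (subst sum_ennreal[symmetric], auto simp: ennreal_mult' subset_eq intro!: sum.cong)
    also have "\<dots> = (\<Sum>p\<in>Q. ennreal (2 * A * \<beta> p) * (\<integral>\<^sup>+ x. ennreal (W (r p) (x - c p)) \<partial>circle))"
      by (subst nn_integral_sum, measurable, intro sum.cong refl nn_integral_cmult) measurable
    also have "\<dots> \<le> (\<Sum>p\<in>Q. ennreal (2 * A * \<beta> p) * 6)"
      using W6 Q by (intro sum_mono mult_left_mono) auto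
    also have "\<dots> = (\<Sum>p\<in>Q. ennreal (12 * A * \<beta> p))"
    proof (intro sum.cong refl)
      fix p
      have "ennreal (2 * A * \<beta> p) * ennreal 6 = ennreal (2 * A * \<beta> p * 6)"
        using A0 \<beta>0 by (intro ennreal_mult[symmetric]) auto
      then show "ennreal (2 * A * \<beta> p) * 6 = ennreal (12 * A * \<beta> p)" by (simp add: mult_ac)
    qed
    also have "\<dots> = ennreal (\<Sum>p\<in>Q. 12 * A * \<beta> p)" using A0 \<beta>0 by (intro sum_ennreal) auto
    also have "\<dots> \<le> ennreal (24 * A * F)"
    proof (rule ennreal_leI)
      have "(\<Sum>p\<in>Q. 12 * A * \<beta> p) \<le> (\<Sum>p\<in>P. 12 * A * \<beta> p)"
        using P(1) Q A0 \<beta>0 by (intro sum_mono2) auto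
      also have "\<dots> \<le> 12 * A * (2 * F)"
        unfolding sum_distrib_left[symmetric] using sum\<beta> A0 by (intro mult_left_mono) auto
      finally show "(\<Sum>p\<in>Q. 12 * A * \<beta> p) \<le> 24 * A * F" by simp
    qed
    finally show ?thesis .
  qed
  have mV: "measure circle {x \<in> space circle. l / 3 \<le> V x} \<le> 72 * A * F / l"
  proof -
    have iV: "integrable circle V"
      using intV V0 by (intro integrableI_bounded) (auto simp: le_less_trans)
    have "measure circle {x \<in> space circle. l / 3 \<le> V x} \<le> (LINT x|circle. V x) / (l / 3)"
      using iV V0 l by (intro integral_Markov_inequality_measure[where A = "{}"]) auto
    also have "(LINT x|circle. V x) \<le> 24 * A * F"
      using intV iV V0 A0 F0 by (simp add: nn_integral_eq_integral)
    finally show ?thesis using l by (simp add: divide_right_mono field_simps)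
  qed
  have mg: "measure circle {x \<in> space circle. l / 3 < norm (T g x)} \<le> 18 * B ^ 2 * F / l"
  proof -
    have "measure circle {x \<in> space circle. l / 3 < norm (T g x)} \<le> (B / (l / 3)) ^ 2 * (LINT x|circle. norm (g x) ^ 2)"
      using l g2l by (intro weak_type_2[where L = "2 * l"]) auto
    also have "\<dots> \<le> (B / (l / 3)) ^ 2 * (2 * l * F)" using g1 by (intro mult_left_mono) auto
    also have "\<dots> = 18 * B ^ 2 * F / l" using l by (simp add: field_simps power2_eq_square)
    finally show ?thesis .
  qed
  have "measure circle {x \<in> space circle. l < norm (T f x)}
    \<le> measure circle (({x \<in> space circle. l / 3 < norm (T g x)} \<union> E) \<union> {x \<in> space circle. l / 3 \<le> V x})"
  proof (rule circle.finite_measure_mono)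
    show "{x \<in> space circle. l < norm (T f x)} \<subseteq> ({x \<in> space circle. l / 3 < norm (T g x)} \<union> E) \<union> {x \<in> space circle. l / 3 \<le> V x}"
    proof (safe, rule ccontr)
      fix x assume x: "x \<in> space circle" "l < norm (T f x)" "\<not> l / 3 \<le> V x" "x \<notin> E" "\<not> l / 3 < norm (T g x)"
      have "norm (T f x) \<le> norm (T g x) + norm (\<Sum>p\<in>P. T (b p) x)" unfolding Tf by (rule norm_triangle_ineq)
      also have "norm (\<Sum>p\<in>P. T (b p) x) \<le> (\<Sum>p\<in>P. norm (T (b p) x))" by (rule norm_sum)
      also have "\<dots> = (\<Sum>p\<in>Q. norm (T (b p) x)) + (\<Sum>p\<in>P - Q. norm (T (b p) x))"
        using P(1) Q by (subst sum.subset_diff[of Q P]) auto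
      also have "\<dots> \<le> V x + l / 3" using far[of x] x short_sum[of x] by (intro add_mono) (auto simp: space_circle)
      finally show False using x by simp
    qed
  qed measurable
  also have "\<dots> \<le> (18 * B ^ 2 * F / l + 6 * F / l) + 72 * A * F / l"
    using mg mE mV by (intro order_trans[OF measure_Un_le] add_mono) auto
  also have "\<dots> \<le> (7 + 18 * B ^ 2 + 72 * A) / l * F"
    using l F0 by (simp add: field_simps)
  finally show ?thesis by (simp add: F_def)
qed

end

section \<open>Convergence of the means and the multiplier theorem\<close>

text \<open>Absolutely convergent unordered sums are integrals with respect to counting measure, so
  the theorem for integrals applies.\<close>

lemma dominated_convergence_infsum:
  fixes u :: "nat \<Rightarrow> 'i \<Rightarrow> 'b::{banach,second_countable_topology}"
  assumes w: "w summable_on UNIV" and bd: "\<And>n t. norm (u n t) \<le> w t"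
    and lim: "\<And>t. (\<lambda>n. u n t) \<longlonglongrightarrow> v t"
  shows "(v has_sum infsum v UNIV) UNIV" "(\<lambda>n. infsum (u n) UNIV) \<longlonglongrightarrow> infsum v UNIV"
proof -
  have w0: "0 \<le> w t" for t using bd[of 0 t] by (rule order_trans[OF norm_ge_zero])
  have vb: "norm (v t) \<le> w t" for t
    by (rule LIMSEQ_le_const2[OF tendsto_norm[OF lim]]) (use bd in blast)
  have sum: "(\<lambda>t. norm (h t)) summable_on UNIV" if "\<And>t. norm (h t) \<le> w t" for h :: "'i \<Rightarrow> 'b"
    by (rule summable_on_comparison_test[OF w]) (use that in auto)
  show "(v has_sum infsum v UNIV) UNIV"
    by (rule has_sum_infsum[OF abs_summable_summable[OF sum[OF vb]]])
  have int: "infsum h UNIV = (\<integral>t. h t \<partial>count_space UNIV)" if "\<And>t. norm (h t) \<le> w t" for h :: "'i \<Rightarrow> 'b"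
    using infsetsum_infsum[of h UNIV] sum[OF that] unfolding abs_summable_equivalent infsetsum_def by simp
  have "integrable (count_space UNIV) w"
  proof -
    have "(\<lambda>t. norm (w t)) summable_on UNIV" using w w0 by simp
    then have "Infinite_Set_Sum.abs_summable_on w UNIV" using abs_summable_equivalent by blast
    then show ?thesis by (simp add: Infinite_Set_Sum.abs_summable_on_def)
  qed
  then have "(\<lambda>n. \<integral>t. u n t \<partial>count_space UNIV) \<longlonglongrightarrow> (\<integral>t. v t \<partial>count_space UNIV)"
    by (intro integral_dominated_convergence[where w = w]) (auto intro: lim bd)
  then show "(\<lambda>n. infsum (u n) UNIV) \<longlonglongrightarrow> infsum v UNIV"
    using bd vb by (simp add: int)
qed

text \<open>Riesz-Fischer: a subsequence converges almost everywhere to some \<open>g\<close>.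
  Fatou's lemma along the subsequence, with \<open>n\<close> fixed, bounds the distance of every
  late \<open>s n\<close> from \<open>g\<close>, so the full sequence converges.\<close>

lemma L1_complete:
  fixes s :: "nat \<Rightarrow> 'a \<Rightarrow> 'b::{banach, second_countable_topology}"
  assumes s [measurable]: "\<And>n. integrable M (s n)"
    and cauchy: "\<And>e. e > 0 \<Longrightarrow> \<exists>N. \<forall>i\<ge>N. \<forall>j\<ge>N. (LINT x|M. norm (s i x - s j x)) < e"
  shows "\<exists>g. integrable M g \<and> (\<lambda>n. LINT x|M. norm (s n x - g x)) \<longlonglongrightarrow> 0"
proof -
  obtain r where r: "strict_mono r" "AE x in M. Cauchy (\<lambda>i. s (r i) x)"
    using cauchy_L1_AE_cauchy_subseq[OF s cauchy] by blast
  define g where "g = (\<lambda>x. lim (\<lambda>i. s (r i) x))"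
  have [measurable]: "g \<in> borel_measurable M" unfolding g_def by measurable
  have lim: "AE x in M. (\<lambda>i. s (r i) x) \<longlonglongrightarrow> g x"
    using r(2) by eventually_elim (simp add: g_def Cauchy_convergent_iff convergent_LIMSEQ_iff)
  have bound: "\<exists>N. \<forall>n\<ge>N. (\<integral>\<^sup>+ x. norm (s n x - g x) \<partial>M) \<le> ennreal e" if "e > 0" for e
  proof -
    obtain N where N: "\<And>i j. i \<ge> N \<Longrightarrow> j \<ge> N \<Longrightarrow> (LINT x|M. norm (s i x - s j x)) < e"
      using cauchy[OF \<open>e > 0\<close>] by blast
    have "(\<integral>\<^sup>+ x. norm (s n x - g x) \<partial>M) \<le> ennreal e" if n: "n \<ge> N" for n
    proof -
      have "(\<integral>\<^sup>+ x. norm (s n x - g x) \<partial>M) = (\<integral>\<^sup>+ x. liminf (\<lambda>i. ennreal (norm (s n x - s (r i) x))) \<partial>M)"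
      proof (rule nn_integral_cong_AE)
        show "AE x in M. ennreal (norm (s n x - g x)) = liminf (\<lambda>i. ennreal (norm (s n x - s (r i) x)))"
          using lim
        proof eventually_elim
          case (elim x)
          then have "(\<lambda>i. ennreal (norm (s n x - s (r i) x))) \<longlonglongrightarrow> ennreal (norm (s n x - g x))"
            by (intro tendsto_intros)
          then show ?case by (rule lim_imp_Liminf[OF sequentially_bot, symmetric])
        qed
      qed
      also have "\<dots> \<le> liminf (\<lambda>i. \<integral>\<^sup>+ x. ennreal (norm (s n x - s (r i) x)) \<partial>M)"
        by (rule nn_integral_liminf) measurable
      also have "\<dots> \<le> ennreal e"
      proof (rule order_trans[OF Liminf_le_Limsup])
        show "limsup (\<lambda>i. \<integral>\<^sup>+ x. ennreal (norm (s n x - s (r i) x)) \<partial>M) \<le> ennreal e"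
        proof (rule Limsup_bounded, rule eventually_sequentiallyI[of N])
          fix i assume "i \<ge> N"
          then have "r i \<ge> N" using seq_suble[OF r(1), of i] by simp
          then have "(LINT x|M. norm (s n x - s (r i) x)) \<le> e" using N[OF n, of "r i"] by simp
          then show "(\<integral>\<^sup>+ x. ennreal (norm (s n x - s (r i) x)) \<partial>M) \<le> ennreal e"
            using s by (subst nn_integral_eq_integral) (auto intro: ennreal_leI)
        qed
      qed simp
      finally show ?thesis .
    qed
    then show ?thesis by blast
  qed
  have gi: "integrable M g"
  proof -
    obtain n where "(\<integral>\<^sup>+ x. norm (s n x - g x) \<partial>M) \<le> ennreal 1" using bound[of 1] by auto
    then have "integrable M (\<lambda>x. s n x - g x)"
      by (intro integrableI_bounded) (auto simp: le_less_trans)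
    from Bochner_Integration.integrable_diff[OF s this]
    have "integrable M (\<lambda>x. s n x - (s n x - g x))" .
    then show ?thesis by simp
  qed
  have "(\<lambda>n. LINT x|M. norm (s n x - g x)) \<longlonglongrightarrow> 0"
  proof (rule LIMSEQ_I)
    fix e :: real assume "e > 0"
    then obtain N where N: "\<And>n. n \<ge> N \<Longrightarrow> (\<integral>\<^sup>+ x. norm (s n x - g x) \<partial>M) \<le> ennreal (e / 2)"
      using bound[of "e / 2"] by auto
    have "(LINT x|M. norm (s n x - g x)) < e" if "n \<ge> N" for n
    proof -
      have "ennreal (LINT x|M. norm (s n x - g x)) \<le> ennreal (e / 2)"
        using N[OF that] gi s by (subst (asm) nn_integral_eq_integral) auto
      then show ?thesis using \<open>e > 0\<close> by simp
    qed
    then show "\<exists>N. \<forall>n\<ge>N. norm ((LINT x|M. norm (s n x - g x)) - 0) < e" by auto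
  qed
  then show ?thesis using gi by blast
qed

section \<open>Monotonicity and truncation of the norms\<close>

lemma LlogL_norm_mono:
  assumes "f \<in> borel_measurable M" "\<And>x. x \<in> space M \<Longrightarrow> norm (g x) \<le> norm (f x)"
  shows "LlogL_norm M n g \<le> LlogL_norm M n f"
  unfolding LlogL_norm_eq
  by (rule nn_integral_unit_mono, rule hardy_funpow_mono[where b = 1]) (auto intro: rearrangement_mono[OF assms])

lemma rearrangement_antimono_on: "antimono_on {0<..} (rearrangement M f)"
  using rearrangement_antimono by (rule monotone_on_subset) simp

lemma LlogL_norm_index_mono:
  assumes "k \<le> n"
  shows "LlogL_norm M k f \<le> LlogL_norm M n f"
  unfolding LlogL_norm_eq
  by (rule nn_integral_unit_mono) (use assms in \<open>auto intro!: hardy_funpow_increasing rearrangement_antimono_on\<close>)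

context prob_space
begin

lemma LlogL_integrable:
  assumes "f \<in> LlogL M n"
  shows "integrable M f"
proof -
  have [measurable]: "f \<in> borel_measurable M" using assms by (simp add: LlogL_def)
  have "(\<integral>\<^sup>+ x. norm (f x) \<partial>M) \<le> LlogL_norm M n f"
    using LlogL_norm_index_mono[of 0 n M f] by (simp add: LlogL_norm_0)
  also have "\<dots> < \<infinity>" using assms by (simp add: LlogL_def)
  finally show ?thesis by (intro integrableI_bounded) auto
qed

text \<open>At each positive \<open>t\<close> the rearrangement of the tail is 0 as soon as
  \<open>j\<close> exceeds the rearrangement of \<open>f\<close>, which dominates throughout.
  Dominated convergence is used twice: inside the average at fixed \<open>t\<close>, and for the
  outer integral, with the average of the rearrangement of \<open>f\<close> as majorant.\<close>

lemma LlogL_norm_truncation_tendsto_0: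
  assumes f: "f \<in> LlogL M 1"
  shows "(\<lambda>j. LlogL_norm M 1 (\<lambda>x. if real j < norm (f x) then f x else 0)) \<longlonglongrightarrow> 0"
proof -
  have [measurable]: "f \<in> borel_measurable M" using f by (simp add: LlogL_def)
  let ?H = "rearrangement M f"
  define h where "h = (\<lambda>j. rearrangement M (\<lambda>x. if real j < norm (f x) then f x else 0))"
  have [measurable]: "h j \<in> borel_measurable borel" for j unfolding h_def by measurable
  have fin: "(\<integral>\<^sup>+ t \<in> {0..1}. hardy ?H t \<partial>lborel) < \<infinity>"
    using f by (simp add: LlogL_def LlogL_norm_eq)
  have hH: "h j t \<le> ?H t" for j t unfolding h_def by (rule rearrangement_mono) auto
  have h0: "(\<lambda>j. h j t) \<longlonglongrightarrow> 0" if "t > 0" for t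
  proof -
    obtain i :: nat where i: "enn2real (?H t) < real i" using reals_Archimedean2 by blast
    have "h j t = 0" if "j \<ge> i" for j
    proof -
      have "\<not> ennreal (real j) < ?H t"
        using i that rearrangement_finite[of f t] \<open>t > 0\<close> by (cases "?H t") (auto simp: ennreal_less_iff)
      then have "emeasure M {x \<in> space M. real j < norm (f x)} \<le> ennreal t"
        using less_rearrangement_iff[of f "real j" t] by simp
      moreover have "emeasure M {x \<in> space M. 0 < norm (if real j < norm (f x) then f x else 0)} \<le> emeasure M {x \<in> space M. real j < norm (f x)}"
        by (intro emeasure_mono) (auto split: if_splits)
      ultimately have "h j t \<le> ennreal 0" unfolding h_def by (intro rearrangement_le) auto
      then show ?thesis by simp
    qed
    then have "eventually (\<lambda>j. h j t = 0) sequentially" by (auto simp: eventually_sequentially)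
    then show ?thesis by (rule tendsto_eventually)
  qed
  have H0: "(\<integral>\<^sup>+ t \<in> {0..1}. ?H t \<partial>lborel) < \<infinity>"
    using LlogL_norm_index_mono[of 0 1 M f] fin by (simp add: LlogL_norm_eq le_less_trans)
  have c1: "(\<lambda>j. hardy (h j) t) \<longlonglongrightarrow> 0" if t: "0 < t" "t \<le> 1" for t
  proof -
    have "(\<lambda>j. \<integral>\<^sup>+ v. h j (t * v) * indicator {0..1} v \<partial>lborel) \<longlonglongrightarrow> (\<integral>\<^sup>+ v. 0 \<partial>(lborel::real measure))"
    proof (rule nn_integral_dominated_convergence[where w = "\<lambda>v. ?H (t * v) * indicator {0..1} v"])
      have "hardy ?H t \<le> (\<integral>\<^sup>+ t \<in> {0..1}. ?H t \<partial>lborel) / ennreal t"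
        unfolding hardy_def using t by (intro divide_right_mono_ennreal nn_integral_mono) (auto simp: indicator_def)
      also have "\<dots> < \<infinity>" using H0 t by (auto simp: ennreal_divide_eq_top_iff less_top[symmetric])
      finally show "(\<integral>\<^sup>+ v. ?H (t * v) * indicator {0..1} v \<partial>lborel) < \<infinity>" using t by (simp add: hardy_scale)
      show "AE v in lborel. (\<lambda>j. h j (t * v) * indicator {0..1} v) \<longlonglongrightarrow> 0"
        by (rule AE_mp[OF AE_lborel_singleton[of 0]])
          (use t in \<open>auto intro!: AE_I2 h0 simp: indicator_def\<close>)
    qed (auto intro!: AE_I2 mult_right_mono hH)
    then show ?thesis using t by (simp add: hardy_scale)
  qed
  have "(\<lambda>j. \<integral>\<^sup>+ t. hardy (h j) t * indicator {0..1} t \<partial>lborel) \<longlonglongrightarrow> (\<integral>\<^sup>+ t. 0 \<partial>(lborel::real measure))"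
  proof (rule nn_integral_dominated_convergence[where w = "\<lambda>t. hardy ?H t * indicator {0..1} t"])
    show "AE t in lborel. (\<lambda>j. hardy (h j) t * indicator {0..1} t) \<longlonglongrightarrow> 0"
      by (rule AE_mp[OF AE_lborel_singleton[of 0]]) (auto intro!: AE_I2 c1 simp: indicator_def)
  qed (use fin in \<open>auto intro!: AE_I2 mult_right_mono hardy_mono hH\<close>)
  then show ?thesis by (simp add: LlogL_norm_eq h_def)
qed

end

section \<open>Fourier coefficients of test functions\<close>

lemma integrable_circle_continuous:
  fixes f :: "real \<Rightarrow> complex"
  assumes "continuous_on UNIV f"
  shows "integrable circle f" "\<exists>L. \<forall>x\<in>{0..<1}. norm (f x) \<le> L"
proof -
  have "compact (f ` {0..1})"
    using assms by (intro compact_continuous_image) (auto intro: continuous_on_subset)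
  then obtain L where L: "\<forall>y \<in> f ` {0..1}. norm y \<le> L"
    using compact_imp_bounded bounded_iff by metis
  then show "\<exists>L. \<forall>x\<in>{0..<1}. norm (f x) \<le> L" by (intro exI[of _ L]) auto
  have "f \<in> borel_measurable circle"
    using assms by (intro borel_measurable_circleI borel_measurable_continuous_onI)
  then show "integrable circle f" by (rule integrable_circle_bounded[where B = L]) (use L in auto)
qed

lemma fourier_coeff_vector_derivative:
  assumes d: "\<And>x. (f has_vector_derivative f' x) (at x)" and c: "continuous_on UNIV f'" and p: "f 1 = f 0"
  shows "fourier_coeff f' k = 2 * of_real pi * \<i> * of_int k * fourier_coeff f k"
proof -
  let ?e = "2 * of_real pi * \<i> * of_int (- k)"
  have fc: "continuous_on UNIV f"
    using d by (intro continuous_at_imp_continuous_on) (auto intro: has_vector_derivative_continuous)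
  have "((\<lambda>x. f x * char_fun (- k) x) has_vector_derivative f x * (?e * char_fun (- k) x) + f' x * char_fun (- k) x) (at x)" for x
    by (intro has_vector_derivative_mult d char_fun_has_vector_derivative)
  then have "(LINT x|circle. f x * (?e * char_fun (- k) x) + f' x * char_fun (- k) x) = f 1 * char_fun (- k) 1 - f 0 * char_fun (- k) 0"
    by (rule integral_circle_vector_derivative)
      (intro continuous_intros char_fun_continuous_on continuous_on_subset[OF fc] continuous_on_subset[OF c]; simp)
  also have "\<dots> = 0" using p char_fun_add_int[of "- k" 0 1] by simp
  also have "(LINT x|circle. f x * (?e * char_fun (- k) x) + f' x * char_fun (- k) x)
      = (LINT x|circle. ?e * (f x * char_fun (- k) x) + f' x * char_fun (- k) x)"
    by (simp only: mult.left_commute)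
  also have "\<dots> = (LINT x|circle. ?e * (f x * char_fun (- k) x)) + (LINT x|circle. f' x * char_fun (- k) x)"
    by (intro Bochner_Integration.integral_add integrable_mult_right integrable_mult_char_fun
        integrable_circle_continuous(1) fc c)
  also have "\<dots> = ?e * fourier_coeff f k + fourier_coeff f' k"
    by (simp add: fourier_coeff_def)
  finally show ?thesis by (simp add: add_eq_0_iff)
qed

text \<open>Two integrations by parts; the boundary terms cancel because the first derivative is
  periodic along with the function. Quadratic decay makes the coefficients absolutely summable,
  which is what the distributional series needs.\<close>

lemma test_function_fourier_coeff_decay:
  assumes "test_function \<phi>"
  shows "\<exists>L. \<forall>k. k \<noteq> 0 \<longrightarrow> norm (fourier_coeff \<phi> k) \<le> L / (of_int k) ^ 2"
proof -
  have sm: "smooth_on UNIV \<phi>" and per: "\<phi> (x + 1) = \<phi> x" for x using assms by (auto simp: test_function_def)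
  have d: "(iter_deriv l \<phi> has_vector_derivative iter_deriv (Suc l) \<phi> x) (at x)" for l x
    using has_vector_derivative_iter_deriv[OF sm] by simp
  have c: "continuous_on UNIV (iter_deriv l \<phi>)" for l
    using d by (intro continuous_at_imp_continuous_on) (auto intro: has_vector_derivative_continuous)
  have d0: "(\<phi> has_vector_derivative iter_deriv 1 \<phi> x) (at x)" for x using d[of 0] by (simp add: iter_deriv_def)
  have per1: "iter_deriv 1 \<phi> 1 = iter_deriv 1 \<phi> 0"
  proof -
    have "(\<phi> \<circ> (\<lambda>x. x + 1) has_vector_derivative 1 *\<^sub>R iter_deriv 1 \<phi> (0 + 1)) (at 0)"
      by (rule vector_diff_chain_at) (use d0[of 1] in \<open>auto intro!: derivative_eq_intros\<close>)
    then have "(\<phi> has_vector_derivative iter_deriv 1 \<phi> 1) (at 0)" by (simp add: o_def per)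
    then show ?thesis using d0[of 0] vector_derivative_unique_at by blast
  qed
  define L where "L = (LINT x|circle. norm (iter_deriv 2 \<phi> x))"
  have L0: "L \<ge> 0" by (simp add: L_def)
  have "norm (fourier_coeff \<phi> k) \<le> L / (of_int k) ^ 2" if "k \<noteq> 0" for k
  proof -
    have "fourier_coeff (iter_deriv 2 \<phi>) k = (2 * of_real pi * \<i> * of_int k) * ((2 * of_real pi * \<i> * of_int k) * fourier_coeff \<phi> k)"
      using fourier_coeff_vector_derivative[OF d c per1, of k] fourier_coeff_vector_derivative[OF d0 c, of k] per[of 0]
      by (simp add: numeral_2_eq_2)
    then have "norm (fourier_coeff (iter_deriv 2 \<phi>) k) = (2 * pi) ^ 2 * (of_int k ^ 2 * norm (fourier_coeff \<phi> k))"
      by (simp add: norm_mult power2_eq_square mult_ac)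
    also have "\<dots> \<ge> 1 * (of_int k ^ 2 * norm (fourier_coeff \<phi> k))"
      using pi_gt3 by (intro mult_right_mono one_le_power) auto
    finally have "of_int k ^ 2 * norm (fourier_coeff \<phi> k) \<le> norm (fourier_coeff (iter_deriv 2 \<phi>) k)" by simp
    also have "\<dots> \<le> L" unfolding L_def by (intro norm_fourier_coeff_le integrable_circle_continuous c)
    finally show ?thesis using that by (simp add: field_simps)
  qed
  then show ?thesis by blast
qed

section \<open>Uniform bounds for the means and passage to the limit\<close>

definition cesaro_op :: "(real \<Rightarrow> complex) \<Rightarrow> nat \<Rightarrow> (real \<Rightarrow> complex) \<Rightarrow> real \<Rightarrow> complex" where
  "cesaro_op m N f = trig_poly {- int N..int N} (\<lambda>t. cesaro_weight m N t * fourier_coeff f t)"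

lemma cesaro_op_measurable [measurable]: "cesaro_op m N f \<in> borel_measurable circle"
  unfolding cesaro_op_def by measurable

lemma integrable_cesaro_op [intro, simp]: "integrable circle (cesaro_op m N f)"
  unfolding cesaro_op_def by (rule integrable_trig_poly)

lemma cesaro_op_add:
  "integrable circle f \<Longrightarrow> integrable circle g \<Longrightarrow>
    cesaro_op m N (\<lambda>x. f x + g x) x = cesaro_op m N f x + cesaro_op m N g x"
  by (simp add: cesaro_op_def trig_poly_def fourier_coeff_add sum.distrib algebra_simps)

lemma cesaro_weight_eq_0: "t \<notin> {- int N..int N} \<Longrightarrow> cesaro_weight m N t = 0"
  by (auto simp: cesaro_weight_def intro!: cesaro_eq_0)

lemma norm_cesaro_weight_le: "norm (cesaro_weight m N t) \<le> norm (m (of_int t))"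
  using cesaro_nonneg[of N "nat \<bar>t\<bar>"] cesaro_le_1[of N "nat \<bar>t\<bar>"]
  by (auto simp: cesaro_weight_def norm_mult intro: mult_left_le)

lemma cesaro_weight_tendsto: "(\<lambda>N. cesaro_weight m N t) \<longlonglongrightarrow> m (of_int t)"
  unfolding cesaro_weight_def
  using tendsto_mult[OF tendsto_const[of "m (of_int t)"] tendsto_of_real[OF cesaro_tendsto_1[of "nat \<bar>t\<bar>"]]] by simp

text \<open>\<open>C\<close> is independent of the order \<open>N\<close>, of \<open>f\<close> and
  of \<open>t\<close>, although the splitting of \<open>f\<close> changes with \<open>t\<close>. The
  bound is stated for distribution functions rather than for rearrangements, because in this form it
  passes to limits in L^1.\<close>

lemma cesaro_op_distribution_bound:
  assumes m: "marcinkiewicz_multiplier m"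
  shows "\<exists>C\<ge>0. \<forall>N f t l. integrable circle f \<longrightarrow> 0 < t \<longrightarrow> t < 1 \<longrightarrow>
    ennreal C * (hardy (rearrangement circle f) t + cohardy (rearrangement circle f) t) < ennreal l \<longrightarrow>
    emeasure circle {x \<in> space circle. l < norm (cesaro_op m N f x)} \<le> ennreal t"
proof -
  obtain A where A: "A \<ge> 0" "\<And>N u. 0 < \<bar>u\<bar> \<Longrightarrow> \<bar>u\<bar> \<le> 1/2 \<Longrightarrow>
    norm (\<Sum>t\<in>{- int N..int N}. cesaro_weight m N t * (2 * pi * \<i> * of_int t) * char_fun t u) \<le> A / u ^ 2"
    using kernel_deriv_bound[OF m] by blast
  obtain B where B: "\<And>t. norm (m t) \<le> B" using m by (auto simp: marcinkiewicz_multiplier_def)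
  have B0: "B \<ge> 0" using B[of 0] by (rule order_trans[OF norm_ge_zero])
  define C1 where "C1 = 7 + 18 * B ^ 2 + 72 * A"
  have C1: "C1 \<ge> 0" using A by (simp add: C1_def)
  have "emeasure circle {x \<in> space circle. l < norm (cesaro_op m N f x)} \<le> ennreal t"
    if f: "integrable circle f" and t: "0 < t" "t < 1"
      and l: "ennreal (4 * C1 + 4 * B) * (hardy (rearrangement circle f) t + cohardy (rearrangement circle f) t) < ennreal l"
    for N f t l
  proof -
    interpret cz_kernel "{- int N..int N}" "cesaro_weight m N" A B
    proof
      fix t show "norm (cesaro_weight m N t) \<le> B" using norm_cesaro_weight_le B by (rule order_trans)
    next
      fix u :: real assume "0 < \<bar>u\<bar>" "\<bar>u\<bar> \<le> 1/2"
      then show "norm (trig_poly {- int N..int N} (\<lambda>t. cesaro_weight m N t * (2 * of_real pi * \<i> * of_int t)) u) \<le> A / u ^ 2"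
        using A(2)[of u N] by (simp add: trig_poly_def)
    qed (use A B0 in auto)
    have T: "cesaro_op m N h = T h" for h by (simp add: cesaro_op_def T_def)
    have [measurable]: "f \<in> borel_measurable circle" using f by auto
    define c where "c = enn2real (rearrangement circle f t)"
    define f1 where "f1 = (\<lambda>x. if c < norm (f x) then f x else 0)"
    define f2 where "f2 = (\<lambda>x. if c < norm (f x) then 0 else f x)"
    have [measurable]: "f1 \<in> borel_measurable circle" "f2 \<in> borel_measurable circle"
      unfolding f1_def f2_def by measurable
    have f1: "integrable circle f1" by (rule Bochner_Integration.integrable_bound[OF f]) (auto simp: f1_def)
    have f2: "integrable circle f2" by (rule Bochner_Integration.integrable_bound[OF f]) (auto simp: f2_def)
    have f2b: "norm (f2 x) \<le> c" for x by (auto simp: f2_def c_def)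
    have f12: "f = (\<lambda>x. f1 x + f2 x)" by (auto simp: f1_def f2_def)
    show ?thesis
    proof (rule circle.distribution_bound_of_weak_type[where f = f and ?F1.0 = "T f1" and ?F2.0 = "T f2" and ?C1.0 = C1 and ?C2.0 = B])
      fix x
      have "cesaro_op m N f x = T f1 x + T f2 x"
        using cesaro_op_add[OF f1 f2, of m N x] unfolding f12[symmetric] T .
      then show "norm (cesaro_op m N f x) \<le> norm (T f1 x) + norm (T f2 x)" by (simp add: norm_triangle_ineq)
    next
      fix l :: real assume l: "l > 0"
      have "emeasure circle {x \<in> space circle. l < norm (T f1 x)} \<le> ennreal (C1 / l * (LINT x|circle. norm (f1 x)))"
        unfolding circle.emeasure_eq_measure C1_def using weak_type_1[OF f1 l] by (rule ennreal_leI)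
      also have "\<dots> = ennreal (C1 / l) * (\<integral>\<^sup>+ x. norm (f1 x) \<partial>circle)"
        using f1 C1 l by (subst nn_integral_eq_integral) (auto intro!: ennreal_mult simp del: times_divide_eq_left)
      finally show "emeasure circle {x \<in> space circle. l < norm (T f1 x)}
        \<le> ennreal (C1 / l) * (\<integral>\<^sup>+ x. norm (if enn2real (rearrangement circle f t) < norm (f x) then f x else 0) \<partial>circle)"
        by (simp add: f1_def c_def)
    next
      fix l :: real assume l: "l > 0"
      have i2: "integrable circle (\<lambda>x. norm (f2 x) ^ 2)"
        by (rule integrable_circle_bounded[where B = "c ^ 2"]) (auto intro: power_mono f2b)
      have "emeasure circle {x \<in> space circle. l < norm (T f2 x)} \<le> ennreal ((B / l) ^ 2 * (LINT x|circle. norm (f2 x) ^ 2))"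
        unfolding circle.emeasure_eq_measure by (intro ennreal_leI weak_type_2[where L = c] l f2b) measurable
      also have "\<dots> = ennreal ((B / l) ^ 2) * (\<integral>\<^sup>+ x. ennreal (norm (f2 x) ^ 2) \<partial>circle)"
        using i2 by (subst nn_integral_eq_integral) (auto simp: ennreal_mult)
      finally show "emeasure circle {x \<in> space circle. l < norm (T f2 x)}
        \<le> ennreal ((B / l) ^ 2) * (\<integral>\<^sup>+ x. ennreal (norm (if enn2real (rearrangement circle f t) < norm (f x) then 0 else f x) ^ 2) \<partial>circle)"
        by (simp add: f2_def c_def)
    qed (use t C1 B0 l in auto)
  qed
  moreover have "4 * C1 + 4 * B \<ge> 0" using C1 B0 by simp
  ultimately show ?thesis by blast
qed

lemma rearrangement_le_of_distribution:
  assumes "\<And>l. X < ennreal l \<Longrightarrow> emeasure M {x \<in> space M. l < norm (g x)} \<le> ennreal t"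
  shows "rearrangement M g t \<le> X"
proof (rule ccontr)
  assume "\<not> ?thesis"
  then obtain z where z: "X < z" "z < rearrangement M g t" using dense[of X "rearrangement M g t"] by (auto simp: not_le)
  then obtain r where r: "z = ennreal r" "r \<ge> 0" by (cases z) auto
  have "rearrangement M g t \<le> ennreal r" using assms z r by (intro rearrangement_le) auto
  then show False using z r by simp
qed

text \<open>The integrated Hardy inequality without further averages, with constant 4 = 1 + 3 * 3^0.
  It serves as a bound uniform in \<open>N\<close> for the convergence proof.\<close>

lemma cesaro_op_L1_bound:
  assumes m: "marcinkiewicz_multiplier m"
  shows "\<exists>C. \<forall>N. \<forall>f \<in> LlogL circle 1. (\<integral>\<^sup>+ x. norm (cesaro_op m N f x) \<partial>circle) \<le> ennreal C * LlogL_norm circle 1 f"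
proof -
  obtain C where C: "C \<ge> 0" "\<And>N f t l. integrable circle f \<Longrightarrow> 0 < t \<Longrightarrow> t < 1 \<Longrightarrow>
    ennreal C * (hardy (rearrangement circle f) t + cohardy (rearrangement circle f) t) < ennreal l \<Longrightarrow>
    emeasure circle {x \<in> space circle. l < norm (cesaro_op m N f x)} \<le> ennreal t"
    using cesaro_op_distribution_bound[OF m] by blast
  have "(\<integral>\<^sup>+ x. norm (cesaro_op m N f x) \<partial>circle) \<le> ennreal (C * 4) * LlogL_norm circle 1 f"
    if f: "f \<in> LlogL circle 1" for N f
  proof -
    have fi: "integrable circle f" using f by (rule circle.LlogL_integrable)
    have "(\<integral>\<^sup>+ x. norm (cesaro_op m N f x) \<partial>circle) = (\<integral>\<^sup>+ t \<in> {0..1}. (hardy ^^ 0) (rearrangement circle (cesaro_op m N f)) t \<partial>lborel)"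
      by (simp add: circle.nn_integral_norm_eq_rearrangement)
    also have "\<dots> \<le> ennreal C * (1 + 3 * 3 ^ 0) * (\<integral>\<^sup>+ t \<in> {0..1}. (hardy ^^ Suc 0) (rearrangement circle f) t \<partial>lborel)"
      by (rule nn_integral_hardy_funpow_le)
        (auto intro!: rearrangement_antimono_on rearrangement_le_of_distribution C(2)[OF fi])
    also have "\<dots> = ennreal (C * 4) * LlogL_norm circle 1 f"
      using C(1) by (simp add: LlogL_norm_eq ennreal_mult)
    finally show ?thesis .
  qed
  then show ?thesis by blast
qed

text \<open>On a probability space the L^1 norm is below the L^2 norm, and Parseval turns the latter
  into a weighted sum of |weight difference|^2. The weights converge for every frequency and are
  bounded by \<open>B\<close>, and the squared coefficients are summable by Bessel, so dominated
  convergence applies.\<close>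

lemma cesaro_op_L1_cauchy_bounded:
  assumes m: "marcinkiewicz_multiplier m" and f [measurable]: "f \<in> borel_measurable circle"
    and bd: "\<And>x. x \<in> {0..<1} \<Longrightarrow> norm (f x) \<le> L" and e: "e > 0"
  shows "\<exists>N0. \<forall>i\<ge>N0. \<forall>j\<ge>N0. (LINT x|circle. norm (cesaro_op m i f x - cesaro_op m j f x)) < e"
proof -
  obtain B where B: "\<And>t. norm (m t) \<le> B" using m by (auto simp: marcinkiewicz_multiplier_def)
  have B0: "B \<ge> 0" using B[of 0] by (rule order_trans[OF norm_ge_zero])
  define F where "F = (\<lambda>t. norm (fourier_coeff f t) ^ 2)"
  define u where "u = (\<lambda>N t. norm (cesaro_weight m N t - m (of_int t)) ^ 2 * F t)"
  have F0: "F t \<ge> 0" for t by (simp add: F_def)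
  have Fs: "F summable_on UNIV"
  proof (rule nonneg_bdd_above_summable_on)
    show "bdd_above (sum F ` {S. S \<subseteq> UNIV \<and> finite S})"
      unfolding bdd_above_def F_def
      by (intro exI[of _ "LINT x|circle. norm (f x) ^ 2"]) (auto intro!: bessel[OF f bd])
  qed (simp add: F_def)
  have w: "(\<lambda>t. (2 * B) ^ 2 * F t) summable_on UNIV" using Fs by (rule summable_on_cmult_right)
  have ub: "norm (u N t) \<le> (2 * B) ^ 2 * F t" for N t
  proof -
    have "norm (cesaro_weight m N t - m (of_int t)) \<le> norm (cesaro_weight m N t) + norm (m (of_int t))"
      by (rule norm_triangle_ineq4)
    also have "\<dots> \<le> 2 * B" using norm_cesaro_weight_le[of m N t] B[of "of_int t"] by simp
    finally have "norm (cesaro_weight m N t - m (of_int t)) ^ 2 \<le> (2 * B) ^ 2" by (intro power_mono) auto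
    then have "norm (cesaro_weight m N t - m (of_int t)) ^ 2 * F t \<le> (2 * B) ^ 2 * F t"
      using F0 by (rule mult_right_mono)
    then show ?thesis unfolding u_def using F0[of t] by (simp only: real_norm_def abs_of_nonneg mult_nonneg_nonneg zero_le_power2)
  qed
  have "(\<lambda>N. infsum (u N) UNIV) \<longlonglongrightarrow> infsum (\<lambda>_::int. 0::real) UNIV"
  proof (rule dominated_convergence_infsum(2)[OF w ub])
    fix t
    have "(\<lambda>N. cesaro_weight m N t - m (of_int t)) \<longlonglongrightarrow> m (of_int t) - m (of_int t)"
      by (intro tendsto_diff cesaro_weight_tendsto tendsto_const)
    from tendsto_mult[OF tendsto_power[OF tendsto_norm[OF this]] tendsto_const]
    have "(\<lambda>N. norm (cesaro_weight m N t - m (of_int t)) ^ 2 * F t) \<longlonglongrightarrow> norm (m (of_int t) - m (of_int t)) ^ 2 * F t" .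
    then show "(\<lambda>N. u N t) \<longlonglongrightarrow> 0" by (simp add: u_def)
  qed
  then have "(\<lambda>N. infsum (u N) UNIV) \<longlonglongrightarrow> 0" by simp
  then obtain N0 where N0: "\<And>N. N \<ge> N0 \<Longrightarrow> norm (infsum (u N) UNIV - 0) < e ^ 2 / 4"
    using LIMSEQ_D[of _ 0 "e ^ 2 / 4"] e by (metis divide_pos_pos zero_less_numeral zero_less_power)
  have us: "u N summable_on UNIV" for N
    by (rule summable_on_comparison_test[OF w]) (use ub F0 in \<open>auto simp: u_def\<close>)
  have "(LINT x|circle. norm (cesaro_op m i f x - cesaro_op m j f x)) < e" if ij: "i \<ge> N0" "j \<ge> N0" for i j
  proof -
    define S where "S = {- int (max i j)..int (max i j)}"
    have fS: "finite S" by (simp add: S_def)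
    have op: "cesaro_op m k f x = trig_poly S (\<lambda>t. cesaro_weight m k t * fourier_coeff f t) x" if "k = i \<or> k = j" for k x
      unfolding cesaro_op_def trig_poly_def using that
      by (intro sum.mono_neutral_left fS) (auto simp: S_def cesaro_weight_eq_0)
    define q where "q = (\<lambda>t. (cesaro_weight m i t - cesaro_weight m j t) * fourier_coeff f t)"
    let ?p = "\<lambda>x. norm (trig_poly S q x)"
    have qe: "cesaro_op m i f x - cesaro_op m j f x = trig_poly S q x" for x
      by (simp add: op trig_poly_def q_def sum_subtractf left_diff_distrib)
    have i2: "integrable circle (\<lambda>x. ?p x ^ 2)"
      by (rule integrable_circle_bounded[where B = "(\<Sum>t\<in>S. norm (q t)) ^ 2"])
        (auto intro: power_mono norm_trig_poly_le)
    \<comment> \<open>The variance of \<open>?p\<close> is nonnegative.\<close>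
    have "(LINT x|circle. ?p x) ^ 2 \<le> (LINT x|circle. ?p x ^ 2)"
    proof -
      define a where "a = (LINT x|circle. ?p x)"
      have "0 \<le> (LINT x|circle. (?p x - a) ^ 2)" by simp
      also have "\<dots> = (LINT x|circle. ?p x ^ 2 - 2 * a * ?p x + a ^ 2)"
        by (intro Bochner_Integration.integral_cong refl) (simp add: power2_diff algebra_simps)
      also have "\<dots> = (LINT x|circle. ?p x ^ 2) - 2 * a * a + a ^ 2"
        using i2 integrable_norm[OF integrable_trig_poly[of S q]] by (simp add: a_def circle.prob_space)
      finally show ?thesis by (simp add: a_def power2_eq_square)
    qed
    also have "\<dots> = (\<Sum>t\<in>S. norm (q t) ^ 2)" by (rule parseval_trig_poly[OF fS])
    also have "\<dots> \<le> (\<Sum>t\<in>S. 2 * u i t + 2 * u j t)"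
    proof (rule sum_mono)
      fix t
      define x y where "x = norm (cesaro_weight m i t - m (of_int t))" and "y = norm (cesaro_weight m j t - m (of_int t))"
      have "norm (cesaro_weight m i t - cesaro_weight m j t) \<le> x + y"
        unfolding x_def y_def by norm
      then have "norm (cesaro_weight m i t - cesaro_weight m j t) ^ 2 \<le> (x + y) ^ 2" by (intro power_mono) auto
      also have "\<dots> \<le> 2 * x ^ 2 + 2 * y ^ 2" using sum_squares_bound[of x y] by (simp add: power2_sum)
      finally have "norm (cesaro_weight m i t - cesaro_weight m j t) ^ 2 * F t \<le> (2 * x ^ 2 + 2 * y ^ 2) * F t"
        using F0 by (intro mult_right_mono) auto
      moreover have "norm (q t) ^ 2 = norm (cesaro_weight m i t - cesaro_weight m j t) ^ 2 * F t"
        by (simp add: q_def F_def norm_mult power_mult_distrib)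
      moreover have "2 * u i t + 2 * u j t = (2 * x ^ 2 + 2 * y ^ 2) * F t"
        by (simp add: u_def x_def y_def distrib_right)
      ultimately show "norm (q t) ^ 2 \<le> 2 * u i t + 2 * u j t" by simp
    qed
    also have "\<dots> = 2 * (\<Sum>t\<in>S. u i t) + 2 * (\<Sum>t\<in>S. u j t)" by (simp add: sum.distrib sum_distrib_left)
    also have "\<dots> \<le> 2 * infsum (u i) UNIV + 2 * infsum (u j) UNIV"
      using us F0 fS by (intro add_mono mult_left_mono finite_sum_le_infsum) (auto simp: u_def)
    also have "\<dots> < 2 * (e ^ 2 / 4) + 2 * (e ^ 2 / 4)"
      using N0[OF ij(1)] N0[OF ij(2)] by (simp add: abs_less_iff)
    finally have "(LINT x|circle. ?p x) ^ 2 < e ^ 2" by simp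
    then show ?thesis using e unfolding qe by (rule power2_less_imp_less[OF _ less_imp_le])
  qed
  then show ?thesis by blast
qed

text \<open>The truncation level is fixed first: it makes the means of the tail small for all
  \<open>N\<close> at once. Only then is \<open>N0\<close> chosen for the bounded remainder.\<close>

lemma cesaro_op_L1_convergent:
  assumes m: "marcinkiewicz_multiplier m" and f: "f \<in> LlogL circle 1"
  shows "\<exists>g. integrable circle g \<and> (\<lambda>N. LINT x|circle. norm (cesaro_op m N f x - g x)) \<longlonglongrightarrow> 0"
proof (rule L1_complete[OF integrable_cesaro_op])
  fix e :: real assume e: "e > 0"
  have [measurable]: "f \<in> borel_measurable circle" using f by (simp add: LlogL_def)
  have fi: "integrable circle f" using f by (rule circle.LlogL_integrable)
  obtain C where C: "\<And>N f. f \<in> LlogL circle 1 \<Longrightarrow> (\<integral>\<^sup>+ x. norm (cesaro_op m N f x) \<partial>circle) \<le> ennreal C * LlogL_norm circle 1 f"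
    using cesaro_op_L1_bound[OF m] by blast
  define h where "h = (\<lambda>j x. if real j < norm (f x) then f x else 0)"
  have "(\<lambda>j. ennreal C * LlogL_norm circle 1 (h j)) \<longlonglongrightarrow> ennreal C * 0"
    unfolding h_def by (intro ennreal_tendsto_cmult circle.LlogL_norm_truncation_tendsto_0 f) simp
  then have "\<forall>\<^sub>F j in sequentially. ennreal C * LlogL_norm circle 1 (h j) < ennreal (e / 3)"
    using e by (intro order_tendstoD(2)) auto
  then obtain j where j: "ennreal C * LlogL_norm circle 1 (h j) < ennreal (e / 3)" by (auto dest: eventually_happens)
  define k where "k = (\<lambda>x. f x - h j x)"
  have [measurable]: "h j \<in> borel_measurable circle" "k \<in> borel_measurable circle" unfolding k_def h_def by measurable
  have hi: "integrable circle (h j)" by (rule Bochner_Integration.integrable_bound[OF fi]) (auto simp: h_def)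
  have ki: "integrable circle k" unfolding k_def using fi hi by auto
  have kb: "norm (k x) \<le> real j" for x by (auto simp: k_def h_def)
  have "LlogL_norm circle 1 (h j) \<le> LlogL_norm circle 1 f" by (rule LlogL_norm_mono) (auto simp: h_def)
  also have "\<dots> < \<infinity>" using f by (simp add: LlogL_def)
  finally have hL: "h j \<in> LlogL circle 1" by (simp add: LlogL_def)
  have small: "(LINT x|circle. norm (cesaro_op m N (h j) x)) < e / 3" for N
  proof -
    have "(\<integral>\<^sup>+ x. norm (cesaro_op m N (h j) x) \<partial>circle) < ennreal (e / 3)"
      using C[OF hL, of N] j by order
    then show ?thesis by (subst (asm) nn_integral_eq_integral) (auto simp: ennreal_less_iff)
  qed
  obtain N0 where N0: "\<And>a b. a \<ge> N0 \<Longrightarrow> b \<ge> N0 \<Longrightarrow> (LINT x|circle. norm (cesaro_op m a k x - cesaro_op m b k x)) < e / 3"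
    using cesaro_op_L1_cauchy_bounded[OF m, of k "real j" "e / 3"] kb e by auto
  have split: "cesaro_op m N f x = cesaro_op m N k x + cesaro_op m N (h j) x" for N x
    using cesaro_op_add[OF ki hi, of m N x] by (simp add: k_def)
  have "(LINT x|circle. norm (cesaro_op m a f x - cesaro_op m b f x)) < e" if ab: "a \<ge> N0" "b \<ge> N0" for a b
  proof -
    have "(LINT x|circle. norm (cesaro_op m a f x - cesaro_op m b f x))
      \<le> (LINT x|circle. norm (cesaro_op m a k x - cesaro_op m b k x) + norm (cesaro_op m a (h j) x) + norm (cesaro_op m b (h j) x))"
      unfolding split by (rule integral_mono) (auto, norm)
    also have "\<dots> = (LINT x|circle. norm (cesaro_op m a k x - cesaro_op m b k x)) + (LINT x|circle. norm (cesaro_op m a (h j) x)) + (LINT x|circle. norm (cesaro_op m b (h j) x))"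
      by simp
    also have "\<dots> < e / 3 + e / 3 + e / 3"
      by (intro add_strict_mono N0 small ab)
    finally show ?thesis by simp
  qed
  then show "\<exists>N. \<forall>i\<ge>N. \<forall>j\<ge>N. (LINT x|circle. norm (cesaro_op m i f x - cesaro_op m j f x)) < e" by blast
qed

text \<open>The pairing of the means with a test function has a limit computed in two ways: by L^1
  convergence against a bounded function, and term by term on the Fourier side. There the t-th term
  involves the coefficient of the test function at -t, and the summability of these coefficients
  gives the majorant \<open>w\<close>.\<close>

lemma multiplier_op_of_L1_limit:
  assumes m: "marcinkiewicz_multiplier m" and f: "integrable circle f" and g: "integrable circle g"
    and lim: "(\<lambda>N. LINT x|circle. norm (cesaro_op m N f x - g x)) \<longlonglongrightarrow> 0"
  shows "multiplier_op m f g"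
  unfolding multiplier_op_def
proof (intro conjI f g allI impI)
  fix \<phi> assume \<phi>: "test_function \<phi>"
  have c\<phi>: "continuous_on UNIV \<phi>"
  proof (intro continuous_at_imp_continuous_on ballI)
    fix x
    have "iter_deriv 0 \<phi> differentiable at x" using \<phi> unfolding test_function_def smooth_on_def by blast
    then show "isCont \<phi> x" by (simp add: iter_deriv_def differentiable_imp_continuous_within)
  qed
  note i\<phi> = integrable_circle_continuous(1)[OF c\<phi>]
  then have [measurable]: "\<phi> \<in> borel_measurable circle" by auto
  obtain L where L: "\<And>x. x \<in> {0..<1} \<Longrightarrow> norm (\<phi> x) \<le> L" using integrable_circle_continuous(2)[OF c\<phi>] by blast
  have i\<phi>h: "integrable circle (\<lambda>x. h x * \<phi> x)" if "integrable circle h" for h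
  proof (rule Bochner_Integration.integrable_bound[of circle "\<lambda>x. L * norm (h x)"])
    show "AE x in circle. norm (h x * \<phi> x) \<le> norm (L * norm (h x))"
    proof (rule AE_I2)
      fix x assume "x \<in> space circle"
      then have "norm (\<phi> x) \<le> \<bar>L\<bar>" using L[of x] by (simp add: space_circle)
      then have "norm (\<phi> x) * norm (h x) \<le> \<bar>L\<bar> * norm (h x)" by (intro mult_right_mono) auto
      then show "norm (h x * \<phi> x) \<le> norm (L * norm (h x))" by (simp add: norm_mult abs_mult mult.commute)
    qed
  qed (use that in auto)
  obtain B where B: "\<And>t. norm (m t) \<le> B" using m by (auto simp: marcinkiewicz_multiplier_def)
  have B0: "B \<ge> 0" using B[of 0] by (rule order_trans[OF norm_ge_zero])
  obtain D where D: "\<And>k. k \<noteq> 0 \<Longrightarrow> norm (fourier_coeff \<phi> k) \<le> D / (of_int k) ^ 2"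
    using test_function_fourier_coeff_decay[OF \<phi>] by blast
  have D0: "D \<ge> 0" using D[of 1] by (simp add: order_trans[OF norm_ge_zero])
  define v where "v = (\<lambda>t. m (of_int t) * fourier_coeff f t * fourier_coeff \<phi> (- t))"
  define u where "u = (\<lambda>N t. cesaro_weight m N t * fourier_coeff f t * fourier_coeff \<phi> (- t))"
  define w where "w = (\<lambda>t. B * (LINT x|circle. norm (f x)) * norm (fourier_coeff \<phi> (- t)))"
  have uw: "norm (u N t) \<le> w t" for N t
    unfolding u_def w_def norm_mult
    by (intro mult_right_mono mult_mono norm_fourier_coeff_le f order_trans[OF norm_cesaro_weight_le B] B0) auto
  have ws: "w summable_on UNIV"
    unfolding w_def
  proof (rule summable_on_cmult_right, rule nonneg_bdd_above_summable_on)
    let ?n = "\<lambda>t. norm (fourier_coeff \<phi> (- t))"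
    have "sum ?n S \<le> norm (fourier_coeff \<phi> 0) + 4 * D" if "finite S" for S :: "int set"
    proof -
      define N where "N = nat (\<Sum>t\<in>S. \<bar>t\<bar>)"
      have "\<bar>t\<bar> \<le> int N" if "t \<in> S" for t
        unfolding N_def using member_le_sum[of t S "\<lambda>t. \<bar>t\<bar>"] that \<open>finite S\<close> by (simp add: sum_nonneg)
      then have "S \<subseteq> {- int N..int N}" by (force simp: abs_le_iff)
      then have "sum ?n S \<le> sum ?n {- int N..int N}" by (intro sum_mono2) auto
      also have "\<dots> = norm (fourier_coeff \<phi> 0) + ((\<Sum>t=1..N. ?n (int t)) + (\<Sum>t=1..N. ?n (- int t)))"
        by (simp add: sum_int_symmetric)
      also have "\<dots> \<le> norm (fourier_coeff \<phi> 0) + ((\<Sum>t=1..N. D * (1 / real t ^ 2)) + (\<Sum>t=1..N. D * (1 / real t ^ 2)))"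
      proof (intro add_mono sum_mono order_refl)
        fix t assume "t \<in> {1..N}"
        then show "?n (int t) \<le> D * (1 / real t ^ 2)" "?n (- int t) \<le> D * (1 / real t ^ 2)"
          using D[of "int t"] D[of "- int t"] by auto
      qed
      also have "\<dots> = norm (fourier_coeff \<phi> 0) + 2 * D * (\<Sum>t=1..<Suc N. 1 / real t ^ 2)"
        by (simp add: sum_distrib_left atLeastLessThanSuc_atLeastAtMost)
      also have "\<dots> \<le> norm (fourier_coeff \<phi> 0) + 2 * D * (2 / real 1)"
        using D0 by (intro add_mono mult_left_mono sum_inverse_squares_le) auto
      finally show ?thesis by simp
    qed
    then show "bdd_above (sum ?n ` {S. S \<subseteq> UNIV \<and> finite S})" unfolding bdd_above_def by auto
  qed simp
  have ul: "(\<lambda>N. u N t) \<longlonglongrightarrow> v t" for t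
    unfolding u_def v_def by (intro tendsto_intros cesaro_weight_tendsto)
  have "(\<lambda>N. LINT x|circle. cesaro_op m N f x * \<phi> x) \<longlonglongrightarrow> (LINT x|circle. g x * \<phi> x)"
  proof (rule Lim_null_comparison[THEN LIM_zero_cancel])
    show "\<forall>\<^sub>F N in sequentially. norm ((LINT x|circle. cesaro_op m N f x * \<phi> x) - (LINT x|circle. g x * \<phi> x))
       \<le> L * (LINT x|circle. norm (cesaro_op m N f x - g x))"
    proof (rule always_eventually, rule allI)
      fix N
      have "(LINT x|circle. cesaro_op m N f x * \<phi> x) - (LINT x|circle. g x * \<phi> x) = (LINT x|circle. (cesaro_op m N f x - g x) * \<phi> x)"
        using i\<phi>h[OF integrable_cesaro_op[of m N f]] i\<phi>h[OF g] by (simp add: left_diff_distrib)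
      also have "norm \<dots> \<le> (LINT x|circle. norm ((cesaro_op m N f x - g x) * \<phi> x))"
        by (rule integral_norm_bound)
      also have "\<dots> \<le> (LINT x|circle. L * norm (cesaro_op m N f x - g x))"
      proof (rule integral_mono)
        show "integrable circle (\<lambda>x. norm ((cesaro_op m N f x - g x) * \<phi> x))"
          using g by (intro integrable_norm i\<phi>h) auto
        show "integrable circle (\<lambda>x. L * norm (cesaro_op m N f x - g x))" using g by auto
        fix x assume "x \<in> space circle"
        then have "norm (\<phi> x) \<le> L" using L by (simp add: space_circle)
        then show "norm ((cesaro_op m N f x - g x) * \<phi> x) \<le> L * norm (cesaro_op m N f x - g x)"
          unfolding norm_mult by (subst mult.commute) (rule mult_right_mono, auto)
      qed
      finally show "norm ((LINT x|circle. cesaro_op m N f x * \<phi> x) - (LINT x|circle. g x * \<phi> x))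
       \<le> L * (LINT x|circle. norm (cesaro_op m N f x - g x))" by simp
    qed
    show "(\<lambda>N. L * (LINT x|circle. norm (cesaro_op m N f x - g x))) \<longlonglongrightarrow> 0"
      using tendsto_mult_right_zero[OF lim] by simp
  qed
  moreover have "(LINT x|circle. cesaro_op m N f x * \<phi> x) = infsum (u N) UNIV" for N
  proof -
    have "(LINT x|circle. cesaro_op m N f x * \<phi> x) = (LINT x|circle. \<phi> x * cesaro_op m N f x)" by (simp add: mult.commute)
    also have "\<dots> = (\<Sum>t\<in>{- int N..int N}. u N t)"
      unfolding cesaro_op_def u_def by (rule integral_mult_trig_poly[OF i\<phi>])
    also have "\<dots> = infsum (u N) {- int N..int N}" by simp
    also have "\<dots> = infsum (u N) UNIV"
      by (rule infsum_cong_neutral) (auto simp: u_def cesaro_weight_eq_0)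
    finally show ?thesis .
  qed
  ultimately have "(LINT x|circle. g x * \<phi> x) = infsum v UNIV"
    using dominated_convergence_infsum(2)[OF ws uw ul] LIMSEQ_unique by auto
  moreover have "(LINT x|circle. m (of_int t) * fourier_coeff f t * char_fun t x * \<phi> x) = v t" for t
  proof -
    have "(LINT x|circle. m (of_int t) * fourier_coeff f t * char_fun t x * \<phi> x) = (LINT x|circle. (m (of_int t) * fourier_coeff f t) * (\<phi> x * char_fun t x))"
      by (simp add: mult_ac)
    also have "\<dots> = v t" by (simp add: v_def fourier_coeff_def)
    finally show ?thesis .
  qed
  ultimately show "((\<lambda>t::int. LINT x|circle. m (of_int t) * fourier_coeff f t * char_fun t x * \<phi> x)
           has_sum (LINT x|circle. g x * \<phi> x)) UNIV"
    using dominated_convergence_infsum(1)[OF ws uw ul] by simp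
qed

text \<open>Where |g| exceeds l', either |s N| exceeds \<open>l\<close> or the two functions differ
  by at least l' - l. Markov's inequality makes the second set negligible in the limit; the gap
  between the levels pays for it.\<close>

lemma distribution_bound_L1_limit:
  fixes g :: "real \<Rightarrow> complex"
  assumes g: "integrable circle g"
    and s: "\<And>N::nat. integrable circle (s N)"
    and lim: "(\<lambda>N. LINT x|circle. norm (s N x - g x)) \<longlonglongrightarrow> 0"
    and bd: "\<And>N. emeasure circle {x \<in> space circle. l < norm (s N x)} \<le> ennreal t" and t: "0 \<le> t" and l: "l < l'"
  shows "emeasure circle {x \<in> space circle. l' < norm (g x)} \<le> ennreal t"
proof -
  have [measurable]: "g \<in> borel_measurable circle" "\<And>N. s N \<in> borel_measurable circle" using g s by auto
  define d where "d = l' - l"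
  have d: "d > 0" using l by (simp add: d_def)
  have "measure circle {x \<in> space circle. l' < norm (g x)} \<le> t + (LINT x|circle. norm (s N x - g x)) / d" for N
  proof -
    have "measure circle {x \<in> space circle. l' < norm (g x)} \<le> measure circle ({x \<in> space circle. l < norm (s N x)} \<union> {x \<in> space circle. d \<le> norm (s N x - g x)})"
    proof (rule circle.finite_measure_mono)
      show "{x \<in> space circle. l' < norm (g x)} \<subseteq> {x \<in> space circle. l < norm (s N x)} \<union> {x \<in> space circle. d \<le> norm (s N x - g x)}"
      proof safe
        fix x assume "l' < norm (g x)" "\<not> d \<le> norm (s N x - g x)"
        then show "l < norm (s N x)" using norm_triangle_ineq2[of "g x" "s N x"] by (simp add: d_def norm_minus_commute)
      qed
    qed measurable
    also have "\<dots> \<le> measure circle {x \<in> space circle. l < norm (s N x)} + measure circle {x \<in> space circle. d \<le> norm (s N x - g x)}"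
      by (intro measure_Un_le) auto
    also have "\<dots> \<le> t + (LINT x|circle. norm (s N x - g x)) / d"
      using bd[of N] t d integrable_norm[OF Bochner_Integration.integrable_diff[OF s[of N] g]]
      by (intro add_mono integral_Markov_inequality_measure[where A = "{}"]) (auto simp: circle.emeasure_eq_measure)
    finally show ?thesis .
  qed
  moreover have "(\<lambda>N. t + (LINT x|circle. norm (s N x - g x)) / d) \<longlonglongrightarrow> t + 0 / d"
    using d by (intro tendsto_intros lim) auto
  ultimately have "measure circle {x \<in> space circle. l' < norm (g x)} \<le> t"
    using LIMSEQ_le_const[of _ t] by auto
  then show ?thesis by (simp add: circle.emeasure_eq_measure ennreal_leI)
qed

theorem corollary5p4:
  fixes m :: "real \<Rightarrow> complex" and n :: nat
  assumes "marcinkiewicz_multiplier m"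
    and "n \<ge> 1"
  shows "\<exists>C::real. \<forall>f \<in> LlogL circle n. \<exists>g \<in> LlogL circle (n - 1).
           multiplier_op m f g \<and>
           LlogL_norm circle (n - 1) g \<le> ennreal C * LlogL_norm circle n f"
proof -
  obtain C where C: "C \<ge> 0" "\<And>N f t l. integrable circle f \<Longrightarrow> 0 < t \<Longrightarrow> t < 1 \<Longrightarrow>
    ennreal C * (hardy (rearrangement circle f) t + cohardy (rearrangement circle f) t) < ennreal l \<Longrightarrow>
    emeasure circle {x \<in> space circle. l < norm (cesaro_op m N f x)} \<le> ennreal t"
    using cesaro_op_distribution_bound[OF assms(1)] by blast
  \<comment> \<open>\<open>C\<close> is the constant of the uniform distribution bound; the other
    factor is the cost of n - 1 further averages.\<close>
  define D where "D = C * (1 + 3 * 3 ^ (n - 1))"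
  have "\<exists>g \<in> LlogL circle (n - 1). multiplier_op m f g \<and> LlogL_norm circle (n - 1) g \<le> ennreal D * LlogL_norm circle n f"
    if f: "f \<in> LlogL circle n" for f
  proof -
    have fi: "integrable circle f" using f by (rule circle.LlogL_integrable)
    \<comment> \<open>The existence of the limit rests on the case n = 1 alone; the estimate for the
      given \<open>n\<close> then follows from the pointwise bound on the rearrangement of
      \<open>g\<close>.\<close>
    have f1: "f \<in> LlogL circle 1"
      using f LlogL_norm_index_mono[OF assms(2), of circle f] by (auto simp: LlogL_def)
    obtain g where g: "integrable circle g" and lim: "(\<lambda>N. LINT x|circle. norm (cesaro_op m N f x - g x)) \<longlonglongrightarrow> 0"
      using cesaro_op_L1_convergent[OF assms(1) f1] by blast
    have g_le: "rearrangement circle g t \<le> ennreal C * (hardy (rearrangement circle f) t + cohardy (rearrangement circle f) t)"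
      (is "_ \<le> ?X") if t: "0 < t" "t < 1" for t
    proof (rule rearrangement_le_of_distribution)
      fix l' assume "?X < ennreal l'"
      \<comment> \<open>An intermediate level provides the gap that the passage to the limit
        consumes.\<close>
      then obtain z where z: "?X < z" "z < ennreal l'" using dense by blast
      then obtain l where l: "z = ennreal l" "l \<ge> 0" by (cases z) auto
      have "l < l'" using z l by (simp add: ennreal_less_iff)
      then show "emeasure circle {x \<in> space circle. l' < norm (g x)} \<le> ennreal t"
        using C(2)[OF fi t] z l t by (intro distribution_bound_L1_limit[OF g integrable_cesaro_op lim]) auto
    qed
    have "LlogL_norm circle (n - 1) g \<le> ennreal C * (1 + 3 * 3 ^ (n - 1)) * (\<integral>\<^sup>+ t \<in> {0..1}. (hardy ^^ Suc (n - 1)) (rearrangement circle f) t \<partial>lborel)"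
      unfolding LlogL_norm_eq by (rule nn_integral_hardy_funpow_le) (auto intro!: rearrangement_antimono_on g_le)
    also have "\<dots> = ennreal D * LlogL_norm circle n f"
    proof -
      have "ennreal (1 + 3 * 3 ^ (n - 1)) = 1 + 3 * 3 ^ (n - 1)"
        by (simp add: ennreal_mult ennreal_power[symmetric])
      then have "ennreal C * (1 + 3 * 3 ^ (n - 1)) = ennreal D"
        using C(1) unfolding D_def by (simp add: ennreal_mult')
      moreover have "Suc (n - 1) = n" using assms(2) by simp
      ultimately show ?thesis by (simp only: LlogL_norm_eq)
    qed
    finally have le: "LlogL_norm circle (n - 1) g \<le> ennreal D * LlogL_norm circle n f" .
    also have "\<dots> < \<infinity>" using f by (auto simp: LlogL_def ennreal_mult_less_top)
    finally have "g \<in> LlogL circle (n - 1)" using g by (auto simp: LlogL_def)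
    then show ?thesis using multiplier_op_of_L1_limit[OF assms(1) fi g lim] le by blast
  qed
  then show ?thesis by blast
qed

end
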